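(* Let $n$ be an even positive integer such that $n-1$ is a perfect square. Then there exist a monic polynomial $P\in\mathbb{Z}[X]$ of degree $n$ and a nonzero polynomial $Q\in\mathbb{Z}[X]$ of degree at most $n-1$ such that for every integer $t$, the polynomial $P(X)-tQ(X)$ has Galois group over $\mathbb{Q}$ isomorphic to the alternating group $A_n$.
   Context: The Galois group of a polynomial $f\in\mathbb{Q}[X]$ is the Galois group of its splitting field over $\mathbb{Q}$, viewed as a group of permutations of the roots of $f$. *)

theory Defs
  imports
    Complex_Main
    "HOL-Computational_Algebra.Polynomial"
    "HOL-Computational_Algebra.Nth_Powers"
    "HOL-Algebra.Generated_Fields"
    "HOL-Algebra.QuotRing"
    "HOL-Algebra.Sym_Groups"
    "HOL-Algebra.Algebraic_Closure_Type"
begin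

definition complex_roots :: "rat poly \<Rightarrow> complex set"
  where "complex_roots f = {z. poly (map_poly of_rat f) z = 0}"

text \<open>The splitting field is realised inside the algebraically closed field of complex numbers,
  as the subfield generated over the rationals by the roots.\<close>

definition splitting_field :: "rat poly \<Rightarrow> complex ring"
  where "splitting_field f =
    ring_of_type_algebra
      \<lparr>carrier := generate_field ring_of_type_algebra (\<rat> \<union> complex_roots f)\<rparr>"

definition galois_automorphisms :: "rat poly \<Rightarrow> (complex \<Rightarrow> complex) set"
  where "galois_automorphisms f =
    {\<sigma> \<in> ring_iso (splitting_field f) (splitting_field f). \<forall>q\<in>\<rat>. \<sigma> q = q}"

text \<open>Elements of \<^const>\<open>galois_automorphisms\<close> are unconstrained outside the splitting field;
  passing to the induced permutations of the roots (extended by the identity, as in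
  \<^const>\<open>sym_group\<close>) makes the representation of each automorphism unique.\<close>

definition galois_group :: "rat poly \<Rightarrow> (complex \<Rightarrow> complex) monoid"
  where "galois_group f =
    \<lparr>carrier = {p. p permutes complex_roots f \<and>
        (\<exists>\<sigma>\<in>galois_automorphisms f. \<forall>z\<in>complex_roots f. p z = \<sigma> z)},
     monoid.mult = (\<circ>), one = id\<rparr>"

end

theory Submission
  imports Defs "HOL-Number_Theory.Cong"
begin

text \<open>
  The rational function \<open>X ^ (n - 1) * (X - a) / (X - b)\<close> with \<open>a = n\<^sup>2\<close> and \<open>b = (n - 2)\<^sup>2\<close> has ramification
  types \<open>(n - 1, 1)\<close>, \<open>(n - 1, 1)\<close> and \<open>(3, 1, \<dots>, 1)\<close> over \<open>0\<close>, \<open>\<infinity>\<close> and a third rational point. The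
  discriminant of \<open>f = X ^ (n - 1) * (X - a) - u * (X - b)\<close> is \<open>n - 1\<close> times a square in \<open>u\<close>, so it
  is a square. All that remains is to make the Galois group large for every \<open>u\<close> in some
  arithmetic progression, which local conditions at three primes achieve:
  \<^item> an odd prime \<open>q\<close> dividing \<open>n\<close>, with \<open>q\<close> exactly dividing \<open>u\<close>, makes \<open>f\<close> Eisenstein;
  \<^item> a prime \<open>p\<close> dividing \<open>n - 1\<close>, with \<open>p\<close> exactly dividing \<open>u\<close>, gives a totally ramified factor of
    degree \<open>n - 1\<close>, hence double transitivity;
  \<^item> a prime \<open>l > n\<close> exactly dividing the distance of \<open>u\<close> to the third branch point gives a nontrivial
    inertia element supported on the three roots which coalesce modulo \<open>l\<close>.
  A transposition would change the sign of the square root of the discriminant, so the inertia element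
  is a three-cycle and the group is \<open>A\<^sub>n\<close>. Localisation is done with valuation rings of \<open>\<complex>\<close> above a prime.
\<close>

text \<open>The numerator of the derivative of the rational function is \<open>X ^ (n - 2)\<close>
  times the quadratic \<open>(n - 1) * (X - a) * (X - b) + (a - b) * X\<close>. Its two roots merge
  when \<open>((n - 2) * a + n * b)^2 = 4 * (n - 1)^2 * a * b\<close>. Up to scaling, and apart from
  a = b, the only solution is \<open>a = n^2\<close>, \<open>b = (n - 2)^2\<close>, with double root
  \<open>c = n * (n - 2)\<close>. One mechanism serves all three primes k, in place of ideal
  factorisation and completions: a Galois-invariant sum or product is rational, and a rational
  nonunit of V is divisible by k itself. Two orbits, or trivial inertia, would produce two such
  divisibilities, hence a factor \<open>k^2\<close> of an integer that k divides exactly once. The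
  three conditions depend only on u modulo some N, and f is affine in u. So a single P, with Q a
  multiple of \<open>X - b\<close>, serves all t. For n = 2 there is no odd prime dividing n and no
  prime dividing n - 1, so that degree gets its own polynomials.\<close>

section \<open>Valuation rings above a prime\<close>

text \<open>In \<complex> the value group is divisible, hence not discrete. Sizes are therefore
  compared by asking whether a quotient lies in V. The condition \<open>inverse_p\<close> puts p
  into the maximal ideal.\<close>

locale valuation_ring_above =
  fixes V :: "'a::field_char_0 set" and p :: nat
  assumes prime_p: "prime p"
    and one_closed: "1 \<in> V"
    and diff_closed: "x \<in> V \<Longrightarrow> y \<in> V \<Longrightarrow> x - y \<in> V"
    and mult_closed: "x \<in> V \<Longrightarrow> y \<in> V \<Longrightarrow> x * y \<in> V"
    and inverse_p: "inverse (of_nat p) \<notin> V"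
    and total: "x \<in> V \<or> inverse x \<in> V"

section \<open>Subrings as sets\<close>

definition subring_set :: "'a::comm_ring_1 set \<Rightarrow> bool" where
  "subring_set B \<longleftrightarrow> 1 \<in> B \<and> (\<forall>x\<in>B. \<forall>y\<in>B. x - y \<in> B \<and> x * y \<in> B)"

context
  fixes B :: "'a::comm_ring_1 set"
  assumes B: "subring_set B"
begin

lemma subring_set_one: "1 \<in> B" using B by (simp add: subring_set_def)
lemma subring_set_diff: "x \<in> B \<Longrightarrow> y \<in> B \<Longrightarrow> x - y \<in> B" using B by (simp add: subring_set_def)
lemma subring_set_mult: "x \<in> B \<Longrightarrow> y \<in> B \<Longrightarrow> x * y \<in> B" using B by (simp add: subring_set_def)
lemma subring_set_zero: "0 \<in> B" using subring_set_diff[OF subring_set_one subring_set_one] by simp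
lemma subring_set_uminus: "x \<in> B \<Longrightarrow> - x \<in> B" using subring_set_diff[OF subring_set_zero] by fastforce
lemma subring_set_add: "x \<in> B \<Longrightarrow> y \<in> B \<Longrightarrow> x + y \<in> B"
  using subring_set_diff[of x "- y"] subring_set_uminus by simp
lemma subring_set_sum: "(\<And>i. i \<in> I \<Longrightarrow> f i \<in> B) \<Longrightarrow> sum f I \<in> B"
  by (induction I rule: infinite_finite_induct) (auto intro: subring_set_add subring_set_zero)
lemma subring_set_prod: "(\<And>i. i \<in> I \<Longrightarrow> f i \<in> B) \<Longrightarrow> prod f I \<in> B"
  by (induction I rule: infinite_finite_induct) (auto intro: subring_set_mult subring_set_one)
lemma subring_set_power: "x \<in> B \<Longrightarrow> x ^ k \<in> B"
  by (induction k) (auto intro: subring_set_mult subring_set_one)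
lemma subring_set_of_nat: "of_nat k \<in> B"
  by (induction k) (auto intro: subring_set_add subring_set_one subring_set_zero)
lemma subring_set_of_int: "of_int k \<in> B"
  by (cases k) (auto intro: subring_set_diff subring_set_uminus subring_set_of_nat subring_set_one)

lemma subring_set_coeff_mult:
  "(\<And>i. coeff g i \<in> B) \<Longrightarrow> (\<And>i. coeff h i \<in> B) \<Longrightarrow> coeff (g * h) i \<in> B"
  unfolding coeff_mult by (intro subring_set_sum subring_set_mult)

text \<open>This is the ring \<open>B[x]\<close>, against which the maximality of B will be
  tested.\<close>

lemma subring_set_adjoin: "subring_set {poly g x | g. \<forall>i. coeff g i \<in> B}"
  unfolding subring_set_def
proof safe
  show "\<exists>g. 1 = poly g x \<and> (\<forall>i. coeff g i \<in> B)"
    by (rule exI[of _ 1]) (auto simp: subring_set_one subring_set_zero)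
  fix g h assume gh: "\<forall>i. coeff g i \<in> B" "\<forall>i. coeff h i \<in> B"
  show "\<exists>k. poly g x - poly h x = poly k x \<and> (\<forall>i. coeff k i \<in> B)"
    by (rule exI[of _ "g - h"]) (use gh in \<open>auto intro: subring_set_diff\<close>)
  show "\<exists>k. poly g x * poly h x = poly k x \<and> (\<forall>i. coeff k i \<in> B)"
    by (rule exI[of _ "g * h"]) (use gh in \<open>auto intro: subring_set_coeff_mult\<close>)
qed

end

section \<open>Existence of a valuation ring above p\<close>

lemma exists_maximal_subring:
  assumes "prime p"
  shows "\<exists>B :: 'a::field_char_0 set. subring_set B \<and> inverse (of_nat p) \<notin> B \<and>
    (\<forall>C. subring_set C \<longrightarrow> inverse (of_nat p) \<notin> C \<longrightarrow> B \<subseteq> C \<longrightarrow> C = B)"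
proof -
  let ?F = "{B :: 'a set. subring_set B \<and> inverse (of_nat p) \<notin> B}"
  have "inverse (of_nat p :: 'a) \<notin> \<int>"
  proof
    assume "inverse (of_nat p :: 'a) \<in> \<int>"
    then obtain k where "inverse (of_nat p :: 'a) = of_int k" by (auto elim: Ints_cases)
    then have "(of_int (int p * k) :: 'a) = of_int 1" using assms
      by (simp add: field_simps prime_gt_0_nat inverse_eq_divide)
    then have "int p * k = 1" by (simp only: of_int_eq_iff)
    then have "int p dvd 1" by (metis dvd_triv_left)
    then show False using assms by (simp add: prime_nat_iff)
  qed
  then have "\<int> \<in> ?F" by (auto simp: subring_set_def)
  then have ne: "?F \<noteq> {}" by blast
  have "\<exists>M\<in>?F. \<forall>C\<in>?F. M \<subseteq> C \<longrightarrow> C = M"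
  proof (rule subset_Zorn_nonempty[OF ne])
    fix C assume C: "C \<noteq> {}" "subset.chain ?F C"
    have sub: "\<And>B. B \<in> C \<Longrightarrow> B \<in> ?F" and ch: "\<And>A B. A \<in> C \<Longrightarrow> B \<in> C \<Longrightarrow> A \<subseteq> B \<or> B \<subseteq> A"
      using C(2) by (auto simp: subset_chain_def)
    have "x - y \<in> \<Union>C \<and> x * y \<in> \<Union>C" if "x \<in> \<Union>C" "y \<in> \<Union>C" for x y
    proof -
      obtain A B where AB: "A \<in> C" "B \<in> C" "x \<in> A" "y \<in> B" using \<open>x \<in> \<Union>C\<close> \<open>y \<in> \<Union>C\<close> by blast
      then obtain D where "D \<in> C" "x \<in> D" "y \<in> D" using ch[of A B] by blast
      then show ?thesis using sub[of D] by (auto simp: subring_set_def)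
    qed
    moreover have "1 \<in> \<Union>C" using C(1) sub by (force simp: subring_set_def)
    ultimately show "\<Union>C \<in> ?F" using sub by (auto simp: subring_set_def)
  qed
  then show ?thesis by blast
qed

text \<open>A subring maximal among those omitting 1/p is a valuation ring. If neither x nor 1/x lay
  in B, then both \<open>B[x]\<close> and \<open>B[1/x]\<close> would contain 1/p; of two
  expressions of 1/p of least degree, the longer could be shortened by means of the other.\<close>

theorem exists_valuation_ring_above:
  assumes p: "prime p"
  shows "\<exists>V :: 'a::field_char_0 set. valuation_ring_above V p"
proof -
  obtain B :: "'a set" where B: "subring_set B" and pB: "inverse (of_nat p) \<notin> B"
    and max: "\<And>C. subring_set C \<Longrightarrow> inverse (of_nat p) \<notin> C \<Longrightarrow> B \<subseteq> C \<Longrightarrow> C = B"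
    using exists_maximal_subring[OF p] by blast
  note cl = subring_set_one[OF B] subring_set_zero[OF B] subring_set_diff[OF B] subring_set_mult[OF B]
    subring_set_add[OF B] subring_set_uminus[OF B] subring_set_sum[OF B] subring_set_power[OF B]
    subring_set_of_nat[OF B]
  have p0: "(of_nat p :: 'a) \<noteq> 0" using p by auto
  have adj: "\<exists>g. (\<forall>i. coeff g i \<in> B) \<and> poly g x = inverse (of_nat p)" if "x \<notin> B" for x
  proof -
    let ?C = "{poly g x | g. \<forall>i. coeff g i \<in> B}"
    have "B \<subseteq> ?C"
    proof
      fix c assume "c \<in> B"
      then show "c \<in> ?C" by (intro CollectI exI[of _ "[:c:]"]) (auto simp: cl coeff_pCons split: nat.splits)
    qed
    moreover have "x \<in> ?C"
      by (intro CollectI exI[of _ "[:0,1:]"]) (auto simp: cl coeff_pCons split: nat.splits)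
    ultimately have "inverse (of_nat p) \<in> ?C"
      using max[OF subring_set_adjoin[OF B, of x]] \<open>x \<notin> B\<close> by blast
    then show ?thesis by force
  qed
  \<comment> \<open>Otherwise 1/p is a polynomial in \<open>inverse e\<close>. Clearing denominators
    puts \<open>e ^ d / p\<close> into B, and since \<open>e ^ d\<close> is 1 modulo p, this puts
    1/p into B.\<close>
  have unit: "inverse (1 - of_nat p * c) \<in> B" if c: "c \<in> B" for c
  proof (rule ccontr)
    define e where "e = 1 - of_nat p * c"
    have eB: "e \<in> B" unfolding e_def by (intro cl c)
    have e0: "e \<noteq> 0"
    proof
      assume "e = 0"
      then have "inverse (of_nat p) = c" using p0 by (simp add: e_def field_simps)
      then show False using pB c by simp
    qed
    assume "inverse (1 - of_nat p * c) \<notin> B"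
    then obtain g where g: "\<And>i. coeff g i \<in> B" "poly g (inverse e) = inverse (of_nat p)"
      using adj unfolding e_def by blast
    define d where "d = degree g"
    have "e ^ d * poly g (inverse e) = (\<Sum>i\<le>d. coeff g i * e ^ (d - i))"
      unfolding poly_altdef d_def sum_distrib_left
      by (rule sum.cong) (use e0 in \<open>auto simp: power_diff field_simps\<close>)
    then have *: "e ^ d * inverse (of_nat p) \<in> B" using g by (simp add: cl eB)
    have "\<exists>b\<in>B. e ^ k = 1 - of_nat p * b" for k
    proof (induction k)
      case 0 show ?case by (rule bexI[of _ 0]) (auto simp: cl)
    next
      case (Suc k)
      then obtain b where b: "b \<in> B" "e ^ k = 1 - of_nat p * b" by blast
      show ?case
      proof (rule bexI[of _ "c + b - of_nat p * b * c"])
        have "e ^ Suc k = e * (1 - of_nat p * b)" using b by simp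
        then show "e ^ Suc k = 1 - of_nat p * (c + b - of_nat p * b * c)"
          by (simp add: e_def algebra_simps)
      qed (intro cl b c)
    qed
    then obtain b where b: "b \<in> B" "e ^ d = 1 - of_nat p * b" by blast
    have "inverse (of_nat p) = e ^ d * inverse (of_nat p) + b" using p0 b by (simp add: field_simps)
    moreover have "e ^ d * inverse (of_nat p) + b \<in> B" by (intro cl * b)
    ultimately show False using pB by simp
  qed
  let ?P = "\<lambda>x d. \<exists>g. (\<forall>i. coeff g i \<in> B) \<and> degree g \<le> d \<and> poly g x = inverse (of_nat p)"
  \<comment> \<open>Dividing the relation for y by the unit \<open>1 - of_nat p * coeff h 0\<close>
    and multiplying by \<open>x ^ N\<close> expresses \<open>x ^ N\<close> through lower powers of
    x. Substituting this for the top term of g yields a relation of degree below the minimum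
    N.\<close>
  have key: False if xy: "x * y = 1" and N: "?P x N" "\<And>d. ?P x d \<Longrightarrow> N \<le> d" and M: "?P y M" and MN: "M \<le> N"
    for x y :: 'a and N M
  proof -
    obtain g where g: "\<And>i. coeff g i \<in> B" "degree g \<le> N" "poly g x = inverse (of_nat p)" using N by blast
    obtain h where h: "\<And>i. coeff h i \<in> B" "degree h \<le> M" "poly h y = inverse (of_nat p)" using M by blast
    have "N \<noteq> 0"
    proof
      assume "N = 0"
      then obtain c where "g = [:c:]" using g(2) by (metis degree_eq_zeroE le_zero_eq)
      then show False using g(3) g(1)[of 0] pB by simp
    qed
    define e where "e = inverse (1 - of_nat p * coeff h 0)"
    have eB: "e \<in> B" unfolding e_def by (intro unit h)
    have e0: "1 - of_nat p * coeff h 0 \<noteq> 0"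
    proof
      assume "1 - of_nat p * coeff h 0 = 0"
      then have "inverse (of_nat p) = coeff h 0" using p0 by (simp add: field_simps)
      then show False using pB h(1)[of 0] by simp
    qed
    have "inverse (of_nat p) = (\<Sum>i\<le>M. coeff h i * y ^ i)"
      unfolding h(3)[symmetric] poly_altdef
      by (rule sum.mono_neutral_left) (use h(2) in \<open>auto simp: coeff_eq_0\<close>)
    also have "\<dots> = coeff h 0 + (\<Sum>i=1..M. coeff h i * y ^ i)"
      by (simp only: sum.atMost_shift sum.atLeast1_atMost_eq One_nat_def power_0 mult_1_right)
    finally have "1 - of_nat p * coeff h 0 = of_nat p * (\<Sum>i=1..M. coeff h i * y ^ i)"
      using p0 by (simp add: field_simps)
    then have 1: "1 = e * of_nat p * (\<Sum>i=1..M. coeff h i * y ^ i)"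
      using e0 by (simp add: e_def field_simps)
    have yx: "y ^ i * x ^ N = x ^ (N - i)" if "i \<le> N" for i
    proof -
      have "x ^ N = x ^ i * x ^ (N - i)" using that power_add[of x i "N - i"] by simp
      moreover have "y ^ i * (x ^ i * x ^ (N - i)) = (x * y) ^ i * x ^ (N - i)"
        by (simp only: power_mult_distrib mult_ac)
      ultimately show ?thesis using xy by simp
    qed
    have xN: "x ^ N = (\<Sum>i=1..M. e * of_nat p * coeff h i * x ^ (N - i))"
    proof -
      have "x ^ N = (e * of_nat p * (\<Sum>i=1..M. coeff h i * y ^ i)) * x ^ N" using 1 by simp
      also have "\<dots> = (\<Sum>i=1..M. e * of_nat p * coeff h i * (y ^ i * x ^ N))"
        by (simp add: sum_distrib_left sum_distrib_right mult.assoc)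
      also have "\<dots> = (\<Sum>i=1..M. e * of_nat p * coeff h i * x ^ (N - i))"
        using MN by (intro sum.cong) (auto simp: yx)
      finally show ?thesis .
    qed
    define g' where "g' = g - monom (coeff g N) N
      + (\<Sum>i=1..M. monom (coeff g N * (e * of_nat p * coeff h i)) (N - i))"
    have "poly g' x = poly g x - coeff g N * x ^ N
        + coeff g N * (\<Sum>i=1..M. e * of_nat p * coeff h i * x ^ (N - i))"
      by (simp add: g'_def poly_monom poly_sum sum_distrib_left mult.assoc)
    then have "poly g' x = inverse (of_nat p)" using g(3) xN by simp
    moreover have "\<forall>i. coeff g' i \<in> B"
      unfolding g'_def by (auto simp: coeff_sum intro!: cl g h eB)
    moreover have "degree g' \<le> N - 1"
    proof (rule degree_le, intro allI impI)
      fix i assume i: "N - 1 < i"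
      have "coeff (monom (coeff g N * (e * of_nat p * coeff h j)) (N - j)) i = 0" if "j \<in> {1..M}" for j
        using that i by auto
      moreover have "coeff (g - monom (coeff g N) N) i = 0"
        using i g(2) \<open>N \<noteq> 0\<close> by (cases "i = N") (auto simp: coeff_eq_0)
      ultimately show "coeff g' i = 0" by (simp add: g'_def coeff_sum)
    qed
    ultimately have "N \<le> N - 1" by (intro N(2)) blast
    then show False using \<open>N \<noteq> 0\<close> by simp
  qed
  have "x \<in> B \<or> inverse x \<in> B" for x
  proof (rule ccontr)
    assume "\<not> (x \<in> B \<or> inverse x \<in> B)"
    then have x: "x \<notin> B" "inverse x \<notin> B" by auto
    then have x0: "x \<noteq> 0" using cl by auto
    have ex: "\<exists>d. ?P x d" "\<exists>d. ?P (inverse x) d" using adj[OF x(1)] adj[OF x(2)] by blast+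
    define N where "N = (LEAST d. ?P x d)"
    define M where "M = (LEAST d. ?P (inverse x) d)"
    have N: "?P x N" "\<And>d. ?P x d \<Longrightarrow> N \<le> d"
      unfolding N_def by (fact LeastI_ex[OF ex(1)], fact Least_le)
    have M: "?P (inverse x) M" "\<And>d. ?P (inverse x) d \<Longrightarrow> M \<le> d"
      unfolding M_def by (fact LeastI_ex[OF ex(2)], fact Least_le)
    have xi: "x * inverse x = 1" "inverse x * x = 1" using x0 by auto
    show False
    proof (cases "M \<le> N")
      case True
      show ?thesis by (rule key[of x "inverse x" N M, OF xi(1) N(1) N(2) M(1) True])
    next
      case False
      then have NM: "N \<le> M" by simp
      show ?thesis by (rule key[of "inverse x" x M N, OF xi(2) M(1) M(2) N(1) NM])
    qed
  qed
  then have "valuation_ring_above B p"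
    by unfold_locales (use p pB cl in auto)
  then show ?thesis ..
qed

section \<open>The maximal ideal, and its intersection with the integers and the rationals\<close>

context valuation_ring_above
begin

lemma subring: "subring_set V"
  by (simp add: subring_set_def one_closed diff_closed mult_closed)

lemmas zero_closed = subring_set_zero[OF subring]
  and add_closed = subring_set_add[OF subring]
  and uminus_closed = subring_set_uminus[OF subring]
  and sum_closed = subring_set_sum[OF subring]
  and prod_closed = subring_set_prod[OF subring]
  and power_closed = subring_set_power[OF subring]
  and of_nat_closed = subring_set_of_nat[OF subring]
  and of_int_closed = subring_set_of_int[OF subring]

lemmas closed = one_closed zero_closed diff_closed mult_closed add_closed uminus_closed
  sum_closed prod_closed power_closed of_nat_closed of_int_closed

text \<open>The case \<open>x = 0\<close> is listed separately because \<open>inverse 0 = 0\<close>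
  lies in V.\<close>

definition nonunits :: "'a set" where
  "nonunits = {x \<in> V. x = 0 \<or> inverse x \<notin> V}"

lemma nonunits_subset: "x \<in> nonunits \<Longrightarrow> x \<in> V"
  by (simp add: nonunits_def)

lemma zero_nonunit: "0 \<in> nonunits"
  by (simp add: nonunits_def closed)

lemma one_not_nonunit: "1 \<notin> nonunits"
  by (simp add: nonunits_def closed)

lemma p_nonzero: "(of_nat p :: 'a) \<noteq> 0"
  using prime_p by auto

lemma p_nonunit: "of_nat p \<in> nonunits"
  using inverse_p by (simp add: nonunits_def closed)

lemma unit_inverse: "x \<in> V \<Longrightarrow> x \<notin> nonunits \<Longrightarrow> inverse x \<in> V"
  by (auto simp: nonunits_def)

lemma mult_nonunit:
  assumes "x \<in> nonunits" "y \<in> V" shows "x * y \<in> nonunits"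
proof (cases "x * y = 0")
  case False
  have "inverse (x * y) \<notin> V"
  proof
    assume "inverse (x * y) \<in> V"
    then have "y * inverse (x * y) \<in> V" using assms by (simp add: closed)
    moreover have "y * inverse (x * y) = inverse x" using False by (simp add: field_simps)
    ultimately have "inverse x \<in> V" by (simp only:)
    then show False using assms False by (auto simp: nonunits_def)
  qed
  then show ?thesis using assms by (simp add: nonunits_def closed)
qed (use assms in \<open>auto simp: nonunits_def closed\<close>)

lemma nonunit_prime: "x * y \<in> nonunits \<Longrightarrow> x \<in> V \<Longrightarrow> y \<in> V \<Longrightarrow> x \<in> nonunits \<or> y \<in> nonunits"
  by (auto simp: nonunits_def closed)

lemma nonunit_power: "x ^ k \<in> nonunits \<Longrightarrow> x \<in> V \<Longrightarrow> x \<in> nonunits"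
  by (induction k) (auto simp: one_not_nonunit dest!: nonunit_prime intro: power_closed)

lemma nonunit_prod:
  assumes "finite I" "prod g I \<in> nonunits" "\<And>i. i \<in> I \<Longrightarrow> g i \<in> V"
  shows "\<exists>i\<in>I. g i \<in> nonunits"
  using assms
  by (induction I rule: finite_induct) (auto simp: one_not_nonunit dest!: nonunit_prime intro: prod_closed)

lemma prod_nonunit:
  assumes "finite I" "i \<in> I" "g i \<in> nonunits" "\<And>i. i \<in> I \<Longrightarrow> g i \<in> V"
  shows "prod g I \<in> nonunits"
proof -
  have "prod g I = g i * prod g (I - {i})" using assms by (simp add: prod.remove)
  also have "\<dots> \<in> nonunits" by (intro mult_nonunit assms prod_closed) (use assms in auto)
  finally show ?thesis .
qed

lemma dvd_total:
  assumes "x \<noteq> 0" "y \<noteq> 0" shows "x / y \<in> V \<or> y / x \<in> V"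
  using total[of "x / y"] assms by (simp add: field_simps)

text \<open>One of two nonzero elements divides the other in V and can be factored out of the
  sum.\<close>

lemma add_nonunit:
  assumes "x \<in> nonunits" "y \<in> nonunits" shows "x + y \<in> nonunits"
proof (cases "x = 0 \<or> y = 0")
  case False
  then consider "x / y \<in> V" | "y / x \<in> V" using dvd_total by blast
  then show ?thesis
  proof cases
    case 1
    have "y * (1 + x / y) \<in> nonunits" by (intro mult_nonunit closed assms 1)
    then show ?thesis using False by (simp add: field_simps)
  next
    case 2
    have "x * (1 + y / x) \<in> nonunits" by (intro mult_nonunit closed assms 2)
    then show ?thesis using False by (simp add: field_simps)
  qed
qed (use assms in auto)

lemma uminus_nonunit: "x \<in> nonunits \<Longrightarrow> - x \<in> nonunits"
  using mult_nonunit[of x "-1"] by (simp add: closed)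

lemma diff_nonunit: "x \<in> nonunits \<Longrightarrow> y \<in> nonunits \<Longrightarrow> x - y \<in> nonunits"
  using add_nonunit[of x "- y"] uminus_nonunit by simp

lemma sum_nonunit: "(\<And>i. i \<in> I \<Longrightarrow> g i \<in> nonunits) \<Longrightarrow> sum g I \<in> nonunits"
  by (induction I rule: infinite_finite_induct) (auto intro: add_nonunit zero_nonunit)

text \<open>An integer prime to p has a Bezout relation with p, which would put 1 into the maximal
  ideal.\<close>

lemma of_int_nonunit: "of_int k \<in> nonunits \<longleftrightarrow> int p dvd k"
proof
  assume k: "of_int k \<in> nonunits"
  show "int p dvd k"
  proof (rule ccontr)
    assume "\<not> int p dvd k"
    then have "coprime (int p) k" using prime_p by (simp add: prime_imp_coprime)
    then obtain s t where "s * int p + t * k = 1" by (metis bezout_int coprime_imp_gcd_eq_1)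
    then have "(of_int (s * int p + t * k) :: 'a) = 1" by simp
    then have "1 = of_nat p * of_int s + of_int k * (of_int t :: 'a)" by (simp add: algebra_simps)
    moreover have "of_nat p * of_int s + of_int k * (of_int t :: 'a) \<in> nonunits"
      by (intro add_nonunit mult_nonunit closed k p_nonunit)
    ultimately show False using one_not_nonunit by simp
  qed
next
  assume "int p dvd k"
  then obtain j where "k = int p * j" by blast
  then show "of_int k \<in> nonunits" using mult_nonunit[OF p_nonunit of_int_closed[of j]] by simp
qed

text \<open>This carries divisibility in V back to the integers, where it contradicts the exact
  powers prescribed for \<open>u\<close>.\<close>

lemma of_int_divide_p_power: "of_int k / of_nat p ^ j \<in> V \<Longrightarrow> int p ^ j dvd k"
proof (induction j arbitrary: k)
  case (Suc j)
  have "of_nat p * (of_nat p ^ j * (of_int k / of_nat p ^ Suc j) :: 'a) \<in> nonunits"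
    by (intro mult_nonunit p_nonunit closed Suc.prems)
  moreover have "of_nat p * (of_nat p ^ j * (of_int k / of_nat p ^ Suc j)) = (of_int k :: 'a)"
    using p_nonzero by (simp add: field_simps)
  ultimately have "(of_int k :: 'a) \<in> nonunits" by (simp only:)
  then have "int p dvd k" using of_int_nonunit by blast
  then obtain i where i: "k = int p * i" by blast
  have "of_int k / of_nat p ^ Suc j = (of_int i / of_nat p ^ j :: 'a)"
    using p_nonzero by (simp add: i field_simps)
  then show ?case using Suc i by simp
qed simp

text \<open>V meets \<rat> in the localisation of the integers at p, so p is a uniformiser for
  rational numbers although it is none in \<complex>. This step from "nonunit" to "divisible by p"
  drives all three local arguments.\<close>

lemma rational_nonunit:
  assumes "x \<in> \<rat>" "x \<in> nonunits" shows "x / of_nat p \<in> V"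
proof -
  obtain r where r: "x = of_rat r" using assms(1) by (auto elim: Rats_cases)
  obtain a b where ab: "quotient_of r = (a, b)" by (cases "quotient_of r")
  have b: "b > 0" "coprime a b" using ab quotient_of_denom_pos quotient_of_coprime by blast+
  have "x = of_int a / of_int b" using r quotient_of_div[OF ab] by (simp add: of_rat_divide)
  then have a: "of_int a = x * of_int b" using b by simp
  then have "of_int a \<in> nonunits" using mult_nonunit[OF assms(2) of_int_closed[of b]] by simp
  then have pa: "int p dvd a" by (simp add: of_int_nonunit)
  then obtain c where c: "a = int p * c" by blast
  have "\<not> int p dvd b" using coprime_common_divisor[OF b(2) pa] prime_p by auto
  then have "inverse (of_int b) \<in> V" by (intro unit_inverse closed) (simp add: of_int_nonunit)
  then have "of_int c * inverse (of_int b :: 'a) \<in> V" by (intro closed)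
  moreover have "x / of_nat p = of_int c * inverse (of_int b)"
    using a c b p_nonzero by (simp add: field_simps)
  ultimately show ?thesis by simp
qed

text \<open>If \<open>x\<close> were outside, then \<open>1/x\<close> would be a nonunit dividing the unit leading coefficient.\<close>

lemma monic_root_closed:
  assumes "lead_coeff g = 1" "\<And>i. coeff g i \<in> V" "poly g x = 0"
  shows "x \<in> V"
proof (rule ccontr)
  assume x: "x \<notin> V"
  then have x0: "x \<noteq> 0" and y: "inverse x \<in> nonunits" using total[of x] zero_closed by (auto simp: nonunits_def)
  define d where "d = degree g"
  have d: "d \<noteq> 0"
  proof
    assume "d = 0"
    then obtain c where c: "g = [:c:]" unfolding d_def by (metis degree_eq_zeroE)
    then show False using assms(1,3) by simp
  qed
  have "0 = inverse x ^ d * poly g x" using assms by simp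
  also have "\<dots> = (\<Sum>i\<le>d. coeff g i * inverse x ^ (d - i))"
    unfolding poly_altdef d_def sum_distrib_left
    by (rule sum.cong) (use x0 in \<open>auto simp: power_diff field_simps\<close>)
  also have "\<dots> = 1 + (\<Sum>i<d. coeff g i * inverse x ^ (d - i))"
    using assms(1) by (simp add: d_def lessThan_Suc_atMost[symmetric])
  finally have "1 = - (\<Sum>i<d. coeff g i * inverse x ^ (d - i))" by (simp add: eq_neg_iff_add_eq_0)
  moreover have "- (\<Sum>i<d. coeff g i * inverse x ^ (d - i)) \<in> nonunits"
  proof (intro uminus_nonunit sum_nonunit)
    fix i assume "i \<in> {..<d}"
    then have "inverse x ^ (d - i) = inverse x * inverse x ^ (d - i - 1)"
      by (metis One_nat_def Suc_diff_Suc diff_Suc_eq_diff_pred lessThan_iff minus_nat.diff_0 power_Suc diff_commute)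
    then show "coeff g i * inverse x ^ (d - i) \<in> nonunits"
      using y nonunits_subset[OF y] assms(2)
      by (metis mult.commute mult_nonunit power_closed)
  qed
  ultimately show False using one_not_nonunit by simp
qed

end

section \<open>Extension of field homomorphisms\<close>

definition subfield_set :: "'a::field set \<Rightarrow> bool" where
  "subfield_set E \<longleftrightarrow> subring_set E \<and> (\<forall>x\<in>E. inverse x \<in> E)"

text \<open>An embedding of the subfield E into the ambient field: values off E are arbitrary and
  the image may leave E, so that it can be extended generator by generator.\<close>

definition hom_on :: "'a::field set \<Rightarrow> ('a \<Rightarrow> 'a) \<Rightarrow> bool" where
  "hom_on E \<tau> \<longleftrightarrow> \<tau> 1 = 1 \<and> (\<forall>x\<in>E. \<forall>y\<in>E. \<tau> (x + y) = \<tau> x + \<tau> y \<and> \<tau> (x * y) = \<tau> x * \<tau> y)"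

abbreviation poly_over :: "'a::zero set \<Rightarrow> 'a poly \<Rightarrow> bool" where
  "poly_over E g \<equiv> \<forall>i. coeff g i \<in> E"

lemma hom_on_subset: "hom_on E \<tau> \<Longrightarrow> D \<subseteq> E \<Longrightarrow> hom_on D \<tau>"
  unfolding hom_on_def by blast

lemma subfield_imp_subring: "subfield_set E \<Longrightarrow> subring_set E"
  by (simp add: subfield_set_def)

context
  fixes E :: "'a::field set" and \<tau> :: "'a \<Rightarrow> 'a"
  assumes E: "subfield_set E" and hom: "hom_on E \<tau>"
begin

private lemmas Er = subfield_imp_subring[OF E]

lemma hom_on_one: "\<tau> 1 = 1" using hom by (simp add: hom_on_def)
lemma hom_on_add: "x \<in> E \<Longrightarrow> y \<in> E \<Longrightarrow> \<tau> (x + y) = \<tau> x + \<tau> y" using hom by (simp add: hom_on_def)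
lemma hom_on_mult: "x \<in> E \<Longrightarrow> y \<in> E \<Longrightarrow> \<tau> (x * y) = \<tau> x * \<tau> y" using hom by (simp add: hom_on_def)
lemma hom_on_zero: "\<tau> 0 = 0" using hom_on_add[of 0 0] subring_set_zero[OF Er]
  by (metis add.right_neutral add_cancel_right_right)
lemma hom_on_uminus: "x \<in> E \<Longrightarrow> \<tau> (- x) = - \<tau> x"
  using hom_on_add[of x "- x"] subring_set_uminus[OF Er] hom_on_zero by (simp add: eq_neg_iff_add_eq_0 add.commute)
lemma hom_on_diff: "x \<in> E \<Longrightarrow> y \<in> E \<Longrightarrow> \<tau> (x - y) = \<tau> x - \<tau> y"
  using hom_on_add[of x "- y"] subring_set_uminus[OF Er] hom_on_uminus by simp
lemma hom_on_sum: "(\<And>i. i \<in> I \<Longrightarrow> g i \<in> E) \<Longrightarrow> \<tau> (sum g I) = (\<Sum>i\<in>I. \<tau> (g i))"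
  by (induction I rule: infinite_finite_induct) (auto simp: hom_on_zero hom_on_add subring_set_sum[OF Er])
lemma hom_on_prod: "(\<And>i. i \<in> I \<Longrightarrow> g i \<in> E) \<Longrightarrow> \<tau> (prod g I) = (\<Prod>i\<in>I. \<tau> (g i))"
  by (induction I rule: infinite_finite_induct) (auto simp: hom_on_one hom_on_mult subring_set_prod[OF Er])
lemma hom_on_power: "x \<in> E \<Longrightarrow> \<tau> (x ^ k) = \<tau> x ^ k"
  by (induction k) (auto simp: hom_on_one hom_on_mult subring_set_power[OF Er])
lemma hom_on_nonzero: "x \<in> E \<Longrightarrow> x \<noteq> 0 \<Longrightarrow> \<tau> x \<noteq> 0"
  using hom_on_mult[of x "inverse x"] E hom_on_one by (auto simp: subfield_set_def)
lemma hom_on_inverse: "x \<in> E \<Longrightarrow> \<tau> (inverse x) = inverse (\<tau> x)"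
  using hom_on_mult[of x "inverse x"] E hom_on_one hom_on_zero
  by (cases "x = 0") (auto simp: subfield_set_def inverse_unique)
lemma hom_on_inj: "inj_on \<tau> E"
proof (rule inj_onI)
  fix x y assume xy: "x \<in> E" "y \<in> E" "\<tau> x = \<tau> y"
  then show "x = y" using hom_on_nonzero[of "x - y"] hom_on_diff[of x y] subring_set_diff[OF Er] by auto
qed

lemma hom_on_map_poly_add:
  "poly_over E g \<Longrightarrow> poly_over E h \<Longrightarrow> map_poly \<tau> (g + h) = map_poly \<tau> g + map_poly \<tau> h"
  by (rule poly_eqI) (simp add: coeff_map_poly hom_on_zero hom_on_add)

lemma hom_on_map_poly_diff:
  "poly_over E g \<Longrightarrow> poly_over E h \<Longrightarrow> map_poly \<tau> (g - h) = map_poly \<tau> g - map_poly \<tau> h"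
  by (rule poly_eqI) (simp add: coeff_map_poly hom_on_zero hom_on_diff)

lemma hom_on_map_poly_mult:
  "poly_over E g \<Longrightarrow> poly_over E h \<Longrightarrow> map_poly \<tau> (g * h) = map_poly \<tau> g * map_poly \<tau> h"
  by (rule poly_eqI)
    (simp add: coeff_map_poly hom_on_zero coeff_mult hom_on_sum hom_on_mult subring_set_mult[OF Er])

lemma hom_on_degree: "poly_over E g \<Longrightarrow> degree (map_poly \<tau> g) = degree g"
  using hom_on_nonzero[of "lead_coeff g"] by (cases "g = 0") (auto intro!: map_poly_degree_eq)

lemma hom_on_poly:
  assumes "poly_over E g" "x \<in> E" shows "\<tau> (poly g x) = poly (map_poly \<tau> g) (\<tau> x)"
proof -
  have "degree (map_poly \<tau> g) = degree g" using assms by (simp add: hom_on_degree)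
  then have "poly (map_poly \<tau> g) (\<tau> x) = (\<Sum>i\<le>degree g. coeff (map_poly \<tau> g) i * \<tau> x ^ i)"
    unfolding poly_altdef by (intro sum.mono_neutral_left) (auto simp: coeff_eq_0)
  also have "\<dots> = \<tau> (poly g x)" using assms
    by (simp add: coeff_map_poly hom_on_zero poly_altdef hom_on_sum hom_on_mult hom_on_power
        subring_set_mult[OF Er] subring_set_power[OF Er])
  finally show ?thesis by simp
qed

end

section \<open>Division with remainder, minimal polynomials and simple extensions\<close>

lemma poly_over_division:
  assumes E: "subfield_set E" and g: "poly_over E g" and h: "poly_over E h" "h \<noteq> 0"
  shows "\<exists>q r. poly_over E q \<and> poly_over E r \<and> g = q * h + r \<and> (r = 0 \<or> degree r < degree h)"
  using g
proof (induction "degree g" arbitrary: g rule: less_induct)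
  case less
  note Er = subfield_imp_subring[OF E]
  have z: "0 \<in> E" by (rule subring_set_zero[OF Er])
  show ?case
  proof (cases "g = 0 \<or> degree g < degree h")
    case True
    then show ?thesis by (intro exI[of _ 0] exI[of _ g]) (use less z in auto)
  next
    case False
    then have dg: "degree h \<le> degree g" "g \<noteq> 0" by auto
    \<comment> \<open>Only the leading coefficient of h is inverted, so all coefficients stay in
      E.\<close>
    define c where "c = lead_coeff g * inverse (lead_coeff h)"
    have cE: "c \<in> E" unfolding c_def
      by (intro subring_set_mult[OF Er]) (use less h E in \<open>auto simp: subfield_set_def\<close>)
    define q where "q = monom c (degree g - degree h)"
    have qE: "poly_over E q" unfolding q_def using cE z by simp
    define g' where "g' = g - q * h"
    have g'E: "poly_over E g'" unfolding g'_def
      using subring_set_diff[OF Er] subring_set_coeff_mult[OF Er] qE less.prems h by simp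
    have c0: "c \<noteq> 0" using dg h unfolding c_def by simp
    have dq: "degree (q * h) = degree g"
      using dg h c0 by (simp add: q_def degree_mult_eq monom_eq_0_iff degree_monom_eq)
    have lq: "lead_coeff (q * h) = lead_coeff g"
    proof -
      have "lead_coeff q = c" unfolding q_def using c0 by (simp add: degree_monom_eq)
      then show ?thesis using h by (simp add: lead_coeff_mult c_def)
    qed
    show ?thesis
    proof (cases "degree g = 0")
      case True
      have "g' = 0"
      proof (rule poly_eqI)
        fix i show "coeff g' i = coeff 0 i"
          using lq dq True by (cases "i = 0") (auto simp: g'_def coeff_eq_0)
      qed
      then show ?thesis by (intro exI[of _ q] exI[of _ 0]) (use qE z in \<open>auto simp: g'_def\<close>)
    next
      case False
      have "degree g' < degree g"
      proof (rule degree_lessI)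
        show "\<forall>k\<ge>degree g. coeff g' k = 0"
        proof (intro allI impI)
          fix k assume "degree g \<le> k"
          then show "coeff g' k = 0" using lq dq by (cases "k = degree g") (auto simp: g'_def coeff_eq_0)
        qed
      qed (use False in auto)
      then obtain q' r where "poly_over E q'" "poly_over E r" "g' = q' * h + r" "r = 0 \<or> degree r < degree h"
        using less.hyps[OF _ g'E] by blast
      then show ?thesis
        by (intro exI[of _ "q + q'"] exI[of _ r])
          (use qE subring_set_add[OF Er] in \<open>auto simp: g'_def algebra_simps\<close>)
    qed
  qed
qed

definition minimal_poly :: "'a::field set \<Rightarrow> 'a \<Rightarrow> 'a poly \<Rightarrow> bool" where
  "minimal_poly E \<alpha> m \<longleftrightarrow> m \<noteq> 0 \<and> poly_over E m \<and> poly m \<alpha> = 0 \<and>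
     (\<forall>g. poly_over E g \<longrightarrow> g \<noteq> 0 \<longrightarrow> poly g \<alpha> = 0 \<longrightarrow> degree m \<le> degree g)"

definition algebraic_over :: "'a::field set \<Rightarrow> 'a \<Rightarrow> bool" where
  "algebraic_over E \<alpha> \<longleftrightarrow> (\<exists>g. g \<noteq> 0 \<and> poly_over E g \<and> poly g \<alpha> = 0)"

lemma exists_minimal_poly:
  assumes "algebraic_over E \<alpha>"
  shows "\<exists>m. minimal_poly E \<alpha> m"
proof -
  let ?P = "\<lambda>d. \<exists>g. g \<noteq> 0 \<and> poly_over E g \<and> poly g \<alpha> = 0 \<and> degree g = d"
  have "\<exists>d. ?P d" using assms by (auto simp: algebraic_over_def)
  then have "?P (LEAST d. ?P d)" by (rule LeastI_ex)
  then obtain m where m: "m \<noteq> 0" "poly_over E m" "poly m \<alpha> = 0" "degree m = (LEAST d. ?P d)" by blast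
  have "degree m \<le> degree g" if "poly_over E g" "g \<noteq> 0" "poly g \<alpha> = 0" for g
    unfolding m(4) by (rule Least_le) (use that in blast)
  then show ?thesis using m by (auto simp: minimal_poly_def)
qed

definition adjoin :: "'a::field set \<Rightarrow> 'a \<Rightarrow> 'a set" where
  "adjoin E \<alpha> = {poly g \<alpha> | g. poly_over E g}"

lemma adjoinI: "poly_over E g \<Longrightarrow> poly g \<alpha> \<in> adjoin E \<alpha>"
  by (auto simp: adjoin_def)

lemma adjoinE:
  assumes "x \<in> adjoin E \<alpha>" obtains g where "poly_over E g" "x = poly g \<alpha>"
  using assms by (auto simp: adjoin_def)

lemma adjoin_incl:
  assumes "subfield_set E" shows "E \<subseteq> adjoin E \<alpha>" "\<alpha> \<in> adjoin E \<alpha>"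
proof -
  note Er = subfield_imp_subring[OF assms]
  show "E \<subseteq> adjoin E \<alpha>"
  proof
    fix c assume "c \<in> E"
    then show "c \<in> adjoin E \<alpha>" using subring_set_zero[OF Er]
      using adjoinI[of "[:c:]" E \<alpha>] by (auto simp: coeff_pCons split: nat.splits)
  qed
  show "\<alpha> \<in> adjoin E \<alpha>" using subring_set_zero[OF Er] subring_set_one[OF Er]
    using adjoinI[of "[:0,1:]" E \<alpha>] by (auto simp: coeff_pCons split: nat.splits)
qed

context
  fixes E :: "'a::field set" and \<alpha> :: 'a and m :: "'a poly"
  assumes E: "subfield_set E" and m: "minimal_poly E \<alpha> m"
begin

private lemmas E_ring = subfield_imp_subring[OF E]

lemma minimal_poly_divides:
  assumes g: "poly_over E g" "poly g \<alpha> = 0"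
  shows "\<exists>q. poly_over E q \<and> g = q * m"
proof -
  have "poly_over E m" "m \<noteq> 0" using m by (auto simp: minimal_poly_def)
  then obtain q r where q: "poly_over E q" "poly_over E r" "g = q * m + r" "r = 0 \<or> degree r < degree m"
    using poly_over_division[OF E g(1)] by blast
  have "poly r \<alpha> = 0" using g q m by (simp add: minimal_poly_def)
  then have "r = 0" using q m by (auto simp: minimal_poly_def not_less[symmetric])
  then show ?thesis using q by auto
qed

lemma degree_minimal_poly: "degree m > 0"
proof (rule ccontr)
  assume "\<not> 0 < degree m"
  then obtain c where "m = [:c:]" by (metis degree_eq_zeroE gr0I)
  then show False using m by (auto simp: minimal_poly_def)
qed

text \<open>Dividing m by g gives
  \<open>poly q \<alpha> * poly g \<alpha> = - poly r \<alpha>\<close> with r of smaller degree than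
  g. The inverse of \<open>poly r \<alpha>\<close> comes from the induction, and the inverse of
  \<open>poly g \<alpha>\<close> is then \<open>- poly q \<alpha> / poly r \<alpha>\<close>.\<close>

lemma adjoin_inverse:
  assumes "poly_over E g" "degree g < degree m" "poly g \<alpha> \<noteq> 0"
  shows "inverse (poly g \<alpha>) \<in> adjoin E \<alpha>"
  using assms
proof (induction "degree g" arbitrary: g rule: less_induct)
  case less
  have mE: "poly_over E m" "m \<noteq> 0" "poly m \<alpha> = 0" using m by (auto simp: minimal_poly_def)
  have g0: "g \<noteq> 0" using less by auto
  show ?case
  proof (cases "degree g = 0")
    case True
    then obtain c where c: "g = [:c:]" by (metis degree_eq_zeroE)
    have "c \<in> E" using less.prems(1) c by (metis coeff_pCons_0)
    then have "inverse c \<in> E" using E by (simp add: subfield_set_def)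
    then show ?thesis using adjoin_incl(1)[OF E] c by auto
  next
    case False
    obtain q r where q: "poly_over E q" "poly_over E r" "m = q * g + r" "r = 0 \<or> degree r < degree g"
      using poly_over_division[OF E mE(1) less.prems(1) g0] by blast
    have q0: "q \<noteq> 0" using q less.prems mE(2) by auto
    have dm: "degree m = degree q + degree g"
    proof -
      have dqg: "degree (q * g) = degree q + degree g" using q0 g0 by (rule degree_mult_eq)
      show ?thesis
      proof (cases "r = 0")
        case True then show ?thesis using q(3) dqg by simp
      next
        case False
        then have "degree r < degree (q * g)" using q(4) dqg by simp
        then show ?thesis using q(3) dqg by (simp add: degree_add_eq_left)
      qed
    qed
    have qa: "poly q \<alpha> \<noteq> 0"
    proof
      assume "poly q \<alpha> = 0"
      then have "degree m \<le> degree q" using m q(1) q0 by (auto simp: minimal_poly_def)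
      then show False using dm False by simp
    qed
    have eq: "poly q \<alpha> * poly g \<alpha> = - poly r \<alpha>" using q(3) mE(3) by (simp add: eq_neg_iff_add_eq_0)
    then have ra: "poly r \<alpha> \<noteq> 0" using qa less.prems(3) by (metis mult_eq_0_iff neg_equal_0_iff_equal)
    then have dr: "degree r < degree g" using q(4) by auto
    have inv: "inverse (poly r \<alpha>) \<in> adjoin E \<alpha>"
      using less.hyps[OF dr q(2) _ ra] dr less.prems(2) by simp
    have Ar: "subring_set (adjoin E \<alpha>)" unfolding adjoin_def by (rule subring_set_adjoin[OF E_ring])
    have "- (poly q \<alpha> * inverse (poly r \<alpha>)) \<in> adjoin E \<alpha>"
      by (intro subring_set_uminus[OF Ar] subring_set_mult[OF Ar] inv adjoinI q(1))
    moreover have "- (poly q \<alpha> * inverse (poly r \<alpha>)) = inverse (poly g \<alpha>)"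
    proof -
      have "poly r \<alpha> = - (poly q \<alpha> * poly g \<alpha>)" using eq by simp
      then show ?thesis using qa less.prems(3) by (simp add: field_simps)
    qed
    ultimately show ?thesis by simp
  qed
qed

lemma subfield_adjoin: "subfield_set (adjoin E \<alpha>)"
  unfolding subfield_set_def
proof (intro conjI ballI)
  show sub: "subring_set (adjoin E \<alpha>)" unfolding adjoin_def by (rule subring_set_adjoin[OF E_ring])
  fix x assume "x \<in> adjoin E \<alpha>"
  then obtain g where g: "poly_over E g" "x = poly g \<alpha>" by (rule adjoinE)
  have mE: "poly_over E m" "m \<noteq> 0" "poly m \<alpha> = 0" using m by (auto simp: minimal_poly_def)
  obtain q r where q: "poly_over E q" "poly_over E r" "g = q * m + r" "r = 0 \<or> degree r < degree m"
    using poly_over_division[OF E g(1) mE(1,2)] by blast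
  have x: "x = poly r \<alpha>" using g q mE by simp
  show "inverse x \<in> adjoin E \<alpha>"
  proof (cases "x = 0")
    case True
    then show ?thesis using subring_set_zero[OF sub] by simp
  next
    case False
    then show ?thesis using adjoin_inverse[of r] q x by auto
  qed
qed

text \<open>Two polynomials over E with the same value at \<alpha> differ by a multiple of m, so
  their images under \<tau> agree at \<beta>. The choice of representative by \<open>SOME\<close> is
  therefore harmless.\<close>

lemma extend_hom:
  assumes hom: "hom_on E \<tau>" and \<beta>: "poly (map_poly \<tau> m) \<beta> = 0"
  obtains \<tau>' where "hom_on (adjoin E \<alpha>) \<tau>'" "\<And>x. x \<in> E \<Longrightarrow> \<tau>' x = \<tau> x" "\<tau>' \<alpha> = \<beta>"
    "\<And>g. poly_over E g \<Longrightarrow> \<tau>' (poly g \<alpha>) = poly (map_poly \<tau> g) \<beta>"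
proof -
  define \<tau>' where "\<tau>' x = poly (map_poly \<tau> (SOME g. poly_over E g \<and> x = poly g \<alpha>)) \<beta>" for x
  have mE: "poly_over E m" using m by (simp add: minimal_poly_def)
  have *: "\<tau>' (poly g \<alpha>) = poly (map_poly \<tau> g) \<beta>" if g: "poly_over E g" for g
  proof -
    define h where "h = (SOME h. poly_over E h \<and> poly g \<alpha> = poly h \<alpha>)"
    have h: "poly_over E h \<and> poly g \<alpha> = poly h \<alpha>"
      unfolding h_def by (rule someI[of _ g]) (use g in simp)
    have "poly_over E (g - h)" using g h subring_set_diff[OF E_ring] by simp
    moreover have "poly (g - h) \<alpha> = 0" using h by simp
    ultimately obtain q where q: "poly_over E q" "g - h = q * m" using minimal_poly_divides by blast
    have "map_poly \<tau> g - map_poly \<tau> h = map_poly \<tau> q * map_poly \<tau> m"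
      using hom_on_map_poly_diff[OF E hom, of g h] hom_on_map_poly_mult[OF E hom q(1) mE] g h q(2) by simp
    then have "poly (map_poly \<tau> g - map_poly \<tau> h) \<beta> = 0" using \<beta> by simp
    then show ?thesis by (simp add: \<tau>'_def h_def)
  qed
  have E\<tau>: "\<tau>' x = \<tau> x" if "x \<in> E" for x
  proof -
    have "poly_over E [:x:]" using that subring_set_zero[OF E_ring] by (auto simp: coeff_pCons split: nat.splits)
    then show ?thesis using *[of "[:x:]"] by (simp add: map_poly_pCons hom_on_zero[OF E hom])
  qed
  moreover have "\<tau>' \<alpha> = \<beta>"
  proof -
    have "poly_over E [:0,1:]" using subring_set_zero[OF E_ring] subring_set_one[OF E_ring]
      by (auto simp: coeff_pCons split: nat.splits)
    then show ?thesis using *[of "[:0,1:]"]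
      by (simp add: map_poly_pCons hom_on_zero[OF E hom] hom_on_one[OF E hom])
  qed
  moreover have "hom_on (adjoin E \<alpha>) \<tau>'"
    unfolding hom_on_def
  proof (intro conjI ballI)
    show "\<tau>' 1 = 1" using E\<tau>[of 1] subring_set_one[OF E_ring] hom_on_one[OF E hom] by simp
    fix x y assume "x \<in> adjoin E \<alpha>" "y \<in> adjoin E \<alpha>"
    then obtain g h where g: "poly_over E g" "x = poly g \<alpha>" and h: "poly_over E h" "y = poly h \<alpha>"
      by (elim adjoinE)
    show "\<tau>' (x + y) = \<tau>' x + \<tau>' y"
      using *[of "g + h"] *[OF g(1)] *[OF h(1)] g h subring_set_add[OF E_ring]
      by (simp add: hom_on_map_poly_add[OF E hom])
    show "\<tau>' (x * y) = \<tau>' x * \<tau>' y"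
      using *[of "g * h"] *[OF g(1)] *[OF h(1)] g h subring_set_coeff_mult[OF E_ring]
      by (simp add: hom_on_map_poly_mult[OF E hom])
  qed
  ultimately show ?thesis using that[of \<tau>'] * by blast
qed

end

section \<open>Generated fields, extension of embeddings and separability\<close>

definition field_gen :: "'a::field set \<Rightarrow> 'a set" where
  "field_gen S = \<Inter>{E. subfield_set E \<and> S \<subseteq> E}"

lemma subfield_field_gen: "subfield_set (field_gen S)"
  unfolding field_gen_def subfield_set_def subring_set_def by blast

lemma field_gen_incl: "S \<subseteq> field_gen S"
  unfolding field_gen_def by blast

lemma field_gen_min: "subfield_set E \<Longrightarrow> S \<subseteq> E \<Longrightarrow> field_gen S \<subseteq> E"
  unfolding field_gen_def by blast

lemma algebraic_over_mono: "algebraic_over E \<alpha> \<Longrightarrow> E \<subseteq> F \<Longrightarrow> algebraic_over F \<alpha>"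
  unfolding algebraic_over_def by blast

text \<open>The ambient field is algebraically closed, so the image of the minimal polynomial of
  each new generator has a root to which the generator can be sent.\<close>

lemma extend_hom_finite:
  fixes E :: "'a::alg_closed_field set"
  assumes "finite S" "subfield_set E" "hom_on E \<tau>" "\<And>s. s \<in> S \<Longrightarrow> algebraic_over E s"
  shows "\<exists>\<tau>'. hom_on (field_gen (E \<union> S)) \<tau>' \<and> (\<forall>x\<in>E. \<tau>' x = \<tau> x)"
  using assms
proof (induction S arbitrary: E \<tau> rule: finite_induct)
  case empty
  then show ?case using field_gen_min[of E E] hom_on_subset by (intro exI[of _ \<tau>]) auto
next
  case (insert s S)
  obtain m where m: "minimal_poly E s m" using exists_minimal_poly insert.prems by blast
  then have "degree (map_poly \<tau> m) = degree m"
    using hom_on_degree[OF insert.prems(1,2)] by (simp add: minimal_poly_def)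
  then have "degree (map_poly \<tau> m) > 0" using degree_minimal_poly[OF insert.prems(1) m] by simp
  then obtain \<beta> where \<beta>: "poly (map_poly \<tau> m) \<beta> = 0" using alg_closed_imp_poly_has_root by blast
  obtain \<tau>1 where \<tau>1: "hom_on (adjoin E s) \<tau>1" "\<And>x. x \<in> E \<Longrightarrow> \<tau>1 x = \<tau> x"
    using extend_hom[OF insert.prems(1) m insert.prems(2) \<beta>] by blast
  have sub: "E \<subseteq> adjoin E s" "s \<in> adjoin E s" using adjoin_incl[OF insert.prems(1)] by auto
  obtain \<tau>2 where \<tau>2: "hom_on (field_gen (adjoin E s \<union> S)) \<tau>2" "\<And>x. x \<in> adjoin E s \<Longrightarrow> \<tau>2 x = \<tau>1 x"
    using insert.IH[OF subfield_adjoin[OF insert.prems(1) m] \<tau>1(1)] insert.prems(3) algebraic_over_mono[OF _ sub(1)]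
    by blast
  have "field_gen (E \<union> insert s S) \<subseteq> field_gen (adjoin E s \<union> S)"
    by (rule field_gen_min[OF subfield_field_gen]) (use field_gen_incl[of "adjoin E s \<union> S"] sub in blast)
  then have "hom_on (field_gen (E \<union> insert s S)) \<tau>2" using hom_on_subset \<tau>2(1) by blast
  moreover have "\<forall>x\<in>E. \<tau>2 x = \<tau> x" using \<tau>1(2) \<tau>2(2) subsetD[OF sub(1)] by simp
  ultimately show ?case by blast
qed

lemma hom_on_id: "hom_on E (\<lambda>x. x)"
  by (simp add: hom_on_def)

text \<open>By minimality of the degree the derivative of m does not vanish at \<alpha>. Every other
  root z is the image of \<alpha> under an embedding over E, and an embedding keeps this value
  nonzero; so all roots are simple.\<close>

lemma minimal_poly_card_roots:
  fixes E :: "complex set"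
  assumes E: "subfield_set E" and m: "minimal_poly E \<alpha> m"
  shows "card {z. poly m z = 0} = degree m"
proof -
  have m0: "m \<noteq> 0" "poly_over E m" using m by (auto simp: minimal_poly_def)
  have dE: "poly_over E (pderiv m)"
    using m0 subring_set_mult[OF subfield_imp_subring[OF E]] subring_set_of_nat[OF subfield_imp_subring[OF E]]
    by (simp add: coeff_pderiv del: of_nat_Suc)
  have d0: "pderiv m \<noteq> 0" using degree_minimal_poly[OF E m] by (auto simp: pderiv_eq_0_iff)
  have nz: "poly (pderiv m) \<alpha> \<noteq> 0"
  proof
    assume "poly (pderiv m) \<alpha> = 0"
    then have "degree m \<le> degree (pderiv m)" using m dE d0 by (simp add: minimal_poly_def)
    then show False using degree_minimal_poly[OF E m] by (simp add: degree_pderiv)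
  qed
  have "poly (pderiv m) z \<noteq> 0" if z: "poly m z = 0" for z
  proof -
    have "poly (map_poly (\<lambda>x. x) m) z = 0" using z by simp
    then obtain \<tau> where \<tau>: "hom_on (adjoin E \<alpha>) \<tau>"
       "\<And>g. poly_over E g \<Longrightarrow> \<tau> (poly g \<alpha>) = poly (map_poly (\<lambda>x. x) g) z"
      using extend_hom[OF E m hom_on_id] by blast
    have "poly (pderiv m) \<alpha> \<in> adjoin E \<alpha>" using dE by (rule adjoinI)
    then show ?thesis using hom_on_nonzero[OF subfield_adjoin[OF E m] \<tau>(1) _ nz] \<tau>(2)[OF dE] by simp
  qed
  then have "rsquarefree m" using m0 by (simp add: rsquarefree_roots)
  then have "smult (lead_coeff m) (\<Prod>z|poly m z = 0. [:-z, 1:]) = m"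
    by (rule complex_poly_decompose_rsquarefree)
  then have "degree m = degree (\<Prod>z|poly m z = 0. [:-z, 1:])"
    using m0(1) by (metis degree_smult_eq leading_coeff_0_iff)
  also have "\<dots> = (\<Sum>z|poly m z = 0. degree [:-z, 1:])" by (intro degree_prod_eq_sum_degree) auto
  also have "\<dots> = card {z. poly m z = 0}" by simp
  finally show ?thesis by simp
qed

text \<open>Write x = \<open>poly r \<alpha>\<close> with r reduced modulo m. If no embedding moved
  x, then r - x would vanish at all \<open>degree m\<close> roots of m. Its degree is smaller, so r
  would be the constant x, and x would lie in E.\<close>

lemma exists_hom_moving_adjoin:
  fixes E :: "complex set"
  assumes E: "subfield_set E" and m: "minimal_poly E \<alpha> m" and x: "x \<in> adjoin E \<alpha>" "x \<notin> E"
  shows "\<exists>\<tau>. hom_on (adjoin E \<alpha>) \<tau> \<and> (\<forall>e\<in>E. \<tau> e = e) \<and> \<tau> x \<noteq> x"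
proof (rule ccontr)
  assume contra: "\<not> ?thesis"
  have mE: "m \<noteq> 0" "poly_over E m" "poly m \<alpha> = 0" using m by (auto simp: minimal_poly_def)
  obtain g where g: "poly_over E g" "x = poly g \<alpha>" using x(1) by (rule adjoinE)
  obtain q r where q: "poly_over E q" "poly_over E r" "g = q * m + r" "r = 0 \<or> degree r < degree m"
    using poly_over_division[OF E g(1) mE(2,1)] by blast
  have xr: "x = poly r \<alpha>" using g q mE by simp
  have "poly r z = x" if z: "poly m z = 0" for z
  proof -
    have "poly (map_poly (\<lambda>x. x) m) z = 0" using z by simp
    then obtain \<tau> where \<tau>: "hom_on (adjoin E \<alpha>) \<tau>" "\<And>x. x \<in> E \<Longrightarrow> \<tau> x = x"
       "\<And>g. poly_over E g \<Longrightarrow> \<tau> (poly g \<alpha>) = poly (map_poly (\<lambda>x. x) g) z"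
      using extend_hom[OF E m hom_on_id] by blast
    then have "\<tau> x = x" using contra by blast
    then show ?thesis using \<tau>(3)[OF q(2)] xr by simp
  qed
  then have sub: "{z. poly m z = 0} \<subseteq> {z. poly (r - [:x:]) z = 0}" by auto
  have dr: "degree (r - [:x:]) < degree m"
    using q(4) degree_minimal_poly[OF E m] degree_diff_less[of r "degree m" "[:x:]"] by auto
  have "r - [:x:] = 0"
  proof (rule ccontr)
    assume nz: "r - [:x:] \<noteq> 0"
    have "degree m \<le> card {z. poly (r - [:x:]) z = 0}"
      using card_mono[OF poly_roots_finite[OF nz] sub] minimal_poly_card_roots[OF E m] by simp
    also have "\<dots> \<le> degree (r - [:x:])" by (rule card_poly_roots_bound[OF nz])
    finally show False using dr by simp
  qed
  then have "x = coeff r 0" by (metis coeff_pCons_0 eq_iff_diff_eq_0)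
  then show False using q(2) x(2) by simp
qed

text \<open>If x already lies in the field obtained by adjoining s, it is moved there and the
  embedding is extended. Otherwise the larger base field still omits x and the induction
  applies.\<close>

lemma exists_hom_moving:
  fixes E :: "complex set"
  assumes "finite S" "subfield_set E" "\<And>s. s \<in> S \<Longrightarrow> algebraic_over E s"
    and "x \<in> field_gen (E \<union> S)" "x \<notin> E"
  shows "\<exists>\<tau>. hom_on (field_gen (E \<union> S)) \<tau> \<and> (\<forall>e\<in>E. \<tau> e = e) \<and> \<tau> x \<noteq> x"
  using assms
proof (induction S arbitrary: E rule: finite_induct)
  case empty
  then show ?case using field_gen_min[of E E] by auto
next
  case (insert s S)
  obtain m where m: "minimal_poly E s m" using exists_minimal_poly insert.prems by blast
  have sub: "E \<subseteq> adjoin E s" "s \<in> adjoin E s" using adjoin_incl[OF insert.prems(1)] by auto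
  have sf: "subfield_set (adjoin E s)" by (rule subfield_adjoin[OF insert.prems(1) m])
  have incl: "field_gen (E \<union> insert s S) \<subseteq> field_gen (adjoin E s \<union> S)"
    by (rule field_gen_min[OF subfield_field_gen]) (use field_gen_incl[of "adjoin E s \<union> S"] sub in blast)
  have alg: "\<And>s'. s' \<in> S \<Longrightarrow> algebraic_over (adjoin E s) s'"
    using insert.prems(2) algebraic_over_mono[OF _ sub(1)] by blast
  show ?case
  proof (cases "x \<in> adjoin E s")
    case False
    then obtain \<tau> where "hom_on (field_gen (adjoin E s \<union> S)) \<tau>" "\<forall>e\<in>adjoin E s. \<tau> e = e" "\<tau> x \<noteq> x"
      using insert.IH[OF sf alg] incl insert.prems(3) by blast
    then show ?thesis using subsetD[OF sub(1)] hom_on_subset[OF _ incl] by (intro exI[of _ \<tau>]) simp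
  next
    case True
    then obtain \<tau> where \<tau>: "hom_on (adjoin E s) \<tau>" "\<forall>e\<in>E. \<tau> e = e" "\<tau> x \<noteq> x"
      using exists_hom_moving_adjoin[OF insert.prems(1) m _ insert.prems(4)] by blast
    obtain \<tau>' where "hom_on (field_gen (adjoin E s \<union> S)) \<tau>'" "\<forall>x\<in>adjoin E s. \<tau>' x = \<tau> x"
      using extend_hom_finite[OF insert.hyps(1) sf \<tau>(1) alg] by blast
    then show ?thesis using \<tau> True subsetD[OF sub(1)] hom_on_subset[OF _ incl] by (intro exI[of _ \<tau>']) simp
  qed
qed

section \<open>Automorphisms of the splitting field\<close>

lemma subfield_set_imp_subfield:
  assumes "subfield_set (E :: complex set)" shows "subfield E ring_of_type_algebra"
proof -
  interpret C: field "ring_of_type_algebra :: complex ring" by (rule field_from_type_algebra)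
  note Er = subfield_imp_subring[OF assms]
  have carr: "carrier (ring_of_type_algebra :: complex ring) = UNIV" by (simp add: ring_of_type_algebra_def)
  have ainv: "\<ominus>\<^bsub>ring_of_type_algebra\<^esub> (x::complex) = - x" for x
    by (rule C.minus_equality) (auto simp: ring_of_type_algebra_def)
  have minv: "inv\<^bsub>ring_of_type_algebra\<^esub> (x::complex) = inverse x" if "x \<noteq> 0" for x
    by (rule C.comm_inv_char) (use that in \<open>auto simp: ring_of_type_algebra_def\<close>)
  show ?thesis
  proof (rule C.subfieldI')
    show "subring E ring_of_type_algebra"
    proof (rule C.subringI)
      show "E \<subseteq> carrier ring_of_type_algebra" by (simp add: carr)
      show "\<one>\<^bsub>ring_of_type_algebra\<^esub> \<in> E" using subring_set_one[OF Er] by (simp add: ring_of_type_algebra_def)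
      fix x y assume "x \<in> E" "y \<in> E"
      then show "\<ominus>\<^bsub>ring_of_type_algebra\<^esub> x \<in> E" "x \<otimes>\<^bsub>ring_of_type_algebra\<^esub> y \<in> E" "x \<oplus>\<^bsub>ring_of_type_algebra\<^esub> y \<in> E"
        using subring_set_uminus[OF Er] subring_set_mult[OF Er] subring_set_add[OF Er]
        by (auto simp: ainv) (auto simp: ring_of_type_algebra_def)
    qed
    fix k assume "k \<in> E - {\<zero>\<^bsub>ring_of_type_algebra\<^esub>}"
    then have "k \<in> E" "k \<noteq> 0" by (auto simp: ring_of_type_algebra_def)
    then show "inv\<^bsub>ring_of_type_algebra\<^esub> k \<in> E" using assms by (simp add: minv subfield_set_def)
  qed
qed

text \<open>Both sides are the least set with the same closure properties. This replaces the
  inductively generated field of the statement by an intersection of subfields.\<close>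

lemma carrier_splitting_field: "carrier (splitting_field F) = field_gen (\<rat> \<union> complex_roots F)"
proof -
  interpret C: field "ring_of_type_algebra :: complex ring" by (rule field_from_type_algebra)
  have carr: "carrier (ring_of_type_algebra :: complex ring) = UNIV" by (simp add: ring_of_type_algebra_def)
  let ?S = "\<rat> \<union> complex_roots F" and ?G = "generate_field ring_of_type_algebra (\<rat> \<union> complex_roots F)"
  have ainv: "\<ominus>\<^bsub>ring_of_type_algebra\<^esub> (x::complex) = - x" for x
    by (rule C.minus_equality) (auto simp: ring_of_type_algebra_def)
  have minv: "inv\<^bsub>ring_of_type_algebra\<^esub> (x::complex) = inverse x" if "x \<noteq> 0" for x
    by (rule C.comm_inv_char) (use that in \<open>auto simp: ring_of_type_algebra_def\<close>)
  have 1: "?G \<subseteq> field_gen ?S"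
    by (rule C.generate_field_min_subfield1)
      (use field_gen_incl[of ?S] subfield_set_imp_subfield[OF subfield_field_gen] in \<open>auto simp: carr\<close>)
  have one: "1 \<in> ?G" using generate_field.one[of "ring_of_type_algebra :: complex ring" ?S]
    by (simp add: ring_of_type_algebra_def)
  have zero: "0 \<in> ?G" using C.zero_in_generate[of ?S] by (simp add: ring_of_type_algebra_def)
  have uminus: "- x \<in> ?G" if "x \<in> ?G" for x using generate_field.a_inv[OF that] by (simp add: ainv)
  have add: "x + y \<in> ?G" if "x \<in> ?G" "y \<in> ?G" for x y using generate_field.eng_add[OF that]
    by (simp add: ring_of_type_algebra_def)
  have mult: "x * y \<in> ?G" if "x \<in> ?G" "y \<in> ?G" for x y using generate_field.eng_mult[OF that]
    by (simp add: ring_of_type_algebra_def)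
  have inv: "inverse x \<in> ?G" if "x \<in> ?G" for x
  proof (cases "x = 0")
    case False
    then have "x \<noteq> \<zero>\<^bsub>ring_of_type_algebra\<^esub>" by (simp add: ring_of_type_algebra_def)
    then show ?thesis using generate_field.m_inv[OF that] False by (simp add: minv)
  qed (use zero in simp)
  have "x - y \<in> ?G" if "x \<in> ?G" "y \<in> ?G" for x y using add[OF that(1) uminus[OF that(2)]] by simp
  then have "subfield_set ?G" using one mult inv unfolding subfield_set_def subring_set_def by blast
  then have 2: "field_gen ?S \<subseteq> ?G" by (rule field_gen_min) (auto intro: generate_field.incl)
  show ?thesis using 1 2 by (simp add: splitting_field_def)
qed

locale splitting =
  fixes F :: "rat poly"
  assumes F_nonzero: "F \<noteq> 0"
begin

abbreviation R :: "complex set" where "R \<equiv> complex_roots F"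
definition K :: "complex set" where "K = field_gen (\<rat> \<union> R)"

text \<open>Extension by the identity off K makes each automorphism a bijection of the whole type,
  so that composition, \<open>inv'\<close> and equality are those of plain functions.\<close>

definition gal :: "(complex \<Rightarrow> complex) set" where
  "gal = {\<sigma>. hom_on K \<sigma> \<and> bij_betw \<sigma> K K \<and> (\<forall>q\<in>\<rat>. \<sigma> q = q) \<and> (\<forall>x. x \<notin> K \<longrightarrow> \<sigma> x = x)}"

lemma F_map_nonzero: "map_poly of_rat F \<noteq> (0 :: complex poly)"
  using F_nonzero by (simp add: map_poly_eq_0_iff)

lemma finite_R: "finite R"
  unfolding complex_roots_def by (rule poly_roots_finite[OF F_map_nonzero])

lemma K_subfield: "subfield_set K" unfolding K_def by (rule subfield_field_gen)
lemmas K_subring = subfield_imp_subring[OF K_subfield]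
lemma R_K: "R \<subseteq> K" and Rats_K: "\<rat> \<subseteq> K"
  using field_gen_incl[of "\<rat> \<union> R"] by (auto simp: K_def)

lemma K_induct: "subfield_set E \<Longrightarrow> \<rat> \<subseteq> E \<Longrightarrow> R \<subseteq> E \<Longrightarrow> K \<subseteq> E"
  unfolding K_def by (rule field_gen_min) auto

lemma subfield_Rats: "subfield_set (\<rat> :: complex set)"
  by (auto simp: subfield_set_def subring_set_def)

lemma hom_maps_roots:
  assumes "hom_on K \<tau>" "\<And>q. q \<in> \<rat> \<Longrightarrow> \<tau> q = q" "r \<in> R" shows "\<tau> r \<in> R"
proof -
  let ?f = "map_poly of_rat F :: complex poly"
  have "poly_over \<rat> ?f" by (simp add: coeff_map_poly)
  then have fK: "poly_over K ?f" and fixQ: "map_poly \<tau> ?f = ?f" using Rats_K assms(2)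
    by (auto simp: poly_eq_iff coeff_map_poly hom_on_zero[OF K_subfield assms(1)])
  have "poly ?f (\<tau> r) = \<tau> (poly ?f r)"
    using hom_on_poly[OF K_subfield assms(1) fK] fixQ assms(3) R_K by auto
  then show ?thesis using assms(3) by (simp add: complex_roots_def hom_on_zero[OF K_subfield assms(1)])
qed

text \<open>Normality of K: an embedding over \<rat> permutes the finite set R by injectivity, so
  both the elements sent into K and the image of K form subfields containing \<rat> and R.\<close>

lemma hom_to_gal:
  assumes hom: "hom_on K \<tau>" and fixQ: "\<And>q. q \<in> \<rat> \<Longrightarrow> \<tau> q = q"
  shows "(\<lambda>x. if x \<in> K then \<tau> x else x) \<in> gal"
proof -
  let ?s = "\<lambda>x. if x \<in> K then \<tau> x else x"
  have inj: "inj_on \<tau> K" by (rule hom_on_inj[OF K_subfield hom])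
  have "\<tau> ` R \<subseteq> R" using hom_maps_roots[OF hom fixQ] by blast
  then have \<tau>R: "\<tau> ` R = R" using finite_R inj R_K by (intro endo_inj_surj) (auto intro: inj_on_subset)
  note hs = hom_on_add[OF K_subfield hom] hom_on_mult[OF K_subfield hom] hom_on_diff[OF K_subfield hom]
    hom_on_inverse[OF K_subfield hom] hom_on_one[OF K_subfield hom]
  note ks = subring_set_one[OF K_subring] subring_set_diff[OF K_subring] subring_set_mult[OF K_subring]
  have kinv: "x \<in> K \<Longrightarrow> inverse x \<in> K" for x using K_subfield by (simp add: subfield_set_def)
  have "subfield_set {x \<in> K. \<tau> x \<in> K}"
    unfolding subfield_set_def subring_set_def using hs ks kinv by auto
  then have "K \<subseteq> {x \<in> K. \<tau> x \<in> K}"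
    by (rule K_induct) (use Rats_K R_K fixQ \<tau>R in auto)
  then have 1: "\<tau> ` K \<subseteq> K" by blast
  have "subfield_set (\<tau> ` K)"
    unfolding subfield_set_def subring_set_def
  proof (intro conjI ballI)
    show "1 \<in> \<tau> ` K" using ks(1) hs(5) by (metis image_eqI)
    fix x assume "x \<in> \<tau> ` K"
    then obtain x' where x': "x' \<in> K" "x = \<tau> x'" by blast
    show "inverse x \<in> \<tau> ` K" using x' hs(4) kinv by (metis image_eqI)
    fix y assume "y \<in> \<tau> ` K"
    then obtain y' where y': "y' \<in> K" "y = \<tau> y'" by blast
    show "x - y \<in> \<tau> ` K" using x' y' hs(3) ks(2) by (metis image_eqI)
    show "x * y \<in> \<tau> ` K" using x' y' hs(2) ks(3) by (metis image_eqI)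
  qed
  then have "K \<subseteq> \<tau> ` K"
  proof (rule K_induct)
    show "\<rat> \<subseteq> \<tau> ` K" using fixQ Rats_K by (metis image_eqI subsetD subsetI)
    show "R \<subseteq> \<tau> ` K" using \<tau>R R_K by blast
  qed
  then have "bij_betw \<tau> K K" using 1 inj by (auto simp: bij_betw_def)
  then have "bij_betw ?s K K" by (rule bij_betw_cong[THEN iffD1, rotated]) simp
  moreover have "hom_on K ?s"
    using hom ks(1) subring_set_add[OF K_subring] ks(3) by (auto simp: hom_on_def)
  ultimately show ?thesis using fixQ Rats_K by (auto simp: gal_def)
qed

context
  fixes \<sigma> assumes s: "\<sigma> \<in> gal"
begin

lemma gal_hom: "hom_on K \<sigma>" and gal_bij_K: "bij_betw \<sigma> K K"
  and gal_rat: "q \<in> \<rat> \<Longrightarrow> \<sigma> q = q" and gal_outside: "x \<notin> K \<Longrightarrow> \<sigma> x = x"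
  using s by (auto simp: gal_def)

lemma gal_K: "x \<in> K \<Longrightarrow> \<sigma> x \<in> K" using gal_bij_K by (auto simp: bij_betw_def)

lemma gal_bij: "bij \<sigma>"
proof -
  have "bij_betw \<sigma> (- K) (- K)" using gal_outside by (intro bij_betw_cong[THEN iffD1, OF _ bij_betw_id]) auto
  then have "bij_betw \<sigma> (K \<union> - K) (K \<union> - K)" by (intro bij_betw_combine gal_bij_K) auto
  then show ?thesis by simp
qed

lemmas gal_add = hom_on_add[OF K_subfield gal_hom]
  and gal_mult = hom_on_mult[OF K_subfield gal_hom]
  and gal_diff = hom_on_diff[OF K_subfield gal_hom]
  and gal_sum = hom_on_sum[OF K_subfield gal_hom]
  and gal_prod = hom_on_prod[OF K_subfield gal_hom]

lemma gal_of_int: "\<sigma> (of_int k) = of_int k" by (simp add: gal_rat)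

lemma gal_R: "r \<in> R \<Longrightarrow> \<sigma> r \<in> R" by (rule hom_maps_roots[OF gal_hom gal_rat])

lemma gal_bij_R: "bij_betw \<sigma> R R"
proof -
  have "inj_on \<sigma> R" using gal_bij_K R_K by (auto simp: bij_betw_def intro: inj_on_subset)
  moreover from this have "\<sigma> ` R = R" using finite_R gal_R by (intro endo_inj_surj) auto
  ultimately show ?thesis by (simp add: bij_betw_def)
qed

end

lemma gal_id: "id \<in> gal"
  by (auto simp: gal_def hom_on_def)

lemma gal_comp:
  assumes "\<sigma> \<in> gal" "\<tau> \<in> gal" shows "\<sigma> \<circ> \<tau> \<in> gal"
proof -
  have "hom_on K (\<sigma> \<circ> \<tau>)"
    using assms gal_add gal_mult gal_K[OF assms(2)] gal_rat[OF assms(1), of 1] gal_rat[OF assms(2), of 1]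
    by (auto simp: hom_on_def)
  then show ?thesis using bij_betw_trans[OF gal_bij_K[OF assms(2)] gal_bij_K[OF assms(1)]] assms
    by (auto simp: gal_def)
qed

lemma gal_ext:
  assumes "\<sigma> \<in> gal" "\<tau> \<in> gal" "\<And>r. r \<in> R \<Longrightarrow> \<sigma> r = \<tau> r" shows "\<sigma> = \<tau>"
proof
  fix x
  have "subfield_set {x \<in> K. \<sigma> x = \<tau> x}"
    using K_subfield hom_on_inverse[OF K_subfield gal_hom[OF assms(1)]] hom_on_inverse[OF K_subfield gal_hom[OF assms(2)]]
      gal_diff[OF assms(1)] gal_mult[OF assms(1)] gal_diff[OF assms(2)] gal_mult[OF assms(2)]
      gal_rat[OF assms(1), of 1] gal_rat[OF assms(2), of 1]
    by (auto simp: subfield_set_def subring_set_def)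
  then have "K \<subseteq> {x \<in> K. \<sigma> x = \<tau> x}"
    by (rule K_induct) (use R_K Rats_K assms(3) gal_rat[OF assms(1)] gal_rat[OF assms(2)] in auto)
  then show "\<sigma> x = \<tau> x" using gal_outside[OF assms(1)] gal_outside[OF assms(2)] by (cases "x \<in> K") auto
qed

lemma finite_gal: "finite gal"
proof -
  let ?g = "\<lambda>\<sigma>. restrict \<sigma> R"
  have "?g ` gal \<subseteq> R \<rightarrow>\<^sub>E R" using gal_R by auto
  then have "finite (?g ` gal)" using finite_PiE[OF finite_R, of "\<lambda>_. R"] finite_R by (metis finite_subset)
  moreover have "inj_on ?g gal"
    by (rule inj_onI) (metis gal_ext restrict_apply')
  ultimately show ?thesis by (rule finite_imageD)
qed

lemma gal_funpow: "\<sigma> \<in> gal \<Longrightarrow> (\<sigma> ^^ k) \<in> gal"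
  by (induction k) (auto simp: gal_id[unfolded id_def] id_def intro: gal_comp)

lemma gal_finite_order:
  assumes "\<sigma> \<in> gal" obtains k where "k > 0" "(\<sigma> ^^ k) = id"
proof -
  have "range (\<lambda>k. \<sigma> ^^ k) \<subseteq> gal" using gal_funpow[OF assms] by blast
  then have "finite (range (\<lambda>k. \<sigma> ^^ k))" using finite_gal finite_subset by blast
  then have "\<not> inj (\<lambda>k. \<sigma> ^^ k)" using finite_imageD infinite_UNIV_nat by blast
  then obtain i j where ij: "(\<sigma> ^^ i) = (\<sigma> ^^ j)" "i < j" unfolding inj_def by (metis linorder_neqE_nat)
  have b: "bij (\<sigma> ^^ i)" by (rule gal_bij[OF gal_funpow[OF assms]])
  have "(\<sigma> ^^ i) \<circ> (\<sigma> ^^ (j - i)) = (\<sigma> ^^ i)"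
    using ij funpow_add[of i "j - i" \<sigma>] by simp
  then have "(\<sigma> ^^ i) ((\<sigma> ^^ (j - i)) x) = (\<sigma> ^^ i) x" for x by (metis comp_apply)
  then have "(\<sigma> ^^ (j - i)) = id" using b by (intro ext) (simp add: bij_is_inj inj_eq)
  then show ?thesis using ij(2) that[of "j - i"] by simp
qed

text \<open>An element of finite order has one of its own powers as inverse.\<close>

lemma gal_inv:
  assumes "\<sigma> \<in> gal" shows "inv' \<sigma> \<in> gal"
proof -
  obtain k where k: "k > 0" "(\<sigma> ^^ k) = id" using gal_finite_order[OF assms] by blast
  have "\<sigma> ^^ (k - 1) \<circ> \<sigma> = id" using k by (metis Suc_diff_1 funpow_Suc_right)
  then have "inv' \<sigma> = \<sigma> ^^ (k - 1)"
    using gal_bij[OF assms] by (metis bij_is_surj comp_assoc comp_id id_comp surj_iff)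
  then show ?thesis using gal_funpow[OF assms] by simp
qed

text \<open>An element of K outside \<rat> is moved by some embedding over \<rat>, which is an
  automorphism by normality.\<close>

lemma fixed_rational:
  assumes x: "x \<in> K" and fixed: "\<And>\<sigma>. \<sigma> \<in> gal \<Longrightarrow> \<sigma> x = x" shows "x \<in> \<rat>"
proof (rule ccontr)
  assume "x \<notin> \<rat>"
  moreover have "algebraic_over \<rat> r" if "r \<in> R" for r :: complex
    unfolding algebraic_over_def
    by (rule exI[of _ "map_poly of_rat F"]) (use that F_map_nonzero in \<open>auto simp: coeff_map_poly complex_roots_def\<close>)
  ultimately obtain \<tau> where \<tau>: "hom_on K \<tau>" "\<forall>e\<in>\<rat>. \<tau> e = e" "\<tau> x \<noteq> x"
    using exists_hom_moving[OF finite_R subfield_Rats, of x] x unfolding K_def by blast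
  then show False using fixed[OF hom_to_gal[of \<tau>]] x by auto
qed

lemma galois_group_carrier:
  "p \<in> carrier (galois_group F) \<longleftrightarrow> p permutes R \<and> (\<exists>\<sigma>\<in>gal. \<forall>z\<in>R. p z = \<sigma> z)"
proof -
  have K: "carrier (splitting_field F) = K" by (simp add: carrier_splitting_field K_def)
  have ops: "\<one>\<^bsub>splitting_field F\<^esub> = 1" "\<And>x y. x \<otimes>\<^bsub>splitting_field F\<^esub> y = x * y" "\<And>x y. x \<oplus>\<^bsub>splitting_field F\<^esub> y = x + y"
    by (auto simp: splitting_field_def ring_of_type_algebra_def)
  have 1: "\<sigma> \<in> galois_automorphisms F" if "\<sigma> \<in> gal" for \<sigma>
    using that gal_K[OF that] unfolding galois_automorphisms_def ring_iso_def ring_hom_def gal_def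
    by (auto simp: K ops hom_on_def)
  have 2: "(\<lambda>x. if x \<in> K then \<sigma> x else x) \<in> gal" if "\<sigma> \<in> galois_automorphisms F" for \<sigma>
    by (rule hom_to_gal)
      (use that in \<open>auto simp: galois_automorphisms_def ring_iso_def ring_hom_def K ops hom_on_def\<close>)
  have "(\<exists>\<sigma>\<in>galois_automorphisms F. \<forall>z\<in>R. p z = \<sigma> z) \<longleftrightarrow> (\<exists>\<sigma>\<in>gal. \<forall>z\<in>R. p z = \<sigma> z)"
  proof
    assume "\<exists>\<sigma>\<in>galois_automorphisms F. \<forall>z\<in>R. p z = \<sigma> z"
    then obtain \<sigma> where s: "\<sigma> \<in> galois_automorphisms F" "\<forall>z\<in>R. p z = \<sigma> z" by blast
    show "\<exists>\<sigma>\<in>gal. \<forall>z\<in>R. p z = \<sigma> z" by (rule bexI[OF _ 2[OF s(1)]]) (use s(2) R_K in auto)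
  qed (use 1 in blast)
  then show ?thesis by (simp add: galois_group_def)
qed

end

section \<open>Inertia\<close>

locale splitting_valuation = splitting F + valuation_ring_above V p
  for F :: "rat poly" and V :: "complex set" and p :: nat +
  assumes R_V: "R \<subseteq> V"
begin

text \<open>V need not be stable under the Galois group. A is the largest stable subring of V inside
  K and plays the role of the ring of integers of K localised at p.\<close>

definition A :: "complex set" where
  "A = {x \<in> K. \<forall>\<sigma>\<in>gal. \<sigma> x \<in> V}"

lemma A_K: "x \<in> A \<Longrightarrow> x \<in> K" by (simp add: A_def)

lemma gal_A_V: "x \<in> A \<Longrightarrow> \<sigma> \<in> gal \<Longrightarrow> \<sigma> x \<in> V" by (simp add: A_def)

lemma A_V: "x \<in> A \<Longrightarrow> x \<in> V" using gal_A_V[OF _ gal_id] by simp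

lemma gal_A: "x \<in> A \<Longrightarrow> \<sigma> \<in> gal \<Longrightarrow> \<sigma> x \<in> A"
  using gal_comp gal_K by (force simp: A_def)

lemma A_subring: "subring_set A"
  unfolding subring_set_def A_def
  using subring_set_one[OF K_subring] subring_set_diff[OF K_subring] subring_set_mult[OF K_subring]
  by (auto simp: gal_rat gal_diff gal_mult closed)

lemma R_A: "r \<in> R \<Longrightarrow> r \<in> A"
  using R_K R_V gal_R by (auto simp: A_def)

text \<open>Dedekind's proof of the independence of characters, with vanishing replaced by divisibility by \<open>p\<close>.\<close>

lemma independence_mod_p:
  assumes distinct: "\<And>\<sigma> \<tau>. \<sigma> \<in> gal \<Longrightarrow> \<tau> \<in> gal \<Longrightarrow> \<sigma> \<noteq> \<tau> \<Longrightarrow> \<exists>y\<in>A. \<sigma> y - \<tau> y \<notin> nonunits"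
    and "finite S" "S \<subseteq> gal" "\<rho> \<in> S"
    and "\<And>y. y \<in> A \<Longrightarrow> (\<Sum>\<sigma>\<in>S. c \<sigma> * \<sigma> y) / of_nat p \<in> V"
  shows "c \<rho> / of_nat p \<in> V"
  using assms(2-5)
proof (induction "card S" arbitrary: S c rule: less_induct)
  case less
  show ?case
  proof (cases "S = {\<rho>}")
    case True
    then show ?thesis using less.prems(4)[of 1] less.prems(2) subring_set_one[OF A_subring]
      gal_rat[of \<rho> 1] by simp
  next
    case False
    then obtain \<tau> where \<tau>: "\<tau> \<in> S" "\<tau> \<noteq> \<rho>" using less.prems(3) by blast
    have g: "\<rho> \<in> gal" "\<tau> \<in> gal" using \<tau> less.prems by auto
    obtain z where z: "z \<in> A" "\<rho> z - \<tau> z \<notin> nonunits" using distinct[OF g] \<tau>(2) by blast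
    \<comment> \<open>The relation at \<open>z * y\<close> minus \<open>\<tau> z\<close> times the
      relation at y loses its \<tau> term, while the coefficient of \<rho> is only multiplied by a
      unit of V.\<close>
    define c' where "c' \<sigma> = c \<sigma> * (\<sigma> z - \<tau> z)" for \<sigma>
    have "c' \<rho> / of_nat p \<in> V"
    proof (rule less.hyps[of "S - {\<tau>}"])
      show "card (S - {\<tau>}) < card S" using \<tau> less.prems(1) by (intro card_Diff1_less) auto
      fix y assume y: "y \<in> A"
      have zy: "z * y \<in> A" using z y subring_set_mult[OF A_subring] by blast
      have "(\<Sum>\<sigma>\<in>S - {\<tau>}. c' \<sigma> * \<sigma> y) = (\<Sum>\<sigma>\<in>S. c' \<sigma> * \<sigma> y)"
        using less.prems(1) \<tau>(1) by (simp add: sum.remove[of S \<tau>] c'_def)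
      also have "\<dots> = (\<Sum>\<sigma>\<in>S. c \<sigma> * \<sigma> (z * y) - \<tau> z * (c \<sigma> * \<sigma> y))"
        by (rule sum.cong) (use less.prems(2) z(1) y in \<open>auto simp: c'_def gal_mult A_K algebra_simps subset_iff\<close>)
      also have "\<dots> = (\<Sum>\<sigma>\<in>S. c \<sigma> * \<sigma> (z * y)) - \<tau> z * (\<Sum>\<sigma>\<in>S. c \<sigma> * \<sigma> y)"
        by (simp add: sum_subtractf sum_distrib_left)
      finally have "(\<Sum>\<sigma>\<in>S - {\<tau>}. c' \<sigma> * \<sigma> y) / of_nat p
          = (\<Sum>\<sigma>\<in>S. c \<sigma> * \<sigma> (z * y)) / of_nat p - \<tau> z * ((\<Sum>\<sigma>\<in>S. c \<sigma> * \<sigma> y) / of_nat p)"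
        by (simp add: diff_divide_distrib)
      also have "\<dots> \<in> V" by (intro closed less.prems(4) zy y gal_A_V z g)
      finally show "(\<Sum>\<sigma>\<in>S - {\<tau>}. c' \<sigma> * \<sigma> y) / of_nat p \<in> V" .
    qed (use less.prems \<tau> in auto)
    moreover have "inverse (\<rho> z - \<tau> z) \<in> V" using z g by (intro unit_inverse closed gal_A_V) auto
    ultimately have "c' \<rho> / of_nat p * inverse (\<rho> z - \<tau> z) \<in> V" by (rule mult_closed)
    moreover have "\<rho> z - \<tau> z \<noteq> 0" using z(2) zero_nonunit by auto
    then have "c' \<rho> / of_nat p * inverse (\<rho> z - \<tau> z) = c \<rho> / of_nat p" by (simp add: c'_def)
    ultimately show ?thesis by (simp only:)
  qed
qed

text \<open>The hypothesis \<open>unram\<close> says that inertia is trivial. For y in A the trace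
  of \<open>z * y\<close> is rational and a nonunit, hence divisible by p. Independence modulo p,
  applied with coefficients \<open>\<sigma> z\<close>, then makes the coefficient z at the identity
  divisible by p.\<close>

lemma unramified_dvd:
  assumes unram: "\<And>\<sigma>. \<sigma> \<in> gal \<Longrightarrow> \<sigma> \<noteq> id \<Longrightarrow> \<exists>y\<in>A. \<sigma> y - y \<notin> nonunits"
    and z: "z \<in> A" "\<And>\<sigma>. \<sigma> \<in> gal \<Longrightarrow> \<sigma> z \<in> nonunits"
  shows "z / of_nat p \<in> V"
proof -
  have distinct: "\<exists>y\<in>A. \<sigma> y - \<tau> y \<notin> nonunits" if st: "\<sigma> \<in> gal" "\<tau> \<in> gal" "\<sigma> \<noteq> \<tau>" for \<sigma> \<tau>
  proof -
    have "\<sigma> \<circ> inv' \<tau> \<noteq> id"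
    proof
      assume "\<sigma> \<circ> inv' \<tau> = id"
      then have "\<sigma> \<circ> inv' \<tau> \<circ> \<tau> = \<tau>" by simp
      then show False using st gal_bij[OF st(2)] by (simp add: comp_assoc bij_is_inj)
    qed
    then obtain y where y: "y \<in> A" "(\<sigma> \<circ> inv' \<tau>) y - y \<notin> nonunits"
      using unram gal_comp[OF st(1) gal_inv[OF st(2)]] by blast
    have "\<tau> (inv' \<tau> y) = y" using gal_bij[OF st(2)] by (simp add: bij_is_surj surj_f_inv_f)
    then show ?thesis using y gal_A[OF y(1) gal_inv[OF st(2)]] by (intro bexI[of _ "inv' \<tau> y"]) auto
  qed
  have "(\<Sum>\<sigma>\<in>gal. \<sigma> z * \<sigma> y) / of_nat p \<in> V" if y: "y \<in> A" for y
  proof (rule rational_nonunit)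
    have zyK: "z * y \<in> K" using z y subring_set_mult[OF A_subring] A_K by blast
    have eq: "(\<Sum>\<sigma>\<in>gal. \<sigma> z * \<sigma> y) = (\<Sum>\<sigma>\<in>gal. \<sigma> (z * y))" using z y by (simp add: gal_mult A_K)
    show "(\<Sum>\<sigma>\<in>gal. \<sigma> z * \<sigma> y) \<in> \<rat>" unfolding eq
    proof (rule fixed_rational)
      show "(\<Sum>\<sigma>\<in>gal. \<sigma> (z * y)) \<in> K" using gal_K zyK by (intro subring_set_sum[OF K_subring]) auto
      fix \<tau> assume t: "\<tau> \<in> gal"
      have "\<tau> (\<Sum>\<sigma>\<in>gal. \<sigma> (z * y)) = (\<Sum>\<sigma>\<in>gal. (\<tau> \<circ> \<sigma>) (z * y))"
        using gal_sum[OF t, of gal "\<lambda>\<sigma>. \<sigma> (z * y)"] gal_K zyK by simp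
      also have "\<dots> = (\<Sum>\<sigma>\<in>gal. \<sigma> (z * y))"
      proof (rule sum.reindex_bij_witness[of _ "\<lambda>\<sigma>. inv' \<tau> \<circ> \<sigma>" "\<lambda>\<sigma>. \<tau> \<circ> \<sigma>"])
        fix \<sigma> assume "\<sigma> \<in> gal"
        then show "\<tau> \<circ> \<sigma> \<in> gal" "inv' \<tau> \<circ> \<sigma> \<in> gal" using gal_comp t gal_inv by auto
        show "inv' \<tau> \<circ> (\<tau> \<circ> \<sigma>) = \<sigma>" using gal_bij[OF t] by (simp add: bij_is_inj flip: comp_assoc)
        show "\<tau> \<circ> (inv' \<tau> \<circ> \<sigma>) = \<sigma>" using gal_bij[OF t]
          by (simp add: bij_is_surj surj_iff[THEN iffD1] flip: comp_assoc)
      qed simp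
      finally show "\<tau> (\<Sum>\<sigma>\<in>gal. \<sigma> (z * y)) = (\<Sum>\<sigma>\<in>gal. \<sigma> (z * y))" .
    qed
    show "(\<Sum>\<sigma>\<in>gal. \<sigma> z * \<sigma> y) \<in> nonunits"
      using z y by (intro sum_nonunit mult_nonunit gal_A_V) auto
  qed
  then have "id z / of_nat p \<in> V"
    using independence_mod_p[OF distinct finite_gal subset_refl gal_id, of "\<lambda>\<sigma>. \<sigma> z"] by blast
  then show ?thesis by simp
qed

text \<open>The witness avoids the given prime but lies in all its other conjugates.\<close>

lemma exists_conjugate_killer:
  "\<exists>w\<in>A. w \<notin> nonunits \<and> (\<forall>x\<in>A. x \<in> nonunits \<longrightarrow> (\<forall>\<sigma>\<in>gal. \<sigma> (w * x) \<in> nonunits))"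
proof -
  \<comment> \<open>These are the automorphisms outside the decomposition group of the given
    prime.\<close>
  define bad where "bad = {\<sigma> \<in> gal. \<exists>x\<in>A. x \<in> nonunits \<and> \<sigma> x \<notin> nonunits}"
  have "\<exists>w. w \<in> A \<and> w \<notin> nonunits \<and> \<sigma> w \<in> nonunits" if bad: "\<sigma> \<in> bad" for \<sigma>
  proof -
    obtain x where s: "\<sigma> \<in> gal" and x: "x \<in> A" "x \<in> nonunits" "\<sigma> x \<notin> nonunits"
      using bad by (auto simp: bad_def)
    obtain k where k: "k > 0" "(\<sigma> ^^ k) = id" using gal_finite_order[OF s] by blast
    \<comment> \<open>Since \<sigma> has finite order, the iterates of x come back to the nonunits.
      The iterate just before the first return lies outside the nonunits, while its image under
      \<sigma> lies inside.\<close>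
    let ?P = "\<lambda>k. k > 0 \<and> (\<sigma> ^^ k) x \<in> nonunits"
    have "?P k" using k x by simp
    then have P: "?P (LEAST k. ?P k)" by (rule LeastI)
    then obtain j where j: "(LEAST k. ?P k) = Suc j" by (meson gr0_conv_Suc)
    have "j \<noteq> 0" using P x(3) unfolding j by (intro notI) simp
    moreover have "\<not> ?P j" by (rule not_less_Least) (simp add: j)
    ultimately have "(\<sigma> ^^ j) x \<notin> nonunits" by simp
    moreover have "\<sigma> ((\<sigma> ^^ j) x) \<in> nonunits" using P j by simp
    ultimately show ?thesis using gal_A[OF x(1) gal_funpow[OF s]] by blast
  qed
  then obtain w where w: "\<And>\<sigma>. \<sigma> \<in> bad \<Longrightarrow> w \<sigma> \<in> A \<and> w \<sigma> \<notin> nonunits \<and> \<sigma> (w \<sigma>) \<in> nonunits" by metis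
  have fin: "finite bad" using finite_gal by (simp add: bad_def)
  have wA: "prod w bad \<in> A" using w by (intro subring_set_prod[OF A_subring]) auto
  have "prod w bad \<notin> nonunits" using nonunit_prod[OF fin, of w] w A_V by blast
  moreover have "\<sigma> (prod w bad * x) \<in> nonunits" if x: "x \<in> A" "x \<in> nonunits" and s: "\<sigma> \<in> gal" for x \<sigma>
  proof -
    have eq: "\<sigma> (prod w bad * x) = \<sigma> (prod w bad) * \<sigma> x" using gal_mult[OF s] wA x A_K by blast
    show ?thesis
    proof (cases "\<sigma> \<in> bad")
      case True
      have "\<sigma> (prod w bad) = (\<Prod>\<tau>\<in>bad. \<sigma> (w \<tau>))" using w A_K by (intro gal_prod[OF s]) auto
      also have "\<dots> \<in> nonunits" by (rule prod_nonunit[OF fin True]) (use w gal_A_V s True in auto)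
      finally show ?thesis unfolding eq using mult_nonunit gal_A_V[OF x(1) s] by blast
    next
      case False
      then have "\<sigma> x \<in> nonunits" using x s by (auto simp: bad_def)
      then show ?thesis unfolding eq using mult_nonunit gal_A_V[OF wA s] by (metis mult.commute)
    qed
  qed
  ultimately show ?thesis using wA by blast
qed

text \<open>With trivial inertia, \<open>unramified_dvd\<close> applies to
  \<open>w * (of_int c - x)\<close> for x = r and x = s, because the factor w turns all conjugates
  into nonunits. As w is a unit of V, both differences are divisible by p, so the whole product is
  divisible by \<open>p ^ 2\<close>.\<close>

theorem exists_inertia:
  assumes r: "r \<in> R" "s \<in> R" "r \<noteq> s" "of_int c - r \<in> nonunits" "of_int c - s \<in> nonunits"
    and val: "(\<Prod>r\<in>R. of_int c - r) / of_nat p ^ 2 \<notin> V"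
  shows "\<exists>\<sigma>\<in>gal. \<sigma> \<noteq> id \<and> (\<forall>y\<in>A. \<sigma> y - y \<in> nonunits)"
proof (rule ccontr)
  assume "\<not> ?thesis"
  then have unram: "\<And>\<sigma>. \<sigma> \<in> gal \<Longrightarrow> \<sigma> \<noteq> id \<Longrightarrow> \<exists>y\<in>A. \<sigma> y - y \<notin> nonunits" by blast
  obtain w where w: "w \<in> A" "w \<notin> nonunits"
     "\<And>x \<sigma>. x \<in> A \<Longrightarrow> x \<in> nonunits \<Longrightarrow> \<sigma> \<in> gal \<Longrightarrow> \<sigma> (w * x) \<in> nonunits"
    using exists_conjugate_killer by blast
  have cA: "of_int c - x \<in> A" if "x \<in> R" for x
    using R_A[OF that] subring_set_diff[OF A_subring] subring_set_of_int[OF A_subring] by blast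
  have div: "(of_int c - x) / of_nat p \<in> V" if x: "x \<in> R" "of_int c - x \<in> nonunits" for x
  proof -
    have "w * (of_int c - x) / of_nat p \<in> V"
      by (rule unramified_dvd[OF unram]) (use w x cA subring_set_mult[OF A_subring] in auto)
    then have "inverse w * (w * (of_int c - x) / of_nat p) \<in> V"
      using w A_V by (intro closed unit_inverse) auto
    moreover have "w \<noteq> 0" using w(2) zero_nonunit by auto
    ultimately show ?thesis by (simp add: field_simps)
  qed
  have "(\<Prod>r\<in>R. of_int c - r) = (of_int c - r) * ((of_int c - s) * (\<Prod>r\<in>R - {r} - {s}. of_int c - r))"
    using r finite_R by (simp add: prod.remove[of R r] prod.remove[of "R - {r}" s])
  then have "(\<Prod>r\<in>R. of_int c - r) / of_nat p ^ 2 =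
      (of_int c - r) / of_nat p * ((of_int c - s) / of_nat p) * (\<Prod>r\<in>R - {r} - {s}. of_int c - r)"
    by (simp add: power2_eq_square)
  also have "\<dots> \<in> V"
    by (intro closed div r) (use R_V in auto)
  finally show False using val by simp
qed

end

section \<open>Permutation groups containing a three-cycle\<close>

definition three_cycle :: "'a \<Rightarrow> 'a \<Rightarrow> 'a \<Rightarrow> 'a \<Rightarrow> 'a" where
  "three_cycle a b c = cycle_of_list [a, b, c]"

lemma three_cycle_apply:
  assumes "distinct [a, b, c]"
  shows "three_cycle a b c a = b" "three_cycle a b c b = c" "three_cycle a b c c = a"
    "x \<notin> {a, b, c} \<Longrightarrow> three_cycle a b c x = x"
  using assms by (auto simp: three_cycle_def transpose_def)

lemma three_cycle_rotate:
  assumes "distinct [a, b, c]" shows "three_cycle b c a = three_cycle a b c"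
  using assms by (auto simp: three_cycle_def fun_eq_iff transpose_def)

lemma three_cycle_inverse:
  assumes "distinct [a, b, c]" shows "inv' (three_cycle a b c) = three_cycle c b a"
  by (rule inv_unique_comp) (use assms in \<open>auto simp: three_cycle_def fun_eq_iff transpose_def\<close>)

locale perm_group =
  fixes G :: "('a \<Rightarrow> 'a) set" and Y :: "'a set"
  assumes permutes: "p \<in> G \<Longrightarrow> p permutes Y"
    and comp_closed: "p \<in> G \<Longrightarrow> q \<in> G \<Longrightarrow> p \<circ> q \<in> G"
    and inv_closed: "p \<in> G \<Longrightarrow> inv' p \<in> G"
begin

lemma three_cycle_conj:
  assumes "three_cycle a b c \<in> G" "distinct [a, b, c]" "p \<in> G"
  shows "three_cycle (p a) (p b) (p c) \<in> G"
proof -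
  have "bij p" using permutes[OF assms(3)] by (rule permutes_bij)
  then have "p \<circ> three_cycle a b c \<circ> inv' p = three_cycle (p a) (p b) (p c)"
    using conjugation_of_cycle[of "[a, b, c]" p] assms(2) by (simp add: three_cycle_def)
  moreover have "p \<circ> three_cycle a b c \<circ> inv' p \<in> G"
    by (intro comp_closed inv_closed assms)
  ultimately show ?thesis by (simp only:)
qed

text \<open>Conjugating (x z w) by (x y w) gives (y z x).\<close>

lemma three_cycle_merge:
  assumes "three_cycle x y w \<in> G" "three_cycle x z w \<in> G" "distinct [x, y, z, w]"
  shows "three_cycle x y z \<in> G"
proof -
  have "three_cycle y z x \<in> G"
    using three_cycle_conj[OF assms(2) _ assms(1)] three_cycle_apply(1,3)[of x y w] three_cycle_apply(4)[of x y w z] assms(3) by auto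
  then show ?thesis using three_cycle_rotate[of x y z] assms(3) by simp
qed

text \<open>Conjugation and double transitivity give, for every ordered pair s, t, some three-cycle
  (s t w) in G. Applied to x, y and to x, z this yields (x y w) and (x z v), and it remains to align
  w with v.\<close>

lemma all_three_cycles:
  assumes trans: "\<And>x y x' y'. x \<in> Y \<Longrightarrow> y \<in> Y \<Longrightarrow> x' \<in> Y \<Longrightarrow> y' \<in> Y \<Longrightarrow> x \<noteq> y \<Longrightarrow> x' \<noteq> y' \<Longrightarrow>
      \<exists>p\<in>G. p x = x' \<and> p y = y'"
    and three: "three_cycle a b c \<in> G" "distinct [a, b, c]" "{a, b, c} \<subseteq> Y"
    and xyz: "distinct [x, y, z]" "{x, y, z} \<subseteq> Y"
  shows "three_cycle x y z \<in> G"
proof -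
  have third: "\<exists>w. w \<in> Y \<and> w \<noteq> s \<and> w \<noteq> t \<and> three_cycle s t w \<in> G" if "s \<in> Y" "t \<in> Y" "s \<noteq> t" for s t
  proof -
    obtain p where p: "p \<in> G" "p a = s" "p b = t" using trans[of a b s t] three \<open>s \<in> Y\<close> \<open>t \<in> Y\<close> \<open>s \<noteq> t\<close> by auto
    have "inj p" using permutes_inj[OF permutes[OF p(1)]] .
    then have "p c \<noteq> s" "p c \<noteq> t" using p three(2) by (auto simp: inj_eq simp flip: p(2,3))
    moreover have "p c \<in> Y" using permutes_in_image[OF permutes[OF p(1)]] three(3) by auto
    ultimately show ?thesis using three_cycle_conj[OF three(1,2) p(1)] p by auto
  qed
  obtain w where w: "w \<in> Y" "w \<noteq> x" "w \<noteq> y" "three_cycle x y w \<in> G" using third[of x y] xyz by auto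
  obtain v where v: "v \<in> Y" "v \<noteq> x" "v \<noteq> z" "three_cycle x z v \<in> G" using third[of x z] xyz by auto
  consider "w = z" | "v = y" | "w \<noteq> z" "v \<noteq> y" "v = w" | "w \<noteq> z" "v \<noteq> y" "v \<noteq> w" by blast
  then show ?thesis
  proof cases
    case 1 then show ?thesis using w by simp
  next
    case 2
    then have "three_cycle y z x \<in> G"
      using inv_closed[OF v(4)] three_cycle_inverse[of x z y] xyz by auto
    then show ?thesis using three_cycle_rotate[of x y z] xyz by simp
  next
    case 3
    then show ?thesis using three_cycle_merge[of x y w z] w v xyz by simp
  next
    case 4
    \<comment> \<open>Conjugating (x y w) by (x z v) yields (z y w). Merging it with (x y w) gives
      (x z w), so v has been replaced by w as in the third case.\<close>
    have "three_cycle z y w \<in> G"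
      using three_cycle_conj[OF w(4) _ v(4)] three_cycle_apply(1)[of x z v] three_cycle_apply(4)[of x z v y]
        three_cycle_apply(4)[of x z v w] xyz w v 4 by auto
    then have "three_cycle w z y \<in> G" using three_cycle_rotate[of w z y] xyz w 4 by auto
    moreover have "three_cycle w x y \<in> G" using w three_cycle_rotate[of w x y] xyz by auto
    ultimately have "three_cycle w x z \<in> G" using three_cycle_merge[of w x y z] xyz w 4 by auto
    then have "three_cycle x z w \<in> G" using three_cycle_rotate[of w x z] xyz w 4 by auto
    then show ?thesis using three_cycle_merge[of x y w z] w xyz 4 by simp
  qed
qed

text \<open>A nontrivial permutation of at most three points is a transposition or a three-cycle. If
  p swaps a and b, a further moved point x would put the four points a, b, x, \<open>p x\<close>
  into S.\<close>

lemma small_support_three_cycle: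
  assumes p: "p \<in> G" "p \<noteq> id" and S: "finite S" "card S \<le> 3" "\<And>x. x \<notin> S \<Longrightarrow> p x = x"
    and no_swap: "\<And>a b. a \<in> Y \<Longrightarrow> b \<in> Y \<Longrightarrow> a \<noteq> b \<Longrightarrow> transpose a b \<notin> G"
  shows "\<exists>a b c. distinct [a, b, c] \<and> {a, b, c} \<subseteq> Y \<and> three_cycle a b c \<in> G"
proof -
  have inj: "inj p" using permutes_inj[OF permutes[OF p(1)]] .
  obtain a where a: "p a \<noteq> a" using p(2) by (auto simp: fun_eq_iff)
  define b where "b = p a"
  define c where "c = p b"
  have ab: "a \<noteq> b" and bc: "b \<noteq> c" using a inj by (auto simp: b_def c_def inj_eq)
  have aY: "a \<in> Y" using a permutes_not_in[OF permutes[OF p(1)]] by blast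
  then have Y: "a \<in> Y" "b \<in> Y" "c \<in> Y" using permutes_in_image[OF permutes[OF p(1)]] by (auto simp: b_def c_def)
  have aS: "a \<in> S" "b \<in> S" using S(3)[of a] S(3)[of b] a bc by (auto simp: c_def)
  have cS: "c \<in> S" if "c \<noteq> a"
  proof (rule ccontr)
    assume "c \<notin> S"
    then have "p c = c" by (rule S(3))
    then have "p c = p b" by (simp add: c_def)
    then show False using bc inj by (auto simp: inj_eq)
  qed
  have pS: "p x \<in> S" if "x \<in> S" for x
  proof (rule ccontr)
    assume "p x \<notin> S"
    then have "p (p x) = p x" by (rule S(3))
    then have "p x = x" using inj by (simp add: inj_eq)
    then show False using that \<open>p x \<notin> S\<close> by simp
  qed
  show ?thesis
  proof (cases "c = a")
    case True
    have "p x = x" if "x \<notin> {a, b}" for x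
    proof (rule ccontr)
      assume x: "p x \<noteq> x"
      then have "x \<in> S" using S(3) by blast
      moreover from this have "p x \<in> S" by (rule pS)
      moreover have "p x \<noteq> a" "p x \<noteq> b" using that True inj by (auto simp: b_def c_def inj_eq)
      ultimately have "card {a, b, x, p x} \<le> card S" using aS by (intro card_mono S(1)) auto
      moreover have "card {a, b, x, p x} = 4" using ab that x \<open>p x \<noteq> a\<close> \<open>p x \<noteq> b\<close> by auto
      ultimately show False using S(2) by simp
    qed
    then have "p = transpose a b" using True by (auto simp: fun_eq_iff transpose_def b_def c_def)
    then show ?thesis using no_swap[OF Y(1,2) ab] p(1) by simp
  next
    case False
    have "card {a, b, c} = 3" using ab bc False by auto
    then have Seq: "S = {a, b, c}" using card_subset_eq[OF S(1), of "{a, b, c}"] aS cS[OF False] S(2)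
      by (metis card_mono S(1) empty_subsetI insert_subset order_antisym)
    have "p c \<in> {a, b, c}" using pS[of c] Seq by auto
    moreover have "p c \<noteq> b" "p c \<noteq> c" using False bc inj by (auto simp: b_def c_def inj_eq)
    ultimately have pc: "p c = a" by simp
    have d: "distinct [a, b, c]" using ab bc False by auto
    have "p x = three_cycle a b c x" for x
      using three_cycle_apply[OF d] pc S(3)[of x] Seq b_def c_def by (cases "x \<in> {a, b, c}") auto
    then have "p = three_cycle a b c" by blast
    then show ?thesis using d Y p(1) by blast
  qed
qed

text \<open>Three-cycles generate the alternating group, so its copy on Y lies in G. An odd element
  of G times a suitable even one would be a transposition, so nothing else lies in G.\<close>

lemma iso_alt_group:
  assumes Y: "finite Y" "card Y = n" "n \<ge> 3"
    and three: "\<And>a b c. distinct [a, b, c] \<Longrightarrow> {a, b, c} \<subseteq> Y \<Longrightarrow> three_cycle a b c \<in> G"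
    and no_swap: "\<And>a b. a \<in> Y \<Longrightarrow> b \<in> Y \<Longrightarrow> a \<noteq> b \<Longrightarrow> transpose a b \<notin> G"
  shows "\<lparr>carrier = G, monoid.mult = (\<circ>), one = id\<rparr> \<cong> alt_group n"
proof -
  obtain f where f: "bij_betw f {1..n} Y"
    using Y by (metis card_atLeastAtMost diff_Suc_1 finite_atLeastAtMost finite_same_card_bij)
  then have inj: "inj_on f {1..n}" and fY: "\<And>i. i \<in> {1..n} \<Longrightarrow> f i \<in> Y" by (auto simp: bij_betw_def)
  define \<Phi> where "\<Phi> = map_permutation {1..n} f"
  define \<Psi> where "\<Psi> = map_permutation Y (inv_into {1..n} f)"
  have comp: "\<Phi> (p \<circ> q) = \<Phi> p \<circ> \<Phi> q" if "q permutes {1..n}" for p q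
    unfolding \<Phi>_def by (rule map_permutation_compose'[OF inj that])
  have \<Psi>\<Phi>: "\<Psi> (\<Phi> p) = p" if "p permutes {1..n}" for p
    unfolding \<Phi>_def \<Psi>_def
    by (rule map_permutation_compose_inv[OF f that]) (use inj in \<open>auto simp: inv_into_f_f\<close>)
  have \<Phi>\<Psi>: "\<Phi> (\<Psi> p) = p" if "p permutes Y" for p
    unfolding \<Phi>_def \<Psi>_def
    by (rule map_permutation_compose_inv[OF bij_betw_inv_into[OF f] that])
      (use f in \<open>auto simp: bij_betw_def f_inv_into_f\<close>)
  have \<Psi>perm: "\<Psi> p permutes {1..n}" if "p permutes Y" for p
    unfolding \<Psi>_def by (rule map_permutation_permutes[OF bij_betw_inv_into[OF f] that])
  have \<Phi>cyc: "\<Phi> h \<in> G" if h: "h \<in> three_cycles n" for h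
  proof -
    obtain cs where cs: "h = cycle_of_list cs" "cycle cs" "length cs = 3" "set cs \<subseteq> {1..n}"
      using h by auto
    obtain a b c where cs_def: "cs = [a, b, c]" using stupid_lemma[OF cs(3)] by auto
    have abc: "a \<in> {1..n}" "b \<in> {1..n}" "c \<in> {1..n}" "distinct [a, b, c]" using cs cs_def by auto
    have "\<Phi> h = transpose (f a) (f b) \<circ> transpose (f b) (f c)"
      using cs(1) comp[of "transpose b c" "transpose a b"] permutes_swap_id[OF abc(2,3)]
        map_permutation_transpose[OF inj abc(1,2)] map_permutation_transpose[OF inj abc(2,3)]
      by (simp add: cs_def \<Phi>_def)
    then have "\<Phi> h = three_cycle (f a) (f b) (f c)" by (simp add: three_cycle_def)
    moreover have "distinct [f a, f b, f c]" using abc inj_on_eq_iff[OF inj] by simp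
    ultimately show ?thesis using three[of "f a" "f b" "f c"] fY[OF abc(1)] fY[OF abc(2)] fY[OF abc(3)] by simp
  qed
  have "id \<in> G"
  proof -
    have "distinct [f 1, f 2, f 3]" using inj_on_eq_iff[OF inj] Y(3) by simp
    then have c: "three_cycle (f 1) (f 2) (f 3) \<in> G" using three[of "f 1" "f 2" "f 3"] fY[of 1] fY[of 2] fY[of 3] Y(3) by simp
    from comp_closed[OF c inv_closed[OF c]] show ?thesis
      unfolding permutes_inv_o(1)[OF permutes[OF c]] .
  qed
  have id: "\<Phi> id = id" unfolding \<Phi>_def by (rule map_permutation_id'[OF inj])
  have alt: "\<Phi> q \<in> G" if "q \<in> carrier (alt_group n)" for q
  proof -
    have "q \<in> generate (alt_group n) (three_cycles n)" using that alt_group_carrier_as_three_cycles by simp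
    then show ?thesis
    proof (induction rule: generate.induct)
      case one then show ?case unfolding alt_group_one id by fact
    next
      case (incl h) then show ?case by (rule \<Phi>cyc)
    next
      case (inv h)
      have h: "h \<in> carrier (alt_group n)" using inv three_cycles_incl by blast
      then have hp: "h permutes {1..n}" by (simp add: alt_group_carrier)
      have "\<Phi> (inv' h) \<circ> \<Phi> h = id" using comp[OF hp, of "inv' h"] permutes_inv_o(2)[OF hp] id by simp
      moreover have "\<Phi> h \<circ> \<Phi> (inv' h) = id"
        using comp[OF permutes_inv[OF hp], of h] permutes_inv_o(1)[OF hp] id by simp
      ultimately have "inv' (\<Phi> h) = \<Phi> (inv' h)" by (rule inv_unique_comp[rotated])
      then show ?case using inv_closed[OF \<Phi>cyc[OF inv]] alt_group_inv_equality[OF h] by simp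
    next
      case (eng h1 h2)
      then have h2: "h2 permutes {1..n}" using alt_group_carrier alt_group_carrier_as_three_cycles by blast
      show ?case unfolding alt_group_mult comp[OF h2] by (rule comp_closed[OF eng.IH])
    qed
  qed
  have surj: "\<Psi> p \<in> carrier (alt_group n)" if p: "p \<in> G" for p
  proof (rule ccontr)
    assume "\<Psi> p \<notin> carrier (alt_group n)"
    then have odd: "\<not> evenperm (\<Psi> p)" using \<Psi>perm[OF permutes[OF p]] by (simp add: alt_group_carrier)
    let ?t = "transpose 1 (2::nat)"
    have tp: "?t permutes {1..n}" using Y(3) by (intro permutes_swap_id) auto
    have "evenperm (?t \<circ> \<Psi> p)"
    proof -
      have "permutation (\<Psi> p)" using \<Psi>perm[OF permutes[OF p]] permutation_permutes by blast
      then show ?thesis using odd by (simp add: evenperm_comp permutation_swap_id evenperm_swap)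
    qed
    then have "?t \<circ> \<Psi> p \<in> carrier (alt_group n)"
      using permutes_compose[OF \<Psi>perm[OF permutes[OF p]] tp] by (simp add: alt_group_carrier)
    then have "\<Phi> ?t \<circ> p \<in> G" using alt comp[OF \<Psi>perm[OF permutes[OF p]], of ?t] \<Phi>\<Psi>[OF permutes[OF p]] by metis
    then have "\<Phi> ?t \<circ> p \<circ> inv' p \<in> G" using comp_closed inv_closed p by blast
    then have "\<Phi> ?t \<in> G" using permutes_inv_o(1)[OF permutes[OF p]] by (simp add: comp_assoc)
    moreover have "\<Phi> ?t = transpose (f 1) (f 2)"
      unfolding \<Phi>_def using Y(3) by (intro map_permutation_transpose[OF inj]) auto
    moreover have "f 1 \<noteq> f 2" using inj_on_eq_iff[OF inj, of 1 2] Y(3) by simp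
    ultimately show False using no_swap[of "f 1" "f 2"] fY[of 1] fY[of 2] Y(3) by simp
  qed
  have perm_alt: "q permutes {1..n}" if "q \<in> carrier (alt_group n)" for q
    using that by (simp add: alt_group_carrier)
  have "\<Phi> \<in> iso (alt_group n) \<lparr>carrier = G, monoid.mult = (\<circ>), one = id\<rparr>"
  proof (rule isoI)
    show "\<Phi> \<in> hom (alt_group n) \<lparr>carrier = G, monoid.mult = (\<circ>), one = id\<rparr>"
      using alt comp perm_alt by (auto simp: hom_def alt_group_mult)
    show "bij_betw \<Phi> (carrier (alt_group n)) (carrier \<lparr>carrier = G, monoid.mult = (\<circ>), one = id\<rparr>)"
      by (rule bij_betwI[of _ _ _ \<Psi>]) (use alt surj \<Psi>\<Phi> \<Phi>\<Psi> perm_alt permutes in auto)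
  qed
  then show ?thesis
    using group.iso_sym[OF alt_group_is_group] by (auto simp: is_iso_def)
qed

end

section \<open>Discriminant and transitivity\<close>

context splitting
begin

text \<open>The index set and the action are kept abstract so that both sets of roots and sets of
  pairs of roots are covered.\<close>

lemma invariant_prod_rational:
  assumes T: "finite T" "\<And>t. t \<in> T \<Longrightarrow> h t \<in> K"
    and act: "\<And>\<sigma>. \<sigma> \<in> gal \<Longrightarrow> inj_on (act \<sigma>) T" "\<And>\<sigma> t. \<sigma> \<in> gal \<Longrightarrow> t \<in> T \<Longrightarrow> act \<sigma> t \<in> T"
    and equi: "\<And>\<sigma> t. \<sigma> \<in> gal \<Longrightarrow> t \<in> T \<Longrightarrow> \<sigma> (h t) = h (act \<sigma> t)"
  shows "prod h T \<in> \<rat>"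
proof (rule fixed_rational)
  show "prod h T \<in> K" using T(2) by (rule subring_set_prod[OF K_subring])
  fix \<sigma> assume s: "\<sigma> \<in> gal"
  have img: "act \<sigma> ` T = T" using T(1) act[OF s] by (intro endo_inj_surj) auto
  have "\<sigma> (prod h T) = (\<Prod>t\<in>T. h (act \<sigma> t))" using gal_prod[OF s, of T h] T(2) equi[OF s] by simp
  also have "\<dots> = prod h (act \<sigma> ` T)" using act(1)[OF s] by (simp add: prod.reindex)
  finally show "\<sigma> (prod h T) = prod h T" using img by simp
qed

lemma gal_inj: "\<sigma> \<in> gal \<Longrightarrow> \<sigma> x = \<sigma> y \<longleftrightarrow> x = y"
  using gal_bij by (simp add: bij_is_inj inj_eq)

text \<open>Every unordered pair occurs twice, so this is the discriminant up to the sign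
  \<open>(-1) ^ (card C choose 2)\<close>, written without an ordering of the roots.\<close>

definition pair_prod :: "complex set \<Rightarrow> complex" where
  "pair_prod C = (\<Prod>c\<in>C. \<Prod>d\<in>C - {c}. c - d)"

lemma pair_prod_insert:
  assumes "finite C" "e \<notin> C"
  shows "pair_prod (insert e C) = pair_prod C * (-1) ^ card C * (\<Prod>c\<in>C. e - c) ^ 2"
proof -
  have "(\<Prod>d\<in>insert e C - {c}. c - d) = - (e - c) * (\<Prod>d\<in>C - {c}. c - d)" if "c \<in> C" for c
  proof -
    have "insert e C - {c} = insert e (C - {c})" using that assms by auto
    then show ?thesis using assms by simp
  qed
  moreover have "insert e C - {e} = C" using assms by auto
  ultimately have "pair_prod (insert e C) = (\<Prod>c\<in>C. e - c) * (\<Prod>c\<in>C. - (e - c) * (\<Prod>d\<in>C - {c}. c - d))"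
    using assms by (simp add: pair_prod_def)
  also have "(\<Prod>c\<in>C. - (e - c) * (\<Prod>d\<in>C - {c}. c - d)) = (\<Prod>c\<in>C. - (e - c)) * pair_prod C"
    by (simp only: prod.distrib pair_prod_def)
  also have "(\<Prod>c\<in>C. - (e - c)) = (-1) ^ card C * (\<Prod>c\<in>C. e - c)"
    by (rule prod_uminus)
  finally show ?thesis by (simp add: power2_eq_square)
qed

text \<open>\<Phi> is a Vandermonde product, built by adding one root at a time. Only its square and
  its invariance under automorphisms fixing C pointwise are recorded.\<close>

lemma pair_prod_square:
  assumes "finite C" "C \<subseteq> K"
  shows "\<exists>\<Phi>\<in>K. pair_prod C = (-1) ^ (card C choose 2) * \<Phi>\<^sup>2 \<and>
    (\<forall>\<sigma>\<in>gal. (\<forall>c\<in>C. \<sigma> c = c) \<longrightarrow> \<sigma> \<Phi> = \<Phi>)"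
  using assms
proof (induction C rule: finite_induct)
  case empty
  then show ?case by (intro bexI[of _ 1]) (auto simp: pair_prod_def gal_rat subring_set_one[OF K_subring] binomial_eq_0)
next
  case (insert e C)
  then obtain \<Phi> where \<Phi>: "\<Phi> \<in> K" "pair_prod C = (-1) ^ (card C choose 2) * \<Phi>\<^sup>2"
    "\<And>\<sigma>. \<sigma> \<in> gal \<Longrightarrow> (\<forall>c\<in>C. \<sigma> c = c) \<Longrightarrow> \<sigma> \<Phi> = \<Phi>" by auto
  have eC: "e - c \<in> K" if "c \<in> C" for c using that insert.prems subring_set_diff[OF K_subring] by blast
  have PK: "(\<Prod>c\<in>C. e - c) \<in> K" using eC by (rule subring_set_prod[OF K_subring])
  show ?case
  proof (intro bexI[of _ "\<Phi> * (\<Prod>c\<in>C. e - c)"] conjI ballI impI)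
    show "\<Phi> * (\<Prod>c\<in>C. e - c) \<in> K" using \<Phi>(1) PK by (rule subring_set_mult[OF K_subring])
    show "pair_prod (insert e C) = (-1) ^ (card (insert e C) choose 2) * (\<Phi> * (\<Prod>c\<in>C. e - c))\<^sup>2"
      using insert.hyps by (simp add: pair_prod_insert \<Phi>(2) numeral_2_eq_2 power_add power_mult_distrib)
    fix \<sigma> assume s: "\<sigma> \<in> gal" "\<forall>c\<in>insert e C. \<sigma> c = c"
    have "\<sigma> (\<Prod>c\<in>C. e - c) = (\<Prod>c\<in>C. \<sigma> (e - c))" using eC by (rule gal_prod[OF s(1)])
    also have "\<dots> = (\<Prod>c\<in>C. e - c)"
      using s insert.prems by (intro prod.cong) (auto simp: gal_diff subset_iff)
    finally show "\<sigma> (\<Phi> * (\<Prod>c\<in>C. e - c)) = \<Phi> * (\<Prod>c\<in>C. e - c)"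
      using \<Phi> s by (simp add: gal_mult PK)
  qed
qed

text \<open>The product \<open>(x - y) * E * \<Phi>\<close> is a square root of the discriminant. E
  is symmetric in x and y and \<Phi> involves only the fixed roots, so a transposition negates it;
  but it equals w or - w, which is rational and hence fixed.\<close>

lemma no_transposition:
  assumes disc: "pair_prod R = - w\<^sup>2" "w \<in> \<rat>" and card: "card R mod 8 = 2"
    and s: "\<sigma> \<in> gal" "x \<in> R" "y \<in> R" "x \<noteq> y" "\<sigma> x = y" "\<sigma> y = x" "\<And>r. r \<in> R \<Longrightarrow> r \<noteq> x \<Longrightarrow> r \<noteq> y \<Longrightarrow> \<sigma> r = r"
  shows False
proof -
  define C where "C = R - {x, y}"
  have C: "finite C" "C \<subseteq> K" using finite_R R_K by (auto simp: C_def)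
  have R: "R = insert x (insert y C)" "x \<notin> insert y C" "y \<notin> C" using s by (auto simp: C_def)
  have "card R = card C + 2" using C(1) R by simp
  \<comment> \<open>This makes the sign of \<open>pair_prod C\<close> positive, and inserting y and
    then x into C contributes exactly one factor -1.\<close>
  then have cC: "card C mod 8 = 0" using card by presburger
  then obtain j where j: "card C = 8 * j" by auto
  have ch: "card C choose 2 = 2 * (2 * j * (8 * j - 1))" by (simp add: j choose_two)
  then have ev: "even (card C choose 2)" "even (card C)" using j by auto
  obtain \<Phi> where \<Phi>: "\<Phi> \<in> K" "pair_prod C = \<Phi>\<^sup>2" "\<sigma> \<Phi> = \<Phi>"
    using pair_prod_square[OF C] s(1,7) ev(1) unfolding C_def by force
  define E where "E = (\<Prod>c\<in>C. x - c) * (\<Prod>c\<in>C. y - c)"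
  have xc: "x - c \<in> K" "y - c \<in> K" if "c \<in> C" for c
    using that C(2) s R_K subring_set_diff[OF K_subring] by blast+
  have PK: "(\<Prod>c\<in>C. x - c) \<in> K" "(\<Prod>c\<in>C. y - c) \<in> K"
    using xc by (auto intro: subring_set_prod[OF K_subring])
  have "\<sigma> (\<Prod>c\<in>C. x - c) = (\<Prod>c\<in>C. \<sigma> (x - c))" "\<sigma> (\<Prod>c\<in>C. y - c) = (\<Prod>c\<in>C. \<sigma> (y - c))"
    using xc by (auto intro!: gal_prod[OF s(1)])
  moreover have "\<sigma> (x - c) = y - c" "\<sigma> (y - c) = x - c" if "c \<in> C" for c
    using that s R_K by (auto simp: C_def gal_diff subset_iff)
  ultimately have sP: "\<sigma> (\<Prod>c\<in>C. x - c) = (\<Prod>c\<in>C. y - c)" "\<sigma> (\<Prod>c\<in>C. y - c) = (\<Prod>c\<in>C. x - c)" by simp_all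
  have EK: "E \<in> K" unfolding E_def using PK by (rule subring_set_mult[OF K_subring])
  have sE: "\<sigma> E = E" using sP PK by (simp add: E_def gal_mult[OF s(1)])
  have xyK: "x - y \<in> K" using s R_K subring_set_diff[OF K_subring] by blast
  have sxy: "\<sigma> (x - y) = - (x - y)" using s R_K by (auto simp: gal_diff subset_iff)
  define \<delta> where "\<delta> = (x - y) * E * \<Phi>"
  have "\<sigma> \<delta> = - \<delta>"
  proof -
    have "\<sigma> \<delta> = \<sigma> ((x - y) * E) * \<sigma> \<Phi>"
      unfolding \<delta>_def by (intro gal_mult[OF s(1)] subring_set_mult[OF K_subring] xyK EK \<Phi>(1))
    also have "\<sigma> ((x - y) * E) = \<sigma> (x - y) * \<sigma> E" by (intro gal_mult[OF s(1)] xyK EK)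
    finally show ?thesis unfolding sxy sE \<Phi>(3) \<delta>_def by (simp add: algebra_simps)
  qed
  moreover have "\<delta> \<in> \<rat>"
  proof -
    have "pair_prod R = - \<delta>\<^sup>2"
      using C(1) R(2,3) ev(2) by (simp add: R(1) pair_prod_insert \<Phi>(2) \<delta>_def E_def power_mult_distrib)
    then have "\<delta>\<^sup>2 = w\<^sup>2" using disc by simp
    then have "\<delta> = w \<or> \<delta> = - w" by (simp add: power2_eq_iff)
    then show ?thesis using disc(2) by auto
  qed
  ultimately have "\<delta> = 0" using gal_rat[OF s(1), of \<delta>] by simp
  moreover have "pair_prod R \<noteq> 0" using finite_R by (auto simp: pair_prod_def)
  ultimately show False using C(1) R(2,3) ev(2)
    by (simp add: R(1) pair_prod_insert \<Phi>(2) \<delta>_def E_def) 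
qed

end

section \<open>Orbits on roots and on pairs of roots\<close>

context splitting_valuation
begin

text \<open>Eisenstein by orbits: the products over the orbit of x and over its complement are
  rational nonunits, each divisible by p, so two parts would give \<open>p ^ 2\<close>.\<close>

lemma transitive:
  assumes nonunit: "\<And>r. r \<in> R \<Longrightarrow> r \<in> nonunits" and val: "(\<Prod>r\<in>R. r) / of_nat p ^ 2 \<notin> V"
    and xy: "x \<in> R" "y \<in> R"
  shows "\<exists>\<sigma>\<in>gal. \<sigma> x = y"
proof (rule ccontr)
  assume no: "\<not> ?thesis"
  define T where "T = (\<lambda>\<sigma>. \<sigma> x) ` gal"
  have T: "T \<subseteq> R" "x \<in> T" "y \<notin> T"
  proof -
    show "T \<subseteq> R" using gal_R xy by (auto simp: T_def)
    show "x \<in> T" unfolding T_def by (rule image_eqI[OF _ gal_id]) simp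
    show "y \<notin> T" using no by (auto simp: T_def)
  qed
  have inv: "\<sigma> t \<in> T" if s: "\<sigma> \<in> gal" and t: "t \<in> T" for \<sigma> t
  proof -
    obtain \<tau> where "\<tau> \<in> gal" "t = \<tau> x" using t by (auto simp: T_def)
    then show ?thesis unfolding T_def by (intro image_eqI[OF _ gal_comp[OF s]]) auto
  qed
  have inv': "\<sigma> t \<in> R - T" if s: "\<sigma> \<in> gal" and t: "t \<in> R - T" for \<sigma> t
  proof -
    have "t \<in> T" if "\<sigma> t \<in> T"
    proof -
      have "inv' \<sigma> (\<sigma> t) \<in> T" using inv[OF gal_inv[OF s] that] .
      then show ?thesis using gal_bij[OF s] by (simp add: bij_is_inj inv_f_f)
    qed
    then show ?thesis using t gal_R[OF s] by auto
  qed
  have div: "(\<Prod>r\<in>S. r) / of_nat p \<in> V"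
    if S: "S \<subseteq> R" "S \<noteq> {}" "\<And>\<sigma> t. \<sigma> \<in> gal \<Longrightarrow> t \<in> S \<Longrightarrow> \<sigma> t \<in> S" for S
  proof (rule rational_nonunit)
    have fin: "finite S" using S(1) finite_R finite_subset by blast
    show "(\<Prod>r\<in>S. r) \<in> \<rat>"
      by (rule invariant_prod_rational[OF fin, of _ "\<lambda>\<sigma>. \<sigma>"]) (use S R_K gal_inj in \<open>auto simp: inj_on_def\<close>)
    obtain r where "r \<in> S" using S(2) by blast
    then show "(\<Prod>r\<in>S. r) \<in> nonunits"
      by (rule prod_nonunit[OF fin]) (use S nonunit R_V \<open>r \<in> S\<close> in auto)
  qed
  have "(\<Prod>r\<in>R. r) = (\<Prod>r\<in>T. r) * (\<Prod>r\<in>R - T. r)"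
    using prod.subset_diff[OF T(1) finite_R] by (simp add: mult.commute)
  then have "(\<Prod>r\<in>R. r) / of_nat p ^ 2 = (\<Prod>r\<in>T. r) / of_nat p * ((\<Prod>r\<in>R - T. r) / of_nat p)"
    by (simp add: power2_eq_square)
  also have "\<dots> \<in> V" by (intro closed div) (use T inv inv' xy in auto)
  finally show False using val by simp
qed

text \<open>Shifting every factor by a multiple of d changes the product by a multiple of d.\<close>

lemma prod_perturb:
  assumes "finite I" "\<And>i. i \<in> I \<Longrightarrow> g i \<in> V" "e \<in> V" "e / d \<in> V"
  shows "(prod g I - (\<Prod>i\<in>I. g i + e)) / d \<in> V"
  using assms
proof (induction I rule: finite_induct)
  case (insert i I)
  have "(prod g (insert i I) - (\<Prod>i\<in>insert i I. g i + e)) / d =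
      g i * ((prod g I - (\<Prod>i\<in>I. g i + e)) / d) - e / d * (\<Prod>i\<in>I. g i + e)"
    using insert.hyps by (simp add: algebra_simps diff_divide_distrib add_divide_distrib)
  also have "\<dots> \<in> V" using insert by (intro closed) auto
  finally show ?case .
qed (simp add: closed)

text \<open>The orbit argument is repeated on ordered pairs with the function h. By transitivity
  every orbit contains a pair starting with r0, where h is a nonunit, so two orbits make the product
  of h over all pairs divisible by \<open>p ^ 2\<close>. Up to a unit, and modulo
  \<open>p ^ 2\<close>, that product is the product of all roots.\<close>

lemma two_transitive:
  assumes trans: "\<And>x y. x \<in> R \<Longrightarrow> y \<in> R \<Longrightarrow> \<exists>\<sigma>\<in>gal. \<sigma> x = y"
    and r0: "r0 \<in> R" "\<And>r. r \<in> R \<Longrightarrow> r \<noteq> r0 \<Longrightarrow> r \<in> nonunits" "r0 \<notin> nonunits"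
    and a: "of_int a \<notin> nonunits" "(r0 - of_int a) / of_nat p ^ 2 \<in> V"
    and val: "(\<Prod>r\<in>R. r) / of_nat p ^ 2 \<notin> V"
    and xy: "x \<in> R" "y \<in> R" "x' \<in> R" "y' \<in> R" "x \<noteq> y" "x' \<noteq> y'"
  shows "\<exists>\<sigma>\<in>gal. \<sigma> x = x' \<and> \<sigma> y = y'"
proof (rule ccontr)
  assume no: "\<not> ?thesis"
  \<comment> \<open>Plain \<open>x * y\<close> would be a nonunit for every pair. The summand
    \<open>x - a\<close> is tiny at r0 and congruent to the unit - a at all other roots, so h
    singles out the pairs starting with r0.\<close>
  define h where "h z = fst z * snd z + (fst z - of_int a)" for z :: "complex \<times> complex"
  define D where "D = (SIGMA x:R. R - {x})"
  define act where "act \<sigma> = map_prod \<sigma> \<sigma>" for \<sigma> :: "complex \<Rightarrow> complex"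
  have finD: "finite D" using finite_R by (simp add: D_def)
  define T where "T = (\<lambda>\<sigma>. act \<sigma> (x, y)) ` gal"
  have actD: "act \<sigma> t \<in> D" if "\<sigma> \<in> gal" "t \<in> D" for \<sigma> t
    using that gal_R gal_inj by (auto simp: D_def act_def)
  have T: "T \<subseteq> D" "(x, y) \<in> T" "(x', y') \<in> D - T"
  proof -
    have "(x, y) \<in> D" using xy by (simp add: D_def)
    then show "T \<subseteq> D" using actD unfolding T_def by blast
    show "(x, y) \<in> T" unfolding T_def by (rule image_eqI[OF _ gal_id]) (simp add: act_def)
    show "(x', y') \<in> D - T" using no xy by (auto simp: T_def act_def D_def)
  qed
  have inv: "act \<sigma> t \<in> T" if s: "\<sigma> \<in> gal" and t: "t \<in> T" for \<sigma> t
  proof -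
    obtain \<tau> where "\<tau> \<in> gal" "t = act \<tau> (x, y)" using t by (auto simp: T_def)
    then show ?thesis unfolding T_def by (intro image_eqI[OF _ gal_comp[OF s]]) (auto simp: act_def)
  qed
  have inv': "act \<sigma> t \<in> D - T" if s: "\<sigma> \<in> gal" and t: "t \<in> D - T" for \<sigma> t
  proof -
    have "t \<in> T" if "act \<sigma> t \<in> T"
    proof -
      have "act (inv' \<sigma>) (act \<sigma> t) \<in> T" using inv[OF gal_inv[OF s] that] .
      then show ?thesis using gal_bij[OF s] by (simp add: bij_is_inj inv_f_f act_def map_prod_def split_beta)
    qed
    then show ?thesis using t actD[OF s] by auto
  qed
  have r0V: "r0 - of_int a \<in> nonunits"
  proof -
    have "of_nat p * (of_nat p * ((r0 - of_int a) / of_nat p ^ 2)) \<in> nonunits"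
      by (intro mult_nonunit p_nonunit closed a)
    then show ?thesis using p_nonzero by (simp add: power2_eq_square)
  qed
  have hV: "h z \<in> V" if "z \<in> D" for z using that R_V by (auto simp: h_def D_def intro!: closed)
  have div: "prod h S / of_nat p \<in> V"
    if S: "S \<subseteq> D" "S \<noteq> {}" "\<And>\<sigma> t. \<sigma> \<in> gal \<Longrightarrow> t \<in> S \<Longrightarrow> act \<sigma> t \<in> S" for S
  proof (rule rational_nonunit)
    have fin: "finite S" using S(1) finD finite_subset by blast
    have SK: "fst t \<in> K" "snd t \<in> K" if "t \<in> S" for t
      using subsetD[OF S(1) that] R_K by (auto simp: D_def)
    have aK: "of_int a \<in> K" using subring_set_of_int[OF K_subring] .
    show "prod h S \<in> \<rat>"
    proof (rule invariant_prod_rational[OF fin, of _ act])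
      fix t assume t: "t \<in> S"
      show "h t \<in> K" unfolding h_def
        by (intro subring_set_add[OF K_subring] subring_set_mult[OF K_subring] subring_set_diff[OF K_subring] SK t aK)
      fix \<sigma> assume s: "\<sigma> \<in> gal"
      show "\<sigma> (h t) = h (act \<sigma> t)"
        using SK[OF t] aK subring_set_mult[OF K_subring] subring_set_diff[OF K_subring]
        by (simp add: h_def act_def gal_add[OF s] gal_mult[OF s] gal_diff[OF s] gal_of_int[OF s])
    next
      fix \<sigma> assume s: "\<sigma> \<in> gal"
      show "inj_on (act \<sigma>) S" using gal_inj[OF s] by (auto simp: inj_on_def act_def)
    qed (use S in auto)
    obtain t where t: "t \<in> S" using S(2) by blast
    then have "fst t \<in> R" using subsetD[OF S(1), of t] by (auto simp: D_def)
    then obtain \<sigma> where s: "\<sigma> \<in> gal" "\<sigma> (fst t) = r0" using trans r0(1) by blast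
    define z where "z = act \<sigma> t"
    have z: "z \<in> S" "fst z = r0" using S(3) s t by (auto simp: z_def act_def)
    then have "snd z \<in> R" "snd z \<noteq> r0" using subsetD[OF S(1), of z] by (auto simp: D_def)
    then have "snd z * r0 + (r0 - of_int a) \<in> nonunits"
      using r0 R_V by (intro add_nonunit mult_nonunit r0V) auto
    then have "h z \<in> nonunits" using z(2) by (simp add: h_def mult.commute)
    then show "prod h S \<in> nonunits"
      by (rule prod_nonunit[OF fin z(1)]) (use S hV in auto)
  qed
  have "prod h D = prod h T * prod h (D - T)"
    using prod.subset_diff[OF T(1) finD] by (simp add: mult.commute)
  then have "prod h D / of_nat p ^ 2 = prod h T / of_nat p * (prod h (D - T) / of_nat p)"
    by (simp add: power2_eq_square)
  also have "\<dots> \<in> V" by (intro closed div) (use T inv inv' in auto)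
  finally have 1: "prod h D / of_nat p ^ 2 \<in> V" .
  define e where "e = r0 - of_int a"
  define B where "B = (\<Prod>y\<in>R - {r0}. r0 * y + e)"
  define U where "U = (\<Prod>x\<in>R - {r0}. \<Prod>y\<in>R - {x}. h (x, y))"
  have "prod h D = (\<Prod>x\<in>R. \<Prod>y\<in>R - {x}. h (x, y))"
    unfolding D_def using finite_R by (subst prod.Sigma) auto
  also have "\<dots> = B * U" using finite_R r0(1) by (simp add: prod.remove[of R r0] B_def U_def h_def e_def)
  finally have hBU: "prod h D = B * U" .
  have unit: "h (x, y) \<notin> nonunits" if x: "x \<in> R - {r0}" and y: "y \<in> R - {x}" for x y
  proof
    assume "h (x, y) \<in> nonunits"
    moreover have xn: "x \<in> nonunits" using r0(2) x by auto
    moreover have "x * y + x \<in> nonunits" using xn y R_V by (intro add_nonunit mult_nonunit) auto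
    ultimately have "(x * y + x) - h (x, y) \<in> nonunits" by (intro diff_nonunit)
    then show False using a(1) by (simp add: h_def)
  qed
  have inU: "(\<Prod>y\<in>R - {x}. h (x, y)) \<in> V" if "x \<in> R" for x using hV that by (intro prod_closed) (auto simp: D_def)
  have "U \<notin> nonunits"
  proof
    assume "U \<in> nonunits"
    then obtain x where x: "x \<in> R - {r0}" "(\<Prod>y\<in>R - {x}. h (x, y)) \<in> nonunits"
      using nonunit_prod[of "R - {r0}" "\<lambda>x. \<Prod>y\<in>R - {x}. h (x, y)"] finite_R inU by (auto simp: U_def)
    then obtain y where "y \<in> R - {x}" "h (x, y) \<in> nonunits"
      using nonunit_prod[of "R - {x}" "\<lambda>y. h (x, y)"] finite_R hV by (auto simp: D_def)
    then show False using unit x by blast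
  qed
  moreover have "U \<in> V" unfolding U_def by (rule prod_closed) (use inU in auto)
  ultimately have "inverse U \<in> V" "U \<noteq> 0" using unit_inverse zero_nonunit by auto
  then have "prod h D / of_nat p ^ 2 * inverse U \<in> V" using 1 by (intro closed)
  moreover have "prod h D / of_nat p ^ 2 * inverse U = B / of_nat p ^ 2"
    using \<open>U \<noteq> 0\<close> by (simp add: hBU)
  ultimately have BV: "B / of_nat p ^ 2 \<in> V" by (simp only:)
  have r0_V: "r0 \<in> V" using r0 R_V by auto
  \<comment> \<open>The shift \<open>e = r0 - a\<close> is divisible by \<open>p ^ 2\<close>, so it
    may be dropped from each factor of B.\<close>
  have "((\<Prod>y\<in>R - {r0}. r0 * y) - B) / of_nat p ^ 2 \<in> V"
    unfolding B_def
    by (rule prod_perturb) (use finite_R R_V r0_V a(2) nonunits_subset[OF r0V] in \<open>auto simp: e_def intro!: closed\<close>)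
  then have "((\<Prod>y\<in>R - {r0}. r0 * y) - B) / of_nat p ^ 2 + B / of_nat p ^ 2 \<in> V" using BV by (rule add_closed)
  then have "(\<Prod>y\<in>R - {r0}. r0 * y) / of_nat p ^ 2 \<in> V" by (simp add: diff_divide_distrib)
  then have "r0 * (inverse r0 ^ card (R - {r0}) * ((\<Prod>y\<in>R - {r0}. r0 * y) / of_nat p ^ 2)) \<in> V"
    using r0 r0_V by (intro closed unit_inverse)
  moreover have "r0 * (inverse r0 ^ card (R - {r0}) * ((\<Prod>y\<in>R - {r0}. r0 * y) / of_nat p ^ 2)) =
      r0 * (\<Prod>y\<in>R - {r0}. y) / of_nat p ^ 2"
  proof -
    have "r0 \<noteq> 0" using r0(3) zero_nonunit by auto
    then have "inverse r0 ^ card (R - {r0}) * r0 ^ card (R - {r0}) = 1"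
      by (simp flip: power_mult_distrib)
    then show ?thesis by (simp add: prod.distrib del: power_inverse)
  qed
  ultimately have "r0 * (\<Prod>y\<in>R - {r0}. y) / of_nat p ^ 2 \<in> V" by (simp only:)
  then show False using val finite_R r0(1) by (simp add: prod.remove[of R r0])
qed

end

section \<open>From automorphisms to permutations of the roots\<close>

context splitting
begin

lemma gal_to_permutation:
  assumes "\<sigma> \<in> gal"
  shows "(\<lambda>z. if z \<in> R then \<sigma> z else z) \<in> carrier (galois_group F)"
  unfolding galois_group_carrier
proof (intro conjI bexI[OF _ assms])
  have "bij_betw (\<lambda>z. if z \<in> R then \<sigma> z else z) R R"
    using gal_bij_R[OF assms] by (rule bij_betw_cong[THEN iffD1, rotated]) simp
  then show "(\<lambda>z. if z \<in> R then \<sigma> z else z) permutes R"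
    by (rule bij_imp_permutes) simp
qed simp

lemma perm_group_galois: "perm_group (carrier (galois_group F)) R"
proof
  fix p assume p: "p \<in> carrier (galois_group F)"
  then show pR: "p permutes R" by (simp add: galois_group_carrier)
  obtain \<sigma> where s: "\<sigma> \<in> gal" "\<And>z. z \<in> R \<Longrightarrow> p z = \<sigma> z" using p by (auto simp: galois_group_carrier)
  show "inv' p \<in> carrier (galois_group F)"
    unfolding galois_group_carrier
  proof (intro conjI bexI[OF _ gal_inv[OF s(1)]] ballI)
    show "inv' p permutes R" using pR by (rule permutes_inv)
    fix z assume z: "z \<in> R"
    have y: "inv' p z \<in> R" using permutes_in_image[OF permutes_inv[OF pR]] z by simp
    have "\<sigma> (inv' p z) = z" using s(2)[OF y] permutes_inverses(1)[OF pR] by simp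
    then show "inv' p z = inv' \<sigma> z" using gal_bij[OF s(1)] by (metis bij_is_inj inv_f_f)
  qed
  fix q assume q: "q \<in> carrier (galois_group F)"
  then have qR: "q permutes R" by (simp add: galois_group_carrier)
  obtain \<tau> where t: "\<tau> \<in> gal" "\<And>z. z \<in> R \<Longrightarrow> q z = \<tau> z" using q by (auto simp: galois_group_carrier)
  show "p \<circ> q \<in> carrier (galois_group F)"
    unfolding galois_group_carrier
  proof (intro conjI bexI[OF _ gal_comp[OF s(1) t(1)]] ballI)
    show "p \<circ> q permutes R" using qR pR by (rule permutes_compose)
    fix z assume z: "z \<in> R"
    have "q z \<in> R" using permutes_in_image[OF qR] z by simp
    then show "(p \<circ> q) z = (\<sigma> \<circ> \<tau>) z" using s(2) t(2)[OF z] by simp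
  qed
qed

theorem galois_group_iso_alt:
  assumes card: "card R = n" "n \<ge> 3"
    and trans: "\<And>x y x' y'. x \<in> R \<Longrightarrow> y \<in> R \<Longrightarrow> x' \<in> R \<Longrightarrow> y' \<in> R \<Longrightarrow> x \<noteq> y \<Longrightarrow> x' \<noteq> y' \<Longrightarrow>
      \<exists>\<sigma>\<in>gal. \<sigma> x = x' \<and> \<sigma> y = y'"
    and small: "\<sigma> \<in> gal" "\<sigma> \<noteq> id" "S \<subseteq> R" "card S \<le> 3" "\<And>r. r \<in> R - S \<Longrightarrow> \<sigma> r = r"
    and no_swap: "\<And>\<sigma> x y. \<sigma> \<in> gal \<Longrightarrow> x \<in> R \<Longrightarrow> y \<in> R \<Longrightarrow> x \<noteq> y \<Longrightarrow> \<sigma> x = y \<Longrightarrow> \<sigma> y = x \<Longrightarrow>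
      (\<And>r. r \<in> R \<Longrightarrow> r \<noteq> x \<Longrightarrow> r \<noteq> y \<Longrightarrow> \<sigma> r = r) \<Longrightarrow> False"
  shows "galois_group F \<cong> alt_group n"
proof -
  interpret G: perm_group "carrier (galois_group F)" R by (rule perm_group_galois)
  let ?p = "\<lambda>\<sigma> z. if z \<in> R then \<sigma> z else z"
  have ns: "transpose a b \<notin> carrier (galois_group F)" if ab: "a \<in> R" "b \<in> R" "a \<noteq> b" for a b
  proof
    assume "transpose a b \<in> carrier (galois_group F)"
    then obtain \<tau> where t: "\<tau> \<in> gal" "\<And>z. z \<in> R \<Longrightarrow> transpose a b z = \<tau> z" by (auto simp: galois_group_carrier)
    show False
    proof (rule no_swap[OF t(1) ab])
      show "\<tau> a = b" "\<tau> b = a" using t(2)[of a] t(2)[of b] ab by auto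
      fix r assume "r \<in> R" "r \<noteq> a" "r \<noteq> b"
      then show "\<tau> r = r" using t(2)[of r] by simp
    qed
  qed
  have moves: "?p \<sigma> \<noteq> id"
  proof
    assume eq: "?p \<sigma> = id"
    have "\<sigma> r = id r" if "r \<in> R" for r using fun_cong[OF eq, of r] that by simp
    then show False using gal_ext[OF small(1) gal_id] small(2) by blast
  qed
  have fin: "finite S" using small(3) finite_R finite_subset by blast
  have out: "?p \<sigma> x = x" if "x \<notin> S" for x using small(5)[of x] that by simp
  have "\<exists>a b c. distinct [a, b, c] \<and> {a, b, c} \<subseteq> R \<and> three_cycle a b c \<in> carrier (galois_group F)"
    by (rule G.small_support_three_cycle[OF gal_to_permutation[OF small(1)] moves fin small(4) out ns])
  then obtain a b c where abc: "distinct [a, b, c]" "{a, b, c} \<subseteq> R" "three_cycle a b c \<in> carrier (galois_group F)"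
    by blast
  have trans': "\<exists>p\<in>carrier (galois_group F). p x = x' \<and> p y = y'"
    if xy: "x \<in> R" "y \<in> R" "x' \<in> R" "y' \<in> R" "x \<noteq> y" "x' \<noteq> y'" for x y x' y'
  proof -
    obtain \<tau> where t: "\<tau> \<in> gal" "\<tau> x = x'" "\<tau> y = y'" using trans[OF xy] by blast
    show ?thesis by (rule bexI[OF _ gal_to_permutation[OF t(1)]]) (use t xy in simp)
  qed
  have three: "three_cycle x y z \<in> carrier (galois_group F)" if "distinct [x, y, z]" "{x, y, z} \<subseteq> R" for x y z
    by (rule G.all_three_cycles[OF trans' abc(3,1,2) that])
  have "\<lparr>carrier = carrier (galois_group F), monoid.mult = (\<circ>), one = id\<rparr> \<cong> alt_group n"
    by (rule G.iso_alt_group[OF finite_R card three ns])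
  then show ?thesis by (simp add: galois_group_def)
qed

end

section \<open>The family of polynomials\<close>

lemma poly_pderiv_prod_roots:
  fixes A :: "'a::{comm_ring_1, semiring_no_zero_divisors} set"
  assumes "finite A" "r \<in> A"
  shows "poly (pderiv (\<Prod>s\<in>A. [:-s, 1:])) r = (\<Prod>s\<in>A - {r}. r - s)"
proof -
  have "(\<Prod>s\<in>A. [:-s, 1:]) = [:-r, 1:] * (\<Prod>s\<in>A - {r}. [:-s, 1:])"
    using assms by (simp add: prod.remove)
  then show ?thesis by (simp add: pderiv_mult pderiv_pCons poly_prod del: mult_pCons_left)
qed

definition family :: "nat \<Rightarrow> int \<Rightarrow> int poly" where
  "family n u = monom 1 n - monom (int n ^ 2) (n - 1) - smult u [:- ((int n - 2) ^ 2), 1:]"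

lemma coeff_family:
  "n \<ge> 3 \<Longrightarrow> i \<ge> n \<Longrightarrow> coeff (family n u) i = (if i = n then 1 else 0)"
  by (auto simp: family_def coeff_pCons split: nat.splits)

lemma degree_family: "n \<ge> 3 \<Longrightarrow> degree (family n u) = n"
  by (intro antisym degree_le le_degree) (auto simp: coeff_family)

lemma lead_coeff_family: "n \<ge> 3 \<Longrightarrow> lead_coeff (family n u) = 1"
  by (simp add: degree_family coeff_family)

text \<open>The third branch value, over which c lies, is
  \<open>- n ^ n * (n - 2) ^ (n - 2)\<close>. Since \<open>n - 1 = m ^ 2\<close>, the primes
  dividing n - 1 are those dividing m, and \<open>p ^ 2\<close> then divides n - 1; this brings one
  root within \<open>p ^ 2\<close> of a.\<close>

locale alt_family =
  fixes n m :: nat and u :: int and q p l :: nat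
  assumes n_mod: "n mod 8 = 2" and n_ge: "n \<ge> 10" and n_m: "n = m ^ 2 + 1"
    and prime_q: "prime q" and prime_p: "prime p" and prime_l: "prime l"
    and q: "q dvd n" "odd q" "int q dvd u" "\<not> int q ^ 2 dvd u"
    and p: "p dvd m" "int p dvd u" "\<not> int p ^ 2 dvd u"
    and l: "l > n" "int l dvd u + int n ^ n * (int n - 2) ^ (n - 2)"
      "\<not> int l ^ 2 dvd u + int n ^ n * (int n - 2) ^ (n - 2)"
begin

definition a :: int where "a = int n ^ 2"
definition b :: int where "b = (int n - 2) ^ 2"
definition c :: int where "c = int n * (int n - 2)"

definition F :: "rat poly" where "F = map_poly rat_of_int (family n u)"
definition g :: "complex poly" where "g = map_poly of_int (family n u)"

lemma map_F: "map_poly of_rat F = g"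
  by (rule poly_eqI) (simp add: F_def g_def coeff_map_poly)

lemma degree_g: "degree g = n"
  unfolding g_def using n_ge by (simp add: degree_map_poly degree_family)

lemma lead_g: "lead_coeff g = 1"
  using lead_coeff_family[of n u] n_ge unfolding degree_g by (simp add: g_def coeff_map_poly degree_family)

lemma g_eq: "g = monom 1 n - monom (of_int a) (n - 1) - smult (of_int u) [:- of_int b, 1:]"
  by (rule poly_eqI) (auto simp: g_def a_def b_def family_def coeff_map_poly coeff_pCons split: nat.splits)

lemma poly_g: "poly g x = x ^ n - of_int a * x ^ (n - 1) - of_int u * (x - of_int b)"
  by (simp add: g_eq poly_monom algebra_simps)

lemma poly_g': "poly (pderiv g) x =
    of_nat n * x ^ (n - 1) - of_int a * (of_nat n - 1) * x ^ (n - 2) - of_int u"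
proof -
  have "(of_nat (n - 1) :: complex) = of_nat n - 1" using n_ge by (simp add: of_nat_diff)
  moreover have "n - 1 - 1 = n - 2" by simp
  ultimately show ?thesis
    by (simp add: g_eq pderiv_diff pderiv_monom pderiv_smult pderiv_pCons poly_monom)
qed

lemma pow_n: "(x::'a::comm_ring_1) ^ n = x ^ 2 * x ^ (n - 2)" "x ^ (n - 1) = x * x ^ (n - 2)"
proof -
  have "n = 2 + (n - 2)" "n - 1 = Suc (n - 2)" using n_ge by auto
  then show "x ^ n = x ^ 2 * x ^ (n - 2)" "x ^ (n - 1) = x * x ^ (n - 2)"
    by (metis power_add, metis power_Suc)
qed

text \<open>The ramification of \<open>X ^ (n - 1) * (X - a) / (X - b)\<close>: apart from \<open>0\<close> and \<open>\<infinity>\<close> there is a single,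
  doubly ramified, critical point \<open>c\<close>.\<close>

lemma derivative_identity:
  "(x - of_int b) * poly (pderiv g) x = poly g x + (of_nat n - 1) * x ^ (n - 2) * (x - of_int c) ^ 2"
  unfolding poly_g poly_g' pow_n a_def b_def c_def by (simp add: power2_eq_square algebra_simps)

lemma poly_g_0: "poly g 0 = of_int (u * b)"
  using n_ge by (simp add: poly_g power_0_left)

lemma poly_g_b: "poly g (of_int b) = - of_int (4 * (int n - 1) * b ^ (n - 1))"
  unfolding poly_g pow_n a_def b_def by (simp add: power2_eq_square algebra_simps)

lemma poly_g_a: "poly g (of_int a) = - of_int (4 * u * int m ^ 2)"
proof -
  have "int n = int m ^ 2 + 1" using n_m by simp
  then have "a - b = 4 * int m ^ 2" by (simp add: a_def b_def power2_eq_square algebra_simps)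
  then have "(of_int (a - b) :: complex) = of_int (4 * int m ^ 2)" by simp
  moreover have "poly g (of_int a) = - (of_int u * of_int (a - b))"
    unfolding poly_g pow_n by (simp add: power2_eq_square algebra_simps)
  ultimately show ?thesis by simp
qed

definition d :: int where "d = u + int n ^ n * (int n - 2) ^ (n - 2)"

lemma poly_g_c: "poly g (of_int c) = - of_int (2 * (int n - 2) * d)"
proof -
  define y z where "y = (of_nat n ^ (n - 2) :: complex)" and "z = ((of_nat n - 2) ^ (n - 2) :: complex)"
  have c: "of_int c ^ (n - 2) = y * z" by (simp add: c_def y_def z_def power_mult_distrib)
  have d: "of_int d = of_int u + of_nat n ^ 2 * y * z" by (simp add: d_def pow_n y_def z_def)
  have "poly g (of_int c) = - (2 * (of_nat n - 2) * of_int d)"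
    unfolding poly_g pow_n c d by (simp add: a_def b_def c_def power2_eq_square algebra_simps)
  then show ?thesis by simp
qed

lemma l_dvd: "int l dvd d" "\<not> int l ^ 2 dvd d"
  using l by (auto simp: d_def)

lemma d_nonzero: "d \<noteq> 0" using l_dvd by auto
lemma u_nonzero: "u \<noteq> 0" using q by auto
lemma b_nonzero: "b \<noteq> 0" using n_ge by (simp add: b_def)
lemma n2_nonzero: "int n - 2 \<noteq> 0" using n_ge by simp

section \<open>Roots and discriminant of the family\<close>

sublocale splitting F
proof
  have "g \<noteq> 0" using degree_g n_ge by auto
  then show "F \<noteq> 0" using map_F by auto
qed

lemma R_eq: "R = {z. poly g z = 0}"
  by (simp add: complex_roots_def map_F)

text \<open>By \<open>derivative_identity\<close> a multiple root can only be 0 or c, and g vanishes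
  at neither.\<close>

lemma g_prod: "g = (\<Prod>z\<in>R. [:-z, 1:])"
proof -
  have "\<not> (poly g z = 0 \<and> poly (pderiv g) z = 0)" for z
  proof
    assume z: "poly g z = 0 \<and> poly (pderiv g) z = 0"
    then have "(of_nat n - 1) * z ^ (n - 2) * (z - of_int c) ^ 2 = 0"
      using derivative_identity[of z] by simp
    moreover have "(of_nat n :: complex) \<noteq> of_nat 1" using n_ge by (subst of_nat_eq_iff) simp
    ultimately have "z = 0 \<or> z = of_int c" by auto
    moreover have "poly g 0 \<noteq> 0" unfolding poly_g_0 of_int_eq_0_iff using u_nonzero b_nonzero by simp
    moreover have "poly g (of_int c) \<noteq> 0"
      unfolding poly_g_c neg_equal_0_iff_equal of_int_eq_0_iff using n2_nonzero d_nonzero by simp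
    ultimately show False using z by blast
  qed
  then have "rsquarefree g" by (auto simp: rsquarefree_roots)
  then have "smult (lead_coeff g) (\<Prod>z|poly g z = 0. [:-z, 1:]) = g"
    by (rule complex_poly_decompose_rsquarefree)
  then show ?thesis using lead_g by (simp add: R_eq)
qed

lemma poly_g_prod: "poly g x = (\<Prod>r\<in>R. x - r)"
  by (subst g_prod) (simp add: poly_prod)

lemma deriv_prod: "r \<in> R \<Longrightarrow> poly (pderiv g) r = (\<Prod>s\<in>R - {r}. r - s)"
  by (subst g_prod) (rule poly_pderiv_prod_roots[OF finite_R])

lemma card_R: "card R = n"
proof -
  have "degree g = (\<Sum>z\<in>R. degree [:-z, 1:])" by (subst g_prod) (intro degree_prod_eq_sum_degree, auto)
  then show ?thesis using degree_g by simp
qed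

lemma even_n: "even n" using n_mod by presburger

lemma prod_minus: "(\<Prod>r\<in>R. r - x) = poly g x"
proof -
  have "(\<Prod>r\<in>R. - (x - r)) = (-1) ^ card R * (\<Prod>r\<in>R. x - r)" by (rule prod_uminus)
  then show ?thesis using even_n card_R by (simp add: poly_g_prod)
qed

lemma prod_R: "(\<Prod>r\<in>R. r) = of_int (u * b)"
  using prod_minus[of 0] poly_g_0 by simp

lemma n1: "int n - 1 = int m ^ 2" using n_m by simp

text \<open>Multiplying \<open>derivative_identity\<close> over all roots gives
  \<open>poly g b\<close> times \<open>pair_prod R\<close> on the left. As n is even, the right side
  is a square, and \<open>- poly g b\<close> is one because \<open>n - 1 = m ^ 2\<close>.\<close>

lemma discriminant: "\<exists>w\<in>\<rat>. pair_prod R = - w\<^sup>2"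
proof -
  have nm: "of_nat n - 1 = (of_nat m ^ 2 :: complex)" using n_m by simp
  have "(\<Prod>r\<in>R. (r - of_int b) * poly (pderiv g) r) =
      (\<Prod>r\<in>R. (of_nat n - 1) * r ^ (n - 2) * (r - of_int c) ^ 2)"
    by (rule prod.cong) (auto simp: derivative_identity R_eq)
  moreover have "(\<Prod>r\<in>R. (r - of_int b) * poly (pderiv g) r) = poly g (of_int b) * pair_prod R"
    by (simp add: prod.distrib prod_minus pair_prod_def deriv_prod)
  moreover have "(\<Prod>r\<in>R. (of_nat n - 1) * r ^ (n - 2) * (r - of_int c) ^ 2) =
      (of_nat n - 1) ^ n * of_int (u * b) ^ (n - 2) * poly g (of_int c) ^ 2"
    using prod_minus[of "of_int c"] prod_R
    by (simp add: prod.distrib card_R prod_power_distrib[symmetric])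
  ultimately have eq: "poly g (of_int b) * pair_prod R =
      (of_nat n - 1) ^ n * of_int (u * b) ^ (n - 2) * poly g (of_int c) ^ 2" by simp
  define h where "h = (n - 2) div 2"
  have h: "n - 2 = 2 * h" using even_n by (auto simp: h_def)
  define e where "e = (of_int (int n - 2) :: complex)"
  have e0: "e \<noteq> 0" unfolding e_def of_int_eq_0_iff by (rule n2_nonzero)
  have m0: "(of_nat m :: complex) \<noteq> 0" using n_m n_ge by (intro notI) simp
  \<comment> \<open>The exponent n - 1 of m arises from \<open>(m ^ 2) ^ n\<close> after cancelling
    the factor \<open>m ^ 2\<close> of \<open>poly g b\<close>.\<close>
  define w where "w = of_nat m ^ (n - 1) * of_int (u * b) ^ h * poly g (of_int c) / (2 * e ^ (n - 1))"
  have gb: "poly g (of_int b) = - ((of_nat m ^ 2) * (2 * e ^ (n - 1)) ^ 2)"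
  proof -
    have "4 * (int n - 1) * b ^ (n - 1) = int m ^ 2 * (2 * (int n - 2) ^ (n - 1)) ^ 2"
      by (simp add: n1 b_def power_mult_distrib flip: power_mult) (simp add: mult.commute)
    then have "(of_int (4 * (int n - 1) * b ^ (n - 1)) :: complex) =
        of_int (int m ^ 2 * (2 * (int n - 2) ^ (n - 1)) ^ 2)" by (simp only:)
    then show ?thesis unfolding poly_g_b by (simp add: e_def)
  qed
  have "(of_nat m ^ 2) ^ n = (of_nat m ^ 2 :: complex) * (of_nat m ^ (n - 1)) ^ 2"
  proof -
    have "2 * n = 2 + (n - 1) * 2" using n_ge by simp
    then show ?thesis by (metis power_add power_mult)
  qed
  moreover define y where "y = of_nat m ^ (n - 1) * of_int (u * b) ^ h * poly g (of_int c)"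
  moreover define z where "z = 2 * e ^ (n - 1)"
  ultimately have "of_nat m ^ 2 * (- (z ^ 2 * pair_prod R)) = of_nat m ^ 2 * y ^ 2"
    using eq unfolding nm gb by (simp add: h power_mult power_mult_distrib mult_ac)
  then have yz: "y ^ 2 = - (z ^ 2 * pair_prod R)" using m0 by (subst (asm) mult_left_cancel) auto
  have "z \<noteq> 0" using e0 by (simp add: z_def)
  moreover have "w = y / z" by (simp add: w_def y_def z_def)
  ultimately have "pair_prod R = - w\<^sup>2" by (simp add: power_divide yz)
  moreover have "w \<in> \<rat>" unfolding w_def e_def poly_g_c
    by (intro Rats_divide Rats_mult Rats_power Rats_minus_iff[THEN iffD2] Rats_of_int Rats_of_nat) auto
  ultimately show ?thesis by blast
qed

lemma no_swap:
  assumes "\<sigma> \<in> gal" "x \<in> R" "y \<in> R" "x \<noteq> y" "\<sigma> x = y" "\<sigma> y = x"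
    "\<And>r. r \<in> R \<Longrightarrow> r \<noteq> x \<Longrightarrow> r \<noteq> y \<Longrightarrow> \<sigma> r = r"
  shows False
proof -
  obtain w where w: "w \<in> \<rat>" "pair_prod R = - w\<^sup>2" using discriminant by blast
  have "card R mod 8 = 2" using card_R n_mod by simp
  from no_transposition[OF w(2,1) this assms] show ?thesis .
qed

section \<open>The local conditions at q, p and l\<close>

lemma splitting_valuationI:
  assumes "valuation_ring_above V k" shows "splitting_valuation F V k"
proof -
  interpret valuation_ring_above V k by (rule assms)
  show ?thesis
  proof
    show "R \<subseteq> V"
    proof
      fix r assume "r \<in> R"
      then have "poly g r = 0" by (simp add: R_eq)
      moreover have "coeff g i \<in> V" for i unfolding g_def by (simp add: coeff_map_poly of_int_closed)
      ultimately show "r \<in> V" using monic_root_closed[of g r] lead_g by blast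
    qed
  qed
qed

lemma square_dvd:
  assumes "prime k" "\<not> int k dvd x" "int k ^ 2 dvd y * x" shows "int k ^ 2 dvd y"
proof -
  have "coprime (int k) x" using assms by (simp add: prime_imp_coprime)
  then have "coprime (int k ^ 2) x" by simp
  then show ?thesis using assms(3) by (simp add: coprime_dvd_mult_left_iff)
qed

lemma prime_dvd_int_power: "prime k \<Longrightarrow> int k dvd x ^ j \<Longrightarrow> int k dvd x"
  using prime_dvd_power[of "int k"] by simp

lemma gal_transitive:
  assumes "x \<in> R" "y \<in> R" shows "\<exists>\<sigma>\<in>gal. \<sigma> x = y"
proof -
  obtain V :: "complex set" where V: "valuation_ring_above V q"
    using exists_valuation_ring_above[OF prime_q] by blast
  interpret splitting_valuation F V q by (rule splitting_valuationI[OF V])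
  \<comment> \<open>Here q odd matters: q divides n but not 2, so not n - 2, and hence q divides the
    product \<open>u * b\<close> of the roots exactly once.\<close>
  have qb: "\<not> int q dvd b"
  proof
    assume "int q dvd b"
    then have "int q dvd int n - 2" unfolding b_def using prime_dvd_int_power prime_q by blast
    moreover have "int q dvd int n" using q(1) by simp
    ultimately have "int q dvd int n - (int n - 2)" by (rule dvd_diff[rotated])
    then have "q dvd 2" by (simp add: int_dvd_int_iff[of q 2, simplified])
    then show False using q(2) prime_q by (metis primes_dvd_imp_eq two_is_prime_nat even_numeral)
  qed
  have "int q dvd a" unfolding a_def using q(1) by (simp add: dvd_power_iff_le dvd_trans[OF _ dvd_power])
  then have "(of_int a :: complex) \<in> nonunits" "(of_int u :: complex) \<in> nonunits"
    using q by (simp_all add: of_int_nonunit)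
  then have "r \<in> nonunits" if r: "r \<in> R" for r
  proof -
    have rV: "r \<in> V" using r R_V by auto
    have "r ^ n = of_int a * r ^ (n - 1) + of_int u * (r - of_int b)"
      using r by (simp add: R_eq poly_g algebra_simps)
    moreover have "of_int a * r ^ (n - 1) + of_int u * (r - of_int b) \<in> nonunits"
      using \<open>of_int a \<in> nonunits\<close> \<open>of_int u \<in> nonunits\<close> by (intro add_nonunit mult_nonunit closed rV)
    ultimately show ?thesis using nonunit_power rV by metis
  qed
  moreover have "(\<Prod>r\<in>R. r) / of_nat q ^ 2 \<notin> V"
  proof
    assume "(\<Prod>r\<in>R. r) / of_nat q ^ 2 \<in> V"
    then have "int q ^ 2 dvd u * b" using of_int_divide_p_power unfolding prod_R by blast
    then show False using square_dvd[OF prime_q qb] q(4) by blast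
  qed
  ultimately show ?thesis using transitive assms by blast
qed

text \<open>Modulo p the polynomial is \<open>X ^ (n - 1) * (X - a)\<close>, and n is 1 modulo p, so
  a and b are units. Exactly one root r0 lies near a, and the others lie near 0.\<close>

lemma gal_two_transitive:
  assumes "x \<in> R" "y \<in> R" "x' \<in> R" "y' \<in> R" "x \<noteq> y" "x' \<noteq> y'"
  shows "\<exists>\<sigma>\<in>gal. \<sigma> x = x' \<and> \<sigma> y = y'"
proof -
  obtain V :: "complex set" where V: "valuation_ring_above V p"
    using exists_valuation_ring_above[OF prime_p] by blast
  interpret splitting_valuation F V p by (rule splitting_valuationI[OF V])
  have pn1: "int p dvd int n - 1" unfolding n1 using p(1) by (simp add: power2_eq_square)
  have not1: "\<not> int p dvd 1" using prime_gt_1_nat[OF prime_p] by simp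
  have pn: "\<not> int p dvd int n"
  proof
    assume "int p dvd int n"
    then have "int p dvd int n - (int n - 1)" using pn1 by (rule dvd_diff)
    then show False using not1 by simp
  qed
  have pn2: "\<not> int p dvd int n - 2"
  proof
    assume "int p dvd int n - 2"
    with pn1 have "int p dvd (int n - 1) - (int n - 2)" by (rule dvd_diff)
    then show False using not1 by simp
  qed
  have pa: "\<not> int p dvd a" and pb: "\<not> int p dvd b"
    unfolding a_def b_def using prime_dvd_int_power[OF prime_p] pn pn2 by blast+
  have an: "(of_int a :: complex) \<notin> nonunits" using pa by (simp add: of_int_nonunit)
  have un: "(of_int u :: complex) \<in> nonunits" using p by (simp add: of_int_nonunit)
  have nn: "(of_nat n :: complex) \<notin> nonunits" using pn of_int_nonunit[of "int n"] by simp
  have n1n: "(of_nat n - 1 :: complex) \<in> nonunits" using pn1 of_int_nonunit[of "int n - 1"] by simp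
  have RV: "r \<in> V" if "r \<in> R" for r using that R_V by auto
  have dich: "r \<in> nonunits \<or> r - of_int a \<in> nonunits" if r: "r \<in> R" for r
  proof -
    have "r ^ (n - 1) * (r - of_int a) = of_int u * (r - of_int b)"
    proof -
      have "poly g r = 0" using r by (simp add: R_eq)
      then show ?thesis unfolding poly_g pow_n by (simp add: power2_eq_square algebra_simps)
    qed
    moreover have "of_int u * (r - of_int b) \<in> nonunits" by (intro mult_nonunit un closed RV r)
    ultimately have "r ^ (n - 1) * (r - of_int a) \<in> nonunits" by simp
    then have "r ^ (n - 1) \<in> nonunits \<or> r - of_int a \<in> nonunits"
      by (rule nonunit_prime) (intro closed RV r)+
    then show ?thesis using nonunit_power RV[OF r] by blast
  qed
  have ga: "(\<Prod>r\<in>R. r - of_int a) = - of_int (4 * u * int m ^ 2)" using prod_minus poly_g_a by simp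
  have "(of_int (4 * u * int m ^ 2) :: complex) \<in> nonunits" using p by (simp only: of_int_nonunit) simp
  then have prod_nonunit_a: "(\<Prod>r\<in>R. r - of_int a) \<in> nonunits" unfolding ga by (rule uminus_nonunit)
  have raV: "r - of_int a \<in> V" if "r \<in> R" for r by (intro closed RV that)
  obtain r0 where r0: "r0 \<in> R" "r0 - of_int a \<in> nonunits"
    using nonunit_prod[OF finite_R prod_nonunit_a raV] by blast
  have r0n: "r0 \<notin> nonunits"
  proof
    assume "r0 \<in> nonunits"
    then have "r0 - (r0 - of_int a) \<in> nonunits" using r0(2) by (rule diff_nonunit)
    then show False using an by simp
  qed
  \<comment> \<open>A second root near a would make the derivative at r0 a nonunit. Modulo p only
    its term \<open>n * r0 ^ (n - 1)\<close> survives, which is a unit.\<close>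
  have others: "r \<in> nonunits" if r: "r \<in> R" "r \<noteq> r0" for r
  proof (rule ccontr)
    assume "r \<notin> nonunits"
    then have "r - of_int a \<in> nonunits" using dich r by blast
    with r0(2) have "(r0 - of_int a) - (r - of_int a) \<in> nonunits" by (rule diff_nonunit)
    then have "r0 - r \<in> nonunits" by simp
    then have "(\<Prod>s\<in>R - {r0}. r0 - s) \<in> nonunits"
      by (intro prod_nonunit[of _ r]) (use r finite_R RV r0 in \<open>auto intro: closed\<close>)
    then have 1: "poly (pderiv g) r0 \<in> nonunits" using deriv_prod[OF r0(1)] by simp
    have "(of_nat n - 1) * (of_int a * r0 ^ (n - 2)) + of_int u \<in> nonunits"
      by (intro add_nonunit mult_nonunit n1n un closed RV r0)
    with 1 have "poly (pderiv g) r0 + ((of_nat n - 1) * (of_int a * r0 ^ (n - 2)) + of_int u) \<in> nonunits"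
      by (rule add_nonunit)
    then have "of_nat n * r0 ^ (n - 1) \<in> nonunits" by (simp add: poly_g' algebra_simps)
    then have "of_nat n \<in> nonunits \<or> r0 ^ (n - 1) \<in> nonunits"
      by (rule nonunit_prime) (intro closed RV r0)+
    then show False using nn nonunit_power[OF _ RV[OF r0(1)]] r0n by blast
  qed
  \<comment> \<open>The product of all r - a is \<open>- 4 * u * m ^ 2\<close>, and every factor
    other than r0 - a is a unit, so r0 - a absorbs the \<open>p ^ 2\<close> contained in
    \<open>m ^ 2\<close>.\<close>
  have r0a: "(r0 - of_int a) / of_nat p ^ 2 \<in> V"
  proof -
    define B where "B = (\<Prod>r\<in>R - {r0}. r - of_int a)"
    have eq: "(r0 - of_int a) * B = - of_int (4 * u * int m ^ 2)"
      using ga finite_R r0(1) by (simp add: prod.remove[of R r0] B_def)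
    have "B \<notin> nonunits"
    proof
      assume "B \<in> nonunits"
      then obtain r where r: "r \<in> R - {r0}" "r - of_int a \<in> nonunits"
        using nonunit_prod[of "R - {r0}" "\<lambda>r. r - of_int a"] finite_R raV unfolding B_def by blast
      then have "r \<in> nonunits" using others by blast
      then have "r - (r - of_int a) \<in> nonunits" using r(2) by (rule diff_nonunit)
      then show False using an by simp
    qed
    moreover have "B \<in> V" unfolding B_def by (intro closed RV) auto
    ultimately have iB: "inverse B \<in> V" "B \<noteq> 0" using unit_inverse zero_nonunit by auto
    obtain m' where m': "m = p * m'" using p(1) by blast
    have "- of_int (4 * u * int m' ^ 2) * inverse B \<in> V" by (intro closed iB)
    moreover have "(r0 - of_int a) / of_nat p ^ 2 = - of_int (4 * u * int m' ^ 2) * inverse B"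
    proof -
      have "(r0 - of_int a) * B = of_nat p ^ 2 * - of_int (4 * u * int m' ^ 2)"
        unfolding eq m' by (simp add: power_mult_distrib)
      then have "r0 - of_int a = of_nat p ^ 2 * - of_int (4 * u * int m' ^ 2) * inverse B"
        using iB(2) by (simp add: field_simps)
      then show ?thesis using p_nonzero by simp
    qed
    ultimately show ?thesis by (simp only:)
  qed
  have val: "(\<Prod>r\<in>R. r) / of_nat p ^ 2 \<notin> V"
  proof
    assume "(\<Prod>r\<in>R. r) / of_nat p ^ 2 \<in> V"
    then have "int p ^ 2 dvd u * b" using of_int_divide_p_power unfolding prod_R by blast
    then show False using square_dvd[OF prime_p pb] p(3) by blast
  qed
  show ?thesis
    by (rule two_transitive[OF gal_transitive r0(1) others r0n an r0a val assms])
qed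

text \<open>Inertia at l moves a root only to one congruent to it, and such roots all lie in the set
  S of roots near c. At a root r, \<open>(r - b) * g'(r)\<close> is a unit times
  \<open>(r - c) ^ 2\<close>. For r in S with r - c of least valuation, r - c divides every r - s
  with s in S, so there are at most two such s besides r.\<close>

lemma exists_small_support:
  "\<exists>\<sigma>\<in>gal. \<exists>S. \<sigma> \<noteq> id \<and> S \<subseteq> R \<and> card S \<le> 3 \<and> (\<forall>r\<in>R - S. \<sigma> r = r)"
proof -
  obtain V :: "complex set" where V: "valuation_ring_above V l"
    using exists_valuation_ring_above[OF prime_l] by blast
  interpret splitting_valuation F V l by (rule splitting_valuationI[OF V])
  have small: "\<not> int l dvd k" if "0 < k" "k \<le> int n" for k
    using that l(1) by (intro zdvd_not_zless) auto
  have ln: "\<not> int l dvd int n" "\<not> int l dvd int n - 1" "\<not> int l dvd int n - 2" "\<not> int l dvd 2"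
    using small[of "int n"] small[of "int n - 1"] small[of "int n - 2"] small[of 2] n_ge by linarith+
  have lp: "prime (int l)" using prime_l by simp
  have lb: "\<not> int l dvd b" unfolding b_def using prime_dvd_int_power[OF prime_l] ln by blast
  have lu: "\<not> int l dvd u"
  proof
    assume "int l dvd u"
    then have "int l dvd int n ^ n * (int n - 2) ^ (n - 2)" using l(2) by (simp add: dvd_add_right_iff)
    then have "int l dvd int n ^ n \<or> int l dvd (int n - 2) ^ (n - 2)" using lp by (simp add: prime_dvd_mult_iff)
    then show False using prime_dvd_int_power[OF prime_l] ln by blast
  qed
  have lub: "\<not> int l dvd u * b" using lp lb lu by (simp add: prime_dvd_mult_iff)
  have l2: "\<not> int l dvd 2 * (int n - 2)" unfolding prime_dvd_mult_iff[OF lp] using ln by blast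
  have RV: "r \<in> V" if "r \<in> R" for r using that R_V by auto
  have Ru: "r \<notin> nonunits" if r: "r \<in> R" for r
  proof
    assume "r \<in> nonunits"
    then have "(\<Prod>r\<in>R. r) \<in> nonunits" using r finite_R RV by (intro prod_nonunit) auto
    then show False using lub unfolding prod_R of_int_nonunit by simp
  qed
  have n1u: "(of_nat n - 1 :: complex) \<notin> nonunits" "(of_nat n - 1 :: complex) \<in> V"
    using ln(2) of_int_nonunit[of "int n - 1"] of_int_closed[of "int n - 1"] by simp_all
  define S where "S = {r \<in> R. r - of_int c \<in> nonunits}"
  have S: "S \<subseteq> R" "finite S" using finite_R by (auto simp: S_def)
  have cV: "r - of_int c \<in> V" if "r \<in> R" for r by (intro closed RV that)
  have cV': "of_int c - r \<in> V" if "r \<in> R" for r by (intro closed RV that)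
  have key: "(r - of_int b) * poly (pderiv g) r = (of_nat n - 1) * r ^ (n - 2) * (r - of_int c) ^ 2"
    if "r \<in> R" for r using derivative_identity[of r] that by (simp add: R_eq)
  have derivV: "poly (pderiv g) r \<in> V" if "r \<in> R" for r
    unfolding deriv_prod[OF that] by (intro closed RV that) auto
  have unit1: "(of_nat n - 1) * r ^ (n - 2) \<notin> nonunits" if r: "r \<in> R" for r
    using nonunit_prime[of "of_nat n - 1" "r ^ (n - 2)"] n1u Ru[OF r] nonunit_power[OF _ RV[OF r]]
      power_closed[OF RV[OF r]] by blast
  have gc: "(\<Prod>r\<in>R. of_int c - r) = of_int (- (2 * (int n - 2) * d))"
    using poly_g_c poly_g_prod[of "of_int c"] by simp
  \<comment> \<open>If r and s agree modulo l, the derivative at r is a nonunit, and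
    \<open>key\<close> forces r, hence also s, to agree with c.\<close>
  have separated: "s \<in> S" if rs: "r \<in> R" "s \<in> R" "r \<noteq> s" "r - s \<in> nonunits" for r s
  proof -
    have "(\<Prod>t\<in>R - {r}. r - t) \<in> nonunits"
      by (rule prod_nonunit[of _ s]) (use rs finite_R RV in \<open>auto intro: closed\<close>)
    then have "poly (pderiv g) r * (r - of_int b) \<in> nonunits"
      unfolding deriv_prod[OF rs(1)] by (intro mult_nonunit closed RV rs)
    then have "(of_nat n - 1) * r ^ (n - 2) * (r - of_int c) ^ 2 \<in> nonunits"
      using key[OF rs(1)] by (simp add: mult.commute)
    then have "(r - of_int c) ^ 2 \<in> nonunits"
      using nonunit_prime unit1[OF rs(1)] n1u(2) RV[OF rs(1)] cV[OF rs(1)] by (metis mult_closed power_closed)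
    then have "r - of_int c \<in> nonunits" using nonunit_power cV[OF rs(1)] by blast
    then have "(r - of_int c) - (r - s) \<in> nonunits" using rs(4) by (rule diff_nonunit)
    then show ?thesis using rs(2) by (simp add: S_def)
  qed
  have rb: "r - of_int b \<notin> nonunits" if r: "r \<in> S" for r
  proof
    assume "r - of_int b \<in> nonunits"
    moreover have "r - of_int c \<in> nonunits" using r by (simp add: S_def)
    ultimately have "(r - of_int b) - (r - of_int c) \<in> nonunits" by (rule diff_nonunit)
    then have "of_int (c - b) \<in> nonunits" by simp
    moreover have "c - b = 2 * (int n - 2)" by (simp add: c_def b_def power2_eq_square algebra_simps)
    ultimately show False using l2 unfolding of_int_nonunit by simp
  qed
  have "int l dvd - (2 * (int n - 2) * d)" using l_dvd(1) by simp
  then have "(\<Prod>r\<in>R. of_int c - r) \<in> nonunits" unfolding gc of_int_nonunit .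
  then obtain r1 where r1: "r1 \<in> R" "of_int c - r1 \<in> nonunits"
    using nonunit_prod[OF finite_R, of "\<lambda>r. of_int c - r"] cV' by blast
  then have r1S: "r1 \<in> S" using uminus_nonunit[OF r1(2)] by (simp add: S_def)
  \<comment> \<open>Since r1 is near c and r1 - b is a unit, \<open>key\<close> makes the derivative
    at r1 a nonunit, so another root coalesces with r1.\<close>
  have "\<exists>r2\<in>R. r2 \<noteq> r1 \<and> r1 - r2 \<in> nonunits"
  proof (rule ccontr)
    assume no: "\<not> ?thesis"
    have "r1 - s \<in> V" if "s \<in> R" for s by (intro closed RV r1 that)
    then have "poly (pderiv g) r1 \<notin> nonunits"
      unfolding deriv_prod[OF r1(1)] using no nonunit_prod[of "R - {r1}" "\<lambda>s. r1 - s"] finite_R by blast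
    moreover have "r1 - of_int b \<in> V" by (intro closed RV r1)
    ultimately have "(r1 - of_int b) * poly (pderiv g) r1 \<notin> nonunits"
      using nonunit_prime[of "r1 - of_int b" "poly (pderiv g) r1"] rb[OF r1S] derivV[OF r1(1)] by blast
    moreover have "(r1 - of_int c) * ((r1 - of_int c) * ((of_nat n - 1) * r1 ^ (n - 2))) \<in> nonunits"
      using r1S by (intro mult_nonunit closed cV RV r1 n1u) (simp add: S_def)
    ultimately show False unfolding key[OF r1(1)] by (simp add: power2_eq_square mult_ac)
  qed
  then obtain r2 where r2: "r2 \<in> R" "r2 \<noteq> r1" "r1 - r2 \<in> nonunits" by blast
  have r2c: "of_int c - r2 \<in> nonunits" using add_nonunit[OF r1(2) r2(3)] by simp
  have val: "(\<Prod>r\<in>R. of_int c - r) / of_nat l ^ 2 \<notin> V"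
  proof
    assume "(\<Prod>r\<in>R. of_int c - r) / of_nat l ^ 2 \<in> V"
    then have "int l ^ 2 dvd - (2 * (int n - 2) * d)" unfolding gc by (rule of_int_divide_p_power)
    then have "int l ^ 2 dvd d * (2 * (int n - 2))" by (simp add: mult.commute)
    then show False using square_dvd[OF prime_l l2] l_dvd(2) by blast
  qed
  obtain \<sigma> where \<sigma>: "\<sigma> \<in> gal" "\<sigma> \<noteq> id" "\<And>y. y \<in> A \<Longrightarrow> \<sigma> y - y \<in> nonunits"
    using exists_inertia[OF r1(1) r2(1) r2(2)[symmetric] r1(2) r2c val] by blast
  have fixed: "\<sigma> r = r" if r: "r \<in> R - S" for r
  proof (rule ccontr)
    assume "\<sigma> r \<noteq> r"
    moreover have "\<sigma> r - r \<in> nonunits" using \<sigma>(3) R_A r by blast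
    ultimately have "r \<in> S" using separated[of "\<sigma> r" r] gal_R[OF \<sigma>(1)] r by blast
    then show False using r by simp
  qed
  have nz: "r - of_int c \<noteq> 0" if "r \<in> R" for r
  proof
    assume "r - of_int c = 0"
    then have "poly g (of_int c) = 0" using that by (simp add: R_eq)
    then show False unfolding poly_g_c neg_equal_0_iff_equal of_int_eq_0_iff
      using n2_nonzero d_nonzero by simp
  qed
  \<comment> \<open>Divisibility in V is a total preorder, so a finite set of roots has a member
    whose distance to c divides all the others.\<close>
  have min: "\<exists>r\<in>T. \<forall>s\<in>T. (s - of_int c) / (r - of_int c) \<in> V" if "finite T" "T \<noteq> {}" "T \<subseteq> R" for T
    using that
  proof (induction T rule: finite_ne_induct)
    case (singleton r)
    then show ?case using nz[of r] by (simp add: closed)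
  next
    case (insert r T)
    then obtain t where t: "t \<in> T" "\<And>s. s \<in> T \<Longrightarrow> (s - of_int c) / (t - of_int c) \<in> V" by auto
    have nz': "r - of_int c \<noteq> 0" "t - of_int c \<noteq> 0" using nz insert.prems t(1) by auto
    from dvd_total[OF nz'] show ?case
    proof
      assume "(r - of_int c) / (t - of_int c) \<in> V"
      then show ?case using t by (intro bexI[of _ t]) auto
    next
      assume rt: "(t - of_int c) / (r - of_int c) \<in> V"
      have "(s - of_int c) / (r - of_int c) \<in> V" if "s \<in> T" for s
        using mult_closed[OF t(2)[OF that] rt] nz' by simp
      then show ?case using nz' by (intro bexI[of _ r]) (auto simp: closed)
    qed
  qed
  obtain r where r: "r \<in> S" "\<And>s. s \<in> S \<Longrightarrow> (s - of_int c) / (r - of_int c) \<in> V"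
    using min[OF S(2) _ S(1)] r1S by auto
  define \<delta> where "\<delta> = r - of_int c"
  have rR: "r \<in> R" using r S by auto
  have \<delta>: "\<delta> \<in> nonunits" "\<delta> \<noteq> 0" using r nz[OF rR] by (auto simp: S_def \<delta>_def)
  have "card S \<le> 3"
  proof (rule ccontr)
    assume "\<not> card S \<le> 3"
    \<comment> \<open>The j + 3 differences r - s supply \<open>\<delta> ^ (j + 3)\<close>, against
      \<open>\<delta> ^ 2\<close> on the right of \<open>key\<close>; the excess
      \<open>\<delta> ^ Suc j\<close> would divide a unit.\<close>
    define j where "j = card S - 4"
    have j: "card S = j + 4" using \<open>\<not> card S \<le> 3\<close> by (simp add: j_def)
    then have cS: "card (S - {r}) = j + 3" using r(1) S(2) by simp
    have "(\<Prod>s\<in>S - {r}. (r - s) / \<delta>) \<in> V"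
    proof (rule prod_closed)
      fix s assume "s \<in> S - {r}"
      then have "1 - (s - of_int c) / \<delta> \<in> V" using r(2) unfolding \<delta>_def by (intro closed) auto
      moreover have "1 - (s - of_int c) / \<delta> = (r - s) / \<delta>" using \<delta>(2) by (simp add: field_simps \<delta>_def)
      ultimately show "(r - s) / \<delta> \<in> V" by simp
    qed
    moreover have "(\<Prod>s\<in>R - S. r - s) \<in> V" using RV rR by (intro closed) auto
    ultimately have 1: "(\<Prod>s\<in>S - {r}. (r - s) / \<delta>) * (\<Prod>s\<in>R - S. r - s) * (r - of_int b) \<in> V"
      using diff_closed[OF RV[OF rR] of_int_closed] by (intro mult_closed)
    have "R - {r} = (S - {r}) \<union> (R - S)" using S(1) r(1) by auto
    then have "poly (pderiv g) r = (\<Prod>s\<in>S - {r}. r - s) * (\<Prod>s\<in>R - S. r - s)"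
      unfolding deriv_prod[OF rR] using S(2) finite_R by (subst prod.union_disjoint[symmetric]) auto
    then have "(\<Prod>s\<in>S - {r}. (r - s) / \<delta>) * (\<Prod>s\<in>R - S. r - s) * (r - of_int b)
        = (r - of_int b) * poly (pderiv g) r / \<delta> ^ (j + 3)"
      by (simp add: prod_dividef cS)
    also have "\<dots> = (of_nat n - 1) * r ^ (n - 2) * \<delta> ^ 2 / \<delta> ^ (j + 3)"
      unfolding key[OF rR] by (simp add: \<delta>_def)
    also have "\<dots> = (of_nat n - 1) * r ^ (n - 2) * inverse (\<delta> ^ Suc j)"
      using \<delta>(2) by (simp add: power_add field_simps power2_eq_square power3_eq_cube)
    finally have "(of_nat n - 1) * r ^ (n - 2) * inverse (\<delta> ^ Suc j) \<in> V" using 1 by simp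
    then have "\<delta> ^ Suc j * ((of_nat n - 1) * r ^ (n - 2) * inverse (\<delta> ^ Suc j)) \<in> nonunits"
      using \<delta>(1) nonunits_subset[OF \<delta>(1)] by (intro mult_nonunit) (simp_all add: mult_nonunit power_closed)
    then have "(of_nat n - 1) * r ^ (n - 2) \<in> nonunits" using \<delta>(2) by (simp add: field_simps)
    then show False using unit1[OF rR] by blast
  qed
  then show ?thesis using \<sigma> S(1) fixed by blast
qed

theorem galois_group_F: "galois_group F \<cong> alt_group n"
proof -
  obtain \<sigma> S where s: "\<sigma> \<in> gal" "\<sigma> \<noteq> id" "S \<subseteq> R" "card S \<le> 3" "\<And>r. r \<in> R - S \<Longrightarrow> \<sigma> r = r"
    using exists_small_support by blast
  have "n \<ge> 3" using n_ge by simp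
  then show ?thesis by (rule galois_group_iso_alt[OF card_R _ gal_two_transitive s no_swap])
qed

end

section \<open>The case n = 2 and the choice of parameters\<close>

lemma galois_group_two: "galois_group (map_poly rat_of_int [:0, - t, 1:]) \<cong> alt_group 2"
proof -
  define F where "F = map_poly rat_of_int [:0, - t, 1:]"
  have F: "F = [:0, - rat_of_int t, 1:]" by (simp add: F_def map_poly_pCons)
  interpret splitting F by unfold_locales (simp add: F)
  \<comment> \<open>The roots 0 and t are rational (and equal for t = 0), so the group is trivial,
    as is \<open>alt_group 2\<close>.\<close>
  have "z \<in> \<rat>" if "z \<in> R" for z
  proof -
    have "z * (z - of_int t) = 0" using that
      by (simp add: complex_roots_def F map_poly_pCons of_rat_minus algebra_simps)
    then have "z = 0 \<or> z = of_int t" by auto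
    then show ?thesis by auto
  qed
  then have "p = id" if "p \<in> carrier (galois_group F)" for p
    using that gal_rat unfolding galois_group_carrier by (metis eq_id_iff permutes_not_in)
  moreover have "id \<in> carrier (galois_group F)"
    unfolding galois_group_carrier using gal_id permutes_id by (metis id_apply)
  ultimately have 1: "carrier (galois_group F) = {id}" by blast
  have "card (carrier (alt_group 2)) = 1" using alt_group_card_carrier[of 2] by (simp add: fact_numeral)
  moreover have "id \<in> carrier (alt_group 2)" by (simp add: alt_group_carrier permutes_id evenperm_id)
  ultimately have 2: "carrier (alt_group 2) = {id}" by (metis card_1_singletonE singletonD)
  have "(\<lambda>_. id) \<in> iso (galois_group F) (alt_group 2)"
    by (rule isoI) (auto simp: hom_def 1 2 bij_betw_def alt_group_mult)
  then show ?thesis unfolding F_def is_iso_def by blast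
qed

lemma cong_prime_square:
  fixes u :: int
  assumes "prime k" "[u = int k] (mod int k ^ 2)"
  shows "int k dvd u" "\<not> int k ^ 2 dvd u"
proof -
  obtain j where "u - int k = int k ^ 2 * j"
    using assms(2) by (auto simp: cong_iff_dvd_diff dvd_def)
  then have j: "u = int k + int k ^ 2 * j" by (simp add: algebra_simps)
  then show "int k dvd u" by (simp add: power2_eq_square)
  show "\<not> int k ^ 2 dvd u"
  proof
    assume "int k ^ 2 dvd u"
    then have "int k ^ 2 dvd int k" unfolding j by (simp add: dvd_add_left_iff)
    then have "k ^ 2 dvd k" by (metis int_dvd_int_iff of_nat_power)
    then have "k ^ 2 \<le> k" using assms(1) by (intro dvd_imp_le) (auto simp: prime_gt_0_nat)
    then show False using prime_gt_1_nat[OF assms(1)] by (simp add: power2_eq_square)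
  qed
qed

lemma odd_square_mod_8:
  assumes "odd (m::nat)" shows "m ^ 2 mod 8 = 1"
proof -
  have "m mod 8 = 1 \<or> m mod 8 = 3 \<or> m mod 8 = 5 \<or> m mod 8 = 7" using assms by presburger
  then have "(m mod 8) ^ 2 mod 8 = 1" by auto
  then show ?thesis by (simp add: power_mod)
qed

text \<open>Exact divisibility by a prime k is secured by a residue k modulo \<open>k ^ 2\<close>.
  The Chinese remainder theorem combines the three conditions, and adding multiples of
  \<open>N = q^2 * p^2 * l^2\<close> preserves them.\<close>

lemma exists_alt_parameters:
  assumes m: "odd m" "m \<ge> 3" and n: "n = m ^ 2 + 1"
  shows "\<exists>u N. N \<noteq> 0 \<and> (\<forall>t. \<exists>q p l. alt_family n m (u + N * t) q p l)"
proof -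
  have n8: "n mod 8 = 2" using odd_square_mod_8[OF m(1)] n by presburger
  have "3 ^ 2 \<le> m ^ 2" using m(2) by (rule power_mono) simp
  then have n10: "n \<ge> 10" using n by simp
  \<comment> \<open>As n is 2 modulo 8, n div 2 is odd and larger than 1, so any prime factor of it
    is an odd prime factor of n.\<close>
  have "n div 2 \<noteq> 1" using n10 by simp
  then obtain q where q: "prime q" "q dvd n div 2" using prime_factor_nat by blast
  have "odd (n div 2)" using n8 by presburger
  then have qodd: "odd q" using q(2) dvd_trans by blast
  have "n = n div 2 * 2" using n8 by presburger
  then have qn: "q dvd n" using q(2) by (metis dvd_mult2)
  have "m \<noteq> 1" using m by simp
  then obtain p where p: "prime p" "p dvd m" using prime_factor_nat by blast
  obtain l where l: "prime l" "l > n" using bigger_prime by blast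
  have "q \<noteq> p"
  proof
    assume "q = p"
    then have "q dvd m ^ 2" using p(2) by (simp add: power2_eq_square)
    then have "q dvd 1" using qn n by (metis dvd_add_right_iff)
    then show False using q(1) by simp
  qed
  moreover have "q \<le> n" using qn n10 by (intro dvd_imp_le) auto
  moreover have "p \<le> n"
  proof -
    have "p \<le> m" using p(2) m by (intro dvd_imp_le) auto
    also have "m \<le> m ^ 2" by (simp add: power2_eq_square)
    finally show ?thesis using n by simp
  qed
  ultimately have neq: "q \<noteq> p" "q \<noteq> l" "p \<noteq> l" using l(2) by auto
  let ?T = "int n ^ n * (int n - 2) ^ (n - 2)"
  have cop: "coprime (int i ^ 2) (int j ^ 2)" if "prime i" "prime j" "i \<noteq> j" for i j
  proof -
    have "coprime i j" using primes_coprime[OF that] .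
    then show ?thesis by simp
  qed
  obtain x where x: "[x = int q] (mod int q ^ 2)" "[x = int p] (mod int p ^ 2)"
    using binary_chinese_remainder_int[OF cop[OF q(1) p(1) neq(1)]] by blast
  have "coprime (int q ^ 2 * int p ^ 2) (int l ^ 2)"
    using cop[OF q(1) l(1) neq(2)] cop[OF p(1) l(1) neq(3)] by (simp only: coprime_mult_left_iff)
  then obtain u where u: "[u = x] (mod (int q ^ 2 * int p ^ 2))" "[u = int l - ?T] (mod int l ^ 2)"
    using binary_chinese_remainder_int by blast
  define N where "N = int q ^ 2 * int p ^ 2 * int l ^ 2"
  have N0: "N \<noteq> 0" using q p l by (auto simp: N_def)
  have N: "int q ^ 2 dvd N" "int p ^ 2 dvd N" "int l ^ 2 dvd N" by (simp_all add: N_def)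
  have "alt_family n m (u + N * t) q p l" for t
  proof
    have Nt: "[u + N * t = u] (mod k)" if "k dvd N" for k
      using that by (simp add: cong_iff_dvd_diff)
    have "[u + N * t = int q] (mod int q ^ 2)"
      using Nt[OF N(1)] cong_dvd_modulus[OF u(1), of "int q ^ 2"] x(1) by (metis cong_trans dvd_triv_left)
    from cong_prime_square[OF q(1) this] show "int q dvd u + N * t" "\<not> int q ^ 2 dvd u + N * t" .
    have "[u + N * t = int p] (mod int p ^ 2)"
      using Nt[OF N(2)] cong_dvd_modulus[OF u(1), of "int p ^ 2"] x(2) by (metis cong_trans dvd_triv_right)
    from cong_prime_square[OF p(1) this] show "int p dvd u + N * t" "\<not> int p ^ 2 dvd u + N * t" .
    have "[u + N * t = int l - ?T] (mod int l ^ 2)" using Nt[OF N(3)] u(2) by (rule cong_trans)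
    then have "[u + N * t + ?T = int l - ?T + ?T] (mod int l ^ 2)" by (rule cong_add) simp
    then have "[u + N * t + ?T = int l] (mod int l ^ 2)" by simp
    from cong_prime_square[OF l(1) this] show "int l dvd u + N * t + ?T" "\<not> int l ^ 2 dvd u + N * t + ?T" .
  qed (use n8 n10 n q p l qodd qn in auto)
  then show ?thesis using N0 by blast
qed

theorem theorem1p2:
  fixes n :: nat
  assumes "even n" and "n > 0" and "is_square (n - 1)"
  shows "\<exists>P Q :: int poly.
    lead_coeff P = 1 \<and> degree P = n \<and> Q \<noteq> 0 \<and> degree Q \<le> n - 1 \<and>
    (\<forall>t :: int. galois_group (map_poly rat_of_int (P - smult t Q)) \<cong> alt_group n)"
proof -
  obtain m where "n - 1 = m ^ 2" using assms(3) by (auto simp: is_nth_power_def)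
  then have n: "n = m ^ 2 + 1" using assms(2) by simp
  then have odd: "odd m" using assms(1) by simp
  show ?thesis
  proof (cases "m = 1")
    case True
    then have n2: "n = 2" using n by simp
    show ?thesis
    proof (intro exI conjI allI)
      show "lead_coeff ([:0, 0, 1:] :: int poly) = 1" "degree ([:0, 0, 1:] :: int poly) = n"
        "([:0, 1:] :: int poly) \<noteq> 0" "degree ([:0, 1:] :: int poly) \<le> n - 1"
        by (simp_all add: n2)
      show "galois_group (map_poly rat_of_int ([:0, 0, 1:] - smult t [:0, 1:])) \<cong> alt_group n" for t
        using galois_group_two[of t] by (simp add: n2)
    qed
  next
    case False
    have "m \<noteq> 0" "m \<noteq> 2" using odd_pos[OF odd] odd by auto
    then have m3: "m \<ge> 3" using False by linarith
    obtain u N where N: "N \<noteq> 0" and fam: "\<And>t. \<exists>q p l. alt_family n m (u + N * t) q p l"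
      using exists_alt_parameters[OF odd m3 n] by blast
    then have n10: "n \<ge> 10" by (meson alt_family.n_ge)
    \<comment> \<open>\<open>family n u\<close> is affine in u, so subtracting
      \<open>smult t Q\<close> amounts to replacing u by \<open>u + N * t\<close>.\<close>
    define Q where "Q = smult N [:- ((int n - 2) ^ 2), 1:]"
    show ?thesis
    proof (intro exI conjI allI)
      show "lead_coeff (family n u) = 1" "degree (family n u) = n"
        using n10 lead_coeff_family degree_family by auto
      show "Q \<noteq> 0" "degree Q \<le> n - 1" using N n10 by (auto simp: Q_def)
      fix t
      obtain q p l where "alt_family n m (u + N * t) q p l" using fam by blast
      then interpret alt_family n m "u + N * t" q p l .
      have "family n u - smult t Q = family n (u + N * t)"
        by (simp add: family_def Q_def smult_add_left algebra_simps)
      then show "galois_group (map_poly rat_of_int (family n u - smult t Q)) \<cong> alt_group n"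
        using galois_group_F by (simp add: F_def)
    qed
  qed
qed

end
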